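(* Let $\tau>0$, $\mu_j>0$, $\lambda_j>0$ and let $R_j$ ($j=1,\dots,J$) be as in the context, and let $\Phi(\bm Z)=\tau f(\bm x)+\sum_{j=1}^J\big(\frac{\mu_j}{2}\|\bm Y_j-R_j(\bm x)\|_F^2+\lambda_j\sum_{i=1}^{m_j}g(\sigma_i(\bm Y_j))\big)$ for $\bm Z=(\bm x,\bm Y_1,\dots,\bm Y_J)$. Suppose that: $f:\mathbb R^N\to(-\infty,+\infty]$ is proper, lower semicontinuous and $\inf f>-\infty$; $g:[0,\infty)\to\mathbb R$ is monotonically increasing, concave (and nonconvex), and continuously differentiable with $L_g$-Lipschitz continuous derivative on $[0,\infty)$; $\Phi$ is coercive, i.e. $\Phi(\bm Z)\to+\infty$ as $\|\bm Z\|\to\infty$. Let $\{\bm Z^k\}_{k\in\mathbb N}$ be a sequence generated by the PARM algorithm (defined in the context) with parameters satisfying $0<\alpha_-\le\alpha_{jk}\le\alpha_+$ and $0<\beta_-\le\beta_k\le\beta_+$ for all $j=1,\dots,J$ and $k\in\mathbb N$, where $\alpha_\pm,\beta_\pm$ are constants. If $\Phi$ is a Kurdyka-\L ojasiewicz (KL) function, then: (a) $\{\bm Z^k\}_{k\in\mathbb N}$ has finite length, that is, $\sum_{k=0}^\infty\|\bm Z^{k+1}-\bm Z^k\|<\infty$; (b) $\{\bm Z^k\}_{k\in\mathbb N}$ converges to a critical point of $\Phi$.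
   Context: Setting. $N,J\ge1$ and $m_j\le n_j$ ($j=1,\dots,J$) are positive integers. $R_j:\mathbb R^N\to\mathbb R^{m_j\times n_j}$ are fixed linear operators ((possibly normalized) extraction of the $j$th patch matrix from an image), and $R_j^\top$ is the adjoint: $\langle R_j(\bm x),\bm Y\rangle_F=\langle\bm x,R_j^\top(\bm Y)\rangle$. Standing assumption: $\bm W:=\sum_{j=1}^J\mu_jR_j^\top\circ R_j$ is a symmetric positive definite $N\times N$ matrix. $\langle\bm x,\bm y\rangle_{\bm W}=\langle\bm x,\bm W\bm y\rangle$, $\|\bm x\|_{\bm W}^2=\langle\bm x,\bm x\rangle_{\bm W}$; $\|\cdot\|_F$ is the Frobenius norm; $\sigma_i(\bm Y)$ is the $i$th largest singular value of $\bm Y$. Variables $\bm Z=(\bm x,\bm Y_1,\dots,\bm Y_J)$ with $\bm x\in\mathbb R^N$, $\bm Y_j\in\mathbb R^{m_j\times n_j}$, normed by $\|\bm Z\|=\sqrt{\|\bm x\|_{\bm W}^2+\sum_j\|\bm Y_j\|_F^2}$. PARM algorithm. Starting from an initial point $\bm Z^0=(\bm x^0,\bm Y_1^0,\dots,\bm Y_J^0)$, for $k=0,1,2,\dots$ put $(w_j^k)_i=g'(\sigma_i(\bm Y_j^k))$, $i=1,\dots,m_j$, and choose $$\bm Y_j^{k+1}\in\arg\min_{\bm Y_j}\ \frac{\mu_j}{2}\|\bm Y_j-R_j(\bm x^k)\|_F^2+\lambda_j\sum_{i=1}^{m_j}(w_j^k)_i\,\sigma_i(\bm Y_j)+\frac{\alpha_{jk}}{2}\|\bm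 Y_j-\bm Y_j^k\|_F^2,\quad j=1,\dots,J,$$ $$\bm x^{k+1}\in\arg\min_{\bm x}\ \Phi(\bm x,\bm Y_1^{k+1},\dots,\bm Y_J^{k+1})+\frac{\beta_k}{2}\|\bm x-\bm x^k\|_{\bm W}^2 .$$ Then $\bm Z^{k+1}=(\bm x^{k+1},\bm Y_1^{k+1},\dots,\bm Y_J^{k+1})$. Subdifferential. For a proper lower semicontinuous $h$ on a finite-dimensional inner product space, the Fréchet subdifferential $\hat\partial h(x)$ at $x\in\operatorname{dom}h$ is the set of $u$ with $\liminf_{y\to x,\,y\ne x}\frac{h(y)-h(x)-\langle u,y-x\rangle}{\|y-x\|}\ge0$ (and $\hat\partial h(x)=\emptyset$ if $x\notin\operatorname{dom}h$); the (limiting) subdifferential $\partial h(x)$ is the set of $u$ for which there are $x_k\to x$ with $h(x_k)\to h(x)$ and $u_k\in\hat\partial h(x_k)$ with $u_k\to u$. The $\bm x$-variable uses the inner product $\langle\cdot,\cdot\rangle_{\bm W}$ and the $\bm Y_j$-variables the Frobenius inner product; $\partial\Phi(\bm Z)$ is the set of $(\bm A_{\bm x},\bm A_{\bm Y_1},\dots,\bm A_{\bm Y_J})$ with $\bm A_{\bm x}$ in the partial subdifferential of $\Phi$ with respect to $\bm x$ and $\bm A_{\bm Y_j}$ in the partial subdifferential with respect to $\bm Y_j$. A critical point of $\Phi$ is a $\bm Z$ with $\bm 0\in\partial\Phi(\bm Z)$. KL function. A proper lower semicontinuous $h$ has the KL property at $\tilde x\in\operatorname{dom}\partial h$ if there exist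 $\eta\in(0,+\infty]$, a neighborhood $U$ of $\tilde x$, and a continuous $\varphi:[0,\eta)\to[0,\infty)$ with $\varphi(0)=0$, $\varphi$ being $C^1$ on $(0,\eta)$ with $\varphi'>0$ there, such that $\varphi'(h(x)-h(\tilde x))\operatorname{dist}(0,\partial h(x))\ge1$ for all $x\in U$ with $h(\tilde x)<h(x)<h(\tilde x)+\eta$. $h$ is a KL function if it has the KL property at every point of $\operatorname{dom}\partial h$. *)

theory Defs
  imports "HOL-Analysis.Analysis" "Jordan_Normal_Form.Char_Poly"
begin

definition proper :: "('a \<Rightarrow> ereal) \<Rightarrow> bool" where
  "proper h \<longleftrightarrow> (\<forall>x. h x \<noteq> -\<infinity>) \<and> (\<exists>x. h x \<noteq> \<infinity>)"

definition lower_semicontinuous :: "('a::topological_space \<Rightarrow> ereal) \<Rightarrow> bool" where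
  "lower_semicontinuous h \<longleftrightarrow> (\<forall>x. h x \<le> Liminf (at x) h)"

text \<open>
  A finite-dimensional inner product space is given here by a carrier set \<open>V\<close> and an inner product
  \<open>ip\<close> on it. Type classes do not suffice: \<open>\<real>\<^sup>N\<close> is used with the inner product induced by \<open>W\<close>, and
  the matrices with a fixed number of rows and columns form a subset of the type of all matrices.
\<close>

definition ip_norm :: "('v \<Rightarrow> 'v \<Rightarrow> real) \<Rightarrow> 'v \<Rightarrow> real" where
  "ip_norm ip v = sqrt (ip v v)"

text \<open>The filter of punctured neighbourhoods of \<open>x\<close> in \<open>V\<close>, that is, \<open>y \<rightarrow> x\<close>, \<open>y \<noteq> x\<close>.\<close>

definition ip_at :: "'v::minus set \<Rightarrow> ('v \<Rightarrow> 'v \<Rightarrow> real) \<Rightarrow> 'v \<Rightarrow> 'v filter" where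
  "ip_at V ip x = inf (filtercomap (\<lambda>y. ip_norm ip (y - x)) (at_right 0)) (principal V)"

definition frechet_subdiff ::
    "'v::minus set \<Rightarrow> ('v \<Rightarrow> 'v \<Rightarrow> real) \<Rightarrow> ('v \<Rightarrow> ereal) \<Rightarrow> 'v \<Rightarrow> 'v set" where
  "frechet_subdiff V ip h x =
     (if h x = \<infinity> then {}
      else {u \<in> V. Liminf (ip_at V ip x)
              (\<lambda>y. (h y - h x - ereal (ip u (y - x))) / ereal (ip_norm ip (y - x))) \<ge> 0})"

definition limiting_subdiff ::
    "'v::minus set \<Rightarrow> ('v \<Rightarrow> 'v \<Rightarrow> real) \<Rightarrow> ('v \<Rightarrow> ereal) \<Rightarrow> 'v \<Rightarrow> 'v set" where
  "limiting_subdiff V ip h x =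
     {u \<in> V. \<exists>xs us. (\<forall>k. xs k \<in> V \<and> us k \<in> frechet_subdiff V ip h (xs k)) \<and>
        (\<lambda>k. ip_norm ip (xs k - x)) \<longlonglongrightarrow> 0 \<and>
        (\<lambda>k. h (xs k)) \<longlonglongrightarrow> h x \<and>
        (\<lambda>k. ip_norm ip (us k - u)) \<longlonglongrightarrow> 0}"

definition dom_subdiff :: "'v set \<Rightarrow> ('v \<Rightarrow> 'v set) \<Rightarrow> 'v set" where
  "dom_subdiff V sd = {x \<in> V. sd x \<noteq> {}}"

text \<open>The distance of the origin to \<open>S\<close>; it is \<open>\<infinity>\<close> if \<open>S\<close> is empty.\<close>

definition dist_origin :: "('v \<Rightarrow> real) \<Rightarrow> 'v set \<Rightarrow> ereal" where
  "dist_origin nrm S = (INF u\<in>S. ereal (nrm u))"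

text \<open>
  The KL property of \<open>h\<close> at \<open>x0\<close>, in the space with carrier \<open>V\<close> and norm \<open>nrm\<close>, where \<open>sd\<close> is the
  subdifferential of \<open>h\<close>; \<open>\<psi>\<close> is the derivative of the desingularizing function \<open>\<phi>\<close>.
\<close>

definition KL_property_at ::
    "'v::minus set \<Rightarrow> ('v \<Rightarrow> real) \<Rightarrow> ('v \<Rightarrow> 'v set) \<Rightarrow> ('v \<Rightarrow> ereal) \<Rightarrow> 'v \<Rightarrow> bool" where
  "KL_property_at V nrm sd h x0 \<longleftrightarrow>
     (\<exists>(\<eta>::ereal) (r::real) (\<phi>::real \<Rightarrow> real) \<psi>.
        \<eta> > 0 \<and> r > 0 \<and>
        continuous_on {s. 0 \<le> s \<and> ereal s < \<eta>} \<phi> \<and>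
        (\<forall>s. 0 \<le> s \<and> ereal s < \<eta> \<longrightarrow> 0 \<le> \<phi> s) \<and> \<phi> 0 = 0 \<and>
        (\<forall>s. 0 < s \<and> ereal s < \<eta> \<longrightarrow> (\<phi> has_real_derivative \<psi> s) (at s) \<and> \<psi> s > 0) \<and>
        continuous_on {s. 0 < s \<and> ereal s < \<eta>} \<psi> \<and>
        (\<forall>x\<in>V. nrm (x - x0) < r \<and> h x0 < h x \<and> h x < h x0 + \<eta> \<longrightarrow>
           ereal (\<psi> (real_of_ereal (h x - h x0))) * dist_origin nrm (sd x) \<ge> 1))"

definition KL_function ::
    "'v::minus set \<Rightarrow> ('v \<Rightarrow> real) \<Rightarrow> ('v \<Rightarrow> 'v set) \<Rightarrow> ('v \<Rightarrow> ereal) \<Rightarrow> bool" where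
  "KL_function V nrm sd h \<longleftrightarrow> (\<forall>x\<in>dom_subdiff V sd. KL_property_at V nrm sd h x)"

definition frob_inner :: "real mat \<Rightarrow> real mat \<Rightarrow> real" where
  "frob_inner A B = (\<Sum>i<dim_row A. \<Sum>l<dim_col A. A $$ (i, l) * B $$ (i, l))"

abbreviation frob_norm :: "real mat \<Rightarrow> real" where
  "frob_norm \<equiv> ip_norm frob_inner"

text \<open>
  \<open>singular_value Y i\<close> is the \<open>i\<close>th largest singular value (\<open>i \<ge> 1\<close>, counted with multiplicity) of a
  matrix \<open>Y\<close> with at most as many rows as columns, i.e. the square root of the \<open>i\<close>th largest eigenvalue
  of \<open>Y Y\<^sup>T\<close>. As \<open>Y Y\<^sup>T\<close> is symmetric, its characteristic polynomial has \<open>dim_row Y\<close> real roots.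
\<close>

definition singular_value :: "real mat \<Rightarrow> nat \<Rightarrow> real" where
  "singular_value Y i =
     sqrt (rev (sorted_list_of_multiset (proots (char_poly (Y * transpose_mat Y)))) ! (i - 1))"

definition linear_to_mat :: "nat \<Rightarrow> nat \<Rightarrow> (real^'N \<Rightarrow> real mat) \<Rightarrow> bool" where
  "linear_to_mat p q R \<longleftrightarrow>
     (\<forall>x. R x \<in> carrier_mat p q) \<and>
     (\<forall>x y. R (x + y) = R x + R y) \<and>
     (\<forall>c x. R (c *\<^sub>R x) = c \<cdot>\<^sub>m R x)"

definition adjoint_of :: "(real^'N \<Rightarrow> real mat) \<Rightarrow> real mat \<Rightarrow> real^'N" where
  "adjoint_of R Y = (THE v. \<forall>x. frob_inner (R x) Y = x \<bullet> v)"

definition W_matrix ::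
    "nat \<Rightarrow> (nat \<Rightarrow> real) \<Rightarrow> (nat \<Rightarrow> real^'N \<Rightarrow> real mat) \<Rightarrow> real^'N^'N" where
  "W_matrix J \<mu> R = matrix (\<lambda>x. \<Sum>j=1..J. \<mu> j *\<^sub>R adjoint_of (R j) (R j x))"

definition sym_pos_def :: "real^'N^'N \<Rightarrow> bool" where
  "sym_pos_def A \<longleftrightarrow> Finite_Cartesian_Product.transpose A = A \<and> (\<forall>x. x \<noteq> 0 \<longrightarrow> x \<bullet> (A *v x) > 0)"

definition inner_W :: "real^'N^'N \<Rightarrow> real^'N \<Rightarrow> real^'N \<Rightarrow> real" where
  "inner_W W x y = x \<bullet> (W *v y)"

abbreviation norm_W :: "real^'N^'N \<Rightarrow> real^'N \<Rightarrow> real" where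
  "norm_W W \<equiv> ip_norm (inner_W W)"

type_synonym 'N var = "(real^'N) \<times> (nat \<Rightarrow> real mat)"

definition Z_space :: "nat \<Rightarrow> (nat \<Rightarrow> nat) \<Rightarrow> (nat \<Rightarrow> nat) \<Rightarrow> 'N::finite var set" where
  "Z_space J m n = UNIV \<times> (\<Pi>\<^sub>E j\<in>{1..J}. carrier_mat (m j) (n j))"

definition Z_zero :: "nat \<Rightarrow> (nat \<Rightarrow> nat) \<Rightarrow> (nat \<Rightarrow> nat) \<Rightarrow> 'N::finite var" where
  "Z_zero J m n = (0, \<lambda>j\<in>{1..J}. 0\<^sub>m (m j) (n j))"

definition Z_norm :: "nat \<Rightarrow> real^'N^'N \<Rightarrow> 'N var \<Rightarrow> real" where
  "Z_norm J W Z = sqrt ((norm_W W (fst Z))\<^sup>2 + (\<Sum>j=1..J. (frob_norm (snd Z j))\<^sup>2))"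

definition Phi ::
    "nat \<Rightarrow> (nat \<Rightarrow> nat) \<Rightarrow> real \<Rightarrow> (nat \<Rightarrow> real) \<Rightarrow> (nat \<Rightarrow> real) \<Rightarrow> (nat \<Rightarrow> real^'N \<Rightarrow> real mat) \<Rightarrow>
     (real^'N \<Rightarrow> ereal) \<Rightarrow> (real \<Rightarrow> real) \<Rightarrow> 'N var \<Rightarrow> ereal" where
  "Phi J m \<tau> \<mu> lam R f g Z =
     ereal \<tau> * f (fst Z) +
     ereal (\<Sum>j=1..J. \<mu> j / 2 * (frob_norm (snd Z j - R j (fst Z)))\<^sup>2 +
                      lam j * (\<Sum>i=1..m j. g (singular_value (snd Z j) i)))"

definition Z_coercive ::
    "nat \<Rightarrow> (nat \<Rightarrow> nat) \<Rightarrow> (nat \<Rightarrow> nat) \<Rightarrow> real^'N^'N \<Rightarrow> ('N var \<Rightarrow> ereal) \<Rightarrow> bool" where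
  "Z_coercive J m n W h \<longleftrightarrow>
     (h \<longlongrightarrow> \<infinity>) (inf (filtercomap (Z_norm J W) at_top) (principal (Z_space J m n)))"

text \<open>The subdifferential on the product space is the product of the partial limiting subdifferentials.\<close>

definition Z_subdiff ::
    "nat \<Rightarrow> (nat \<Rightarrow> nat) \<Rightarrow> (nat \<Rightarrow> nat) \<Rightarrow> real^'N^'N \<Rightarrow> ('N var \<Rightarrow> ereal) \<Rightarrow> 'N var \<Rightarrow> 'N var set" where
  "Z_subdiff J m n W h Z =
     {A \<in> Z_space J m n.
        fst A \<in> limiting_subdiff UNIV (inner_W W) (\<lambda>x. h (x, snd Z)) (fst Z) \<and>
        (\<forall>j\<in>{1..J}. snd A j \<in>
           limiting_subdiff (carrier_mat (m j) (n j)) frob_inner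
             (\<lambda>M. h (fst Z, (snd Z)(j := M))) (snd Z j))}"

definition critical_point ::
    "nat \<Rightarrow> (nat \<Rightarrow> nat) \<Rightarrow> (nat \<Rightarrow> nat) \<Rightarrow> real^'N^'N \<Rightarrow> ('N var \<Rightarrow> ereal) \<Rightarrow> 'N var \<Rightarrow> bool" where
  "critical_point J m n W h Z \<longleftrightarrow> Z \<in> Z_space J m n \<and> Z_zero J m n \<in> Z_subdiff J m n W h Z"

text \<open>\<open>g'\<close> stands for the derivative of \<open>g\<close> on \<open>[0,\<infinity>)\<close> (one-sided at \<open>0\<close>).\<close>

definition PARM_sequence ::
    "nat \<Rightarrow> (nat \<Rightarrow> nat) \<Rightarrow> (nat \<Rightarrow> nat) \<Rightarrow> real \<Rightarrow> (nat \<Rightarrow> real) \<Rightarrow> (nat \<Rightarrow> real) \<Rightarrow>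
     (nat \<Rightarrow> real^'N \<Rightarrow> real mat) \<Rightarrow> (real^'N \<Rightarrow> ereal) \<Rightarrow> (real \<Rightarrow> real) \<Rightarrow> (real \<Rightarrow> real) \<Rightarrow>
     (nat \<Rightarrow> nat \<Rightarrow> real) \<Rightarrow> (nat \<Rightarrow> real) \<Rightarrow> (nat \<Rightarrow> 'N var) \<Rightarrow> bool" where
  "PARM_sequence J m n \<tau> \<mu> lam R f g g' \<alpha> \<beta> Z \<longleftrightarrow>
     (\<forall>k. Z k \<in> Z_space J m n) \<and>
     (\<forall>k. \<forall>j\<in>{1..J}.
        is_arg_min
          (\<lambda>M. \<mu> j / 2 * (frob_norm (M - R j (fst (Z k))))\<^sup>2 +
               lam j * (\<Sum>i=1..m j. g' (singular_value (snd (Z k) j) i) * singular_value M i) +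
               \<alpha> j k / 2 * (frob_norm (M - snd (Z k) j))\<^sup>2)
          (\<lambda>M. M \<in> carrier_mat (m j) (n j))
          (snd (Z (Suc k)) j)) \<and>
     (\<forall>k. is_arg_min
          (\<lambda>x. Phi J m \<tau> \<mu> lam R f g (x, snd (Z (Suc k))) +
               ereal (\<beta> k / 2 * (norm_W (W_matrix J \<mu> R) (x - fst (Z k)))\<^sup>2))
          (\<lambda>x. True)
          (fst (Z (Suc k))))"

end

theory Submission
  imports Defs
begin

text \<open>
  Concavity of \<open>g\<close>, Lipschitz continuity of \<open>g'\<close> and Weyl's inequality
  \<open>\<bar>\<sigma>\<^sub>i(A) - \<sigma>\<^sub>i(B)\<bar> \<le> \<parallel>A - B\<parallel>\<^sub>F\<close> turn the two minimality conditions of a PARM step into a single inequality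
  \<open>\<Phi>(Z\<^sup>k\<^sup>+\<^sup>1) + c \<parallel>Z\<^sup>k\<^sup>+\<^sup>1 - Z\<^sup>k\<parallel>\<^sup>2 \<le> \<Phi>(z) + C \<parallel>z - Z\<^sup>k\<parallel>\<^sup>2\<close>, valid for every \<open>z\<close>: the iteration is an inexact
  proximal point method. Taking \<open>z = Z\<^sup>k\<close> gives descent; passing to the limit shows that a limit point \<open>Z\<^sup>*\<close>
  minimizes \<open>\<Phi>\<close> up to \<open>C \<parallel>z - Z\<^sup>*\<parallel>\<^sup>2\<close> and is therefore critical. The KL property at \<open>Z\<^sup>*\<close> provides, near \<open>Z\<^sup>*\<close>,
  points \<open>z\<close> with \<open>\<Phi>(z) \<le> \<Phi>(Z\<^sup>k\<^sup>+\<^sup>1)\<close> at distance at most a multiple of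
  \<open>\<phi>(\<Phi>(Z\<^sup>k) - \<Phi>(Z\<^sup>*)) - \<phi>(\<Phi>(Z\<^sup>k\<^sup>+\<^sup>1) - \<Phi>(Z\<^sup>*))\<close> from \<open>Z\<^sup>k\<close>; inserting them bounds the step lengths by a telescoping sum.
\<close>

section \<open>Singular values and Weyl's inequality\<close>

text \<open>As \<open>g\<close> is concave, the weights \<open>g' (singular_value Y i)\<close> do
  not decrease with \<open>i\<close> while the singular values do not increase, so the weighted term
  of a matrix subproblem is in general not convex and its subgradients are awkward to control. The
  proof therefore compares function values with an arbitrary competitor and computes no subgradient
  along the iterates.

  A second obstacle is that the matrices are updated with the old image: their minimality speaks of
  the coupling at \<open>fst (Z k)\<close>, whereas the image step needs it at \<open>fst z\<close>.
  The exchange costs a product of two distances, which half of the proximal term of the matrices and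
  a multiple of the squared distance from \<open>z\<close> to \<open>Z k\<close> absorb.

  The points that the KL property provides are minimizers of a truncated \<open>\<phi>\<close> of
  the objective plus a smoothed distance: a minimizer above the wanted level would carry a
  subgradient too short for the KL inequality.\<close>

definition dotn :: "nat \<Rightarrow> (nat \<Rightarrow> real) \<Rightarrow> (nat \<Rightarrow> real) \<Rightarrow> real" where
  "dotn m x y = (\<Sum>a<m. x a * y a)"

definition quadn :: "nat \<Rightarrow> (nat \<Rightarrow> nat \<Rightarrow> real) \<Rightarrow> (nat \<Rightarrow> real) \<Rightarrow> real" where
  "quadn m A x = (\<Sum>a<m. \<Sum>b<m. A a b * x b * x a)"

lemma dotn_self_nonneg: "dotn m x x \<ge> 0"
  by (auto simp: dotn_def intro: sum_nonneg)

lemma dotn_self_pos: "a < m \<Longrightarrow> x a \<noteq> 0 \<Longrightarrow> dotn m x x > 0"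
  unfolding dotn_def
  by (rule sum_pos2[of _ a]) (auto simp: zero_less_mult_iff)

text \<open>Zero rows pad the \<open>k\<close> constraints to a square matrix. Its last row is zero
  because \<open>k < m\<close>, so the last unit vector lies in the kernel of the transpose, the
  determinant vanishes, and a kernel vector of the matrix itself is the required
  \<open>x\<close>.\<close>

lemma exists_nonzero_orthogonal:
  assumes "k < m"
  shows "\<exists>x. (\<exists>a<m. x a \<noteq> 0) \<and> (\<forall>i<k. dotn m x (u i) = 0)"
proof -
  define M :: "real mat" where "M = mat m m (\<lambda>(i, a). if i < k then u i a else 0)"
  have M: "M \<in> carrier_mat m m" by (simp add: M_def)
  have "transpose_mat M *\<^sub>v unit_vec m (m - 1) = 0\<^sub>v m"
    using assms by (intro eq_vecI) (auto simp: M_def)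
  moreover have "unit_vec m (m - 1) \<noteq> (0\<^sub>v m :: real vec)"
    using assms unit_vec_nonzero by auto
  ultimately have "det (transpose_mat M) = 0"
    using det_0_iff_vec_prod_zero[of "transpose_mat M" m] M by (metis transpose_carrier_mat unit_vec_carrier)
  then have "det M = 0"
    using det_transpose[OF M] by simp
  then obtain v where v: "v \<in> carrier_vec m" "v \<noteq> 0\<^sub>v m" "M *\<^sub>v v = 0\<^sub>v m"
    using det_0_iff_vec_prod_zero[OF M] by auto
  have 1: "\<exists>a<m. v $ a \<noteq> 0"
    using v(1,2) by (metis carrier_vecD eq_vecI index_zero_vec)
  have "dotn m (\<lambda>a. v $ a) (u i) = 0" if "i < k" for i
  proof -
    have "(M *\<^sub>v v) $ i = 0" using v(3) that assms by simp
    moreover have "(M *\<^sub>v v) $ i = (\<Sum>a<m. M $$ (i, a) * v $ a)"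
      using that assms M v(1) by (auto simp: scalar_prod_def atLeast0LessThan intro!: sum.cong)
    moreover have "\<dots> = dotn m (\<lambda>a. v $ a) (u i)"
      using that assms unfolding dotn_def M_def by (intro sum.cong) auto
    ultimately show ?thesis by simp
  qed
  with 1 show ?thesis by (intro exI[of _ "\<lambda>a. v $ a"]) auto
qed

text \<open>The maximum is attained on a compact set of unit vectors and carried over to every
  admissible \<open>y\<close> by homogeneity of degree two.\<close>

lemma quadn_attains_max:
  assumes "k < m"
  shows "\<exists>x. dotn m x x = 1 \<and> (\<forall>i<k. dotn m x (u i) = 0) \<and>
    (\<forall>y. (\<forall>i<k. dotn m y (u i) = 0) \<longrightarrow> quadn m A y \<le> quadn m A x * dotn m y y)"
proof -
  \<comment> \<open>Vectors are functions on all naturals: pinning the coordinates from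
    \<open>m\<close> on to 0 places \<open>K\<close> in a compact product. The box excludes nothing,
    since the entries of a unit vector lie in [-1, 1].\<close>
  define K where "K = {x. (\<forall>a. x a \<in> (if a < m then {-1..1} else {0})) \<and> dotn m x x = 1 \<and> (\<forall>i<k. dotn m x (u i) = 0)}"
  have cont_coord: "continuous_on S (\<lambda>x::nat \<Rightarrow> real. x a)" for S a
    by (rule continuous_on_subset[OF continuous_on_product_coordinates]) auto
  have cdot: "continuous_on S (\<lambda>x. dotn m x (v x))" if "\<And>a. continuous_on S (\<lambda>x. v x a)" for S v
    unfolding dotn_def by (intro continuous_intros cont_coord that)
  have cquad: "continuous_on S (quadn m A)" for S
    unfolding quadn_def[abs_def] by (intro continuous_intros cont_coord)
  have "K = (PiE UNIV (\<lambda>a. if a < m then {-1..1::real} else {0})) \<inter>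
      ({x. dotn m x x = 1} \<inter> (\<Inter>i\<in>{..<k}. {x. dotn m x (u i) = 0}))"
    unfolding K_def PiE_UNIV_domain Pi_iff by blast
  moreover have "compact (PiE UNIV (\<lambda>a. if a < m then {-1..1::real} else {0}))"
    by (subst compactin_euclidean_iff[symmetric], subst euclidean_product_topology[symmetric],
        subst compactin_PiE) auto
  moreover have "closed {x. dotn m x x = 1}"
    by (intro closed_Collect_eq cdot cont_coord continuous_on_const)
  moreover have "closed {x. dotn m x (u i) = 0}" for i
    by (intro closed_Collect_eq cdot cont_coord continuous_on_const)
  ultimately have "compact K"
    by (metis (no_types, lifting) closed_INT closed_Int compact_Int_closed)
  have normalize: "\<exists>c>0. dotn m y y = c\<^sup>2 \<and> (\<lambda>a. if a < m then y a / c else 0) \<in> K"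
    if y: "dotn m y y \<noteq> 0" "\<forall>i<k. dotn m y (u i) = 0" for y
  proof -
    define c where "c = sqrt (dotn m y y)"
    define z where "z = (\<lambda>a. if a < m then y a / c else 0)"
    have c: "c > 0" "dotn m y y = c\<^sup>2"
      using y(1) dotn_self_nonneg[of m y] by (auto simp: c_def)
    have zz: "dotn m z z = dotn m y y / c\<^sup>2"
      by (auto simp: dotn_def z_def sum_divide_distrib power2_eq_square intro!: sum.cong)
    have zu: "dotn m z (u i) = dotn m y (u i) / c" for i
      by (auto simp: dotn_def z_def sum_divide_distrib intro!: sum.cong)
    have z1: "dotn m z z = 1" using zz c by simp
    have "z a \<in> {-1..1}" if "a < m" for a
    proof -
      have "z a * z a \<le> dotn m z z"
        unfolding dotn_def by (rule member_le_sum) (use that in auto)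
      then have "(z a)\<^sup>2 \<le> 1" using z1 by (simp add: power2_eq_square)
      then have "\<bar>z a\<bar> \<le> 1" by (simp add: abs_square_le_1)
      then show ?thesis by auto
    qed
    then have "z \<in> K"
      using z1 zu y by (auto simp: K_def z_def)
    then show ?thesis using c unfolding z_def by auto
  qed
  obtain x0 where "\<exists>a<m. x0 a \<noteq> 0" "\<forall>i<k. dotn m x0 (u i) = 0"
    using exists_nonzero_orthogonal[OF assms] by blast
  then have "K \<noteq> {}"
    using normalize[of x0] dotn_self_pos[of _ m x0] by fastforce
  then obtain x where x: "x \<in> K" "\<And>y. y \<in> K \<Longrightarrow> quadn m A y \<le> quadn m A x"
    using continuous_attains_sup[OF \<open>compact K\<close> _ cquad] by blast
  have "quadn m A y \<le> quadn m A x * dotn m y y" if y: "\<forall>i<k. dotn m y (u i) = 0" for y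
  proof (cases "dotn m y y = 0")
    case True
    then have "y a = 0" if "a < m" for a using dotn_self_pos[OF that, of y] by force
    then show ?thesis using True by (simp add: quadn_def)
  next
    case False
    then obtain c where c: "c > 0" "dotn m y y = c\<^sup>2" "(\<lambda>a. if a < m then y a / c else 0) \<in> K"
      using normalize y by blast
    have "quadn m A (\<lambda>a. if a < m then y a / c else 0) = quadn m A y / c\<^sup>2"
      by (auto simp: quadn_def sum_divide_distrib power2_eq_square intro!: sum.cong)
    then have "quadn m A y = c\<^sup>2 * quadn m A (\<lambda>a. if a < m then y a / c else 0)"
      using c(1) by simp
    also have "\<dots> \<le> c\<^sup>2 * quadn m A x"
      using x(2)[OF c(3)] by (intro mult_left_mono) auto
    finally show ?thesis unfolding c(2) by (simp add: mult.commute)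
  qed
  then show ?thesis using x(1) by (auto simp: K_def)
qed

text \<open>A maximizer of the quadratic form over the unit sphere of an \<open>A\<close>-invariant subspace is an eigenvector.
  The third conjunct says that \<open>u i\<close> maximizes over the orthogonal complement of its predecessors; it yields
  the ordering of \<open>d\<close> and the upper half of the Courant--Fischer principle.\<close>

lemma greedy_eigenbasis:
  assumes sym: "\<And>a b. a < m \<Longrightarrow> b < m \<Longrightarrow> A a b = A b a" and "k \<le> m"
  shows "\<exists>u d. (\<forall>i<k. \<forall>j<k. dotn m (u i) (u j) = (if i = j then 1 else 0)) \<and>
     (\<forall>i<k. \<forall>a<m. (\<Sum>b<m. A a b * u i b) = d i * u i a) \<and>
     (\<forall>i<k. \<forall>x. (\<forall>l<i. dotn m x (u l) = 0) \<longrightarrow> quadn m A x \<le> d i * dotn m x x)"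
  using \<open>k \<le> m\<close>
proof (induction k)
  case 0
  show ?case by auto
next
  case (Suc k)
  have "k \<le> m" using Suc.prems by simp
  from Suc.IH[OF this] obtain u d where
    IH: "\<forall>i<k. \<forall>j<k. dotn m (u i) (u j) = (if i = j then 1 else 0)"
      "\<forall>i<k. \<forall>a<m. (\<Sum>b<m. A a b * u i b) = d i * u i a"
      "\<forall>i<k. \<forall>x. (\<forall>l<i. dotn m x (u l) = 0) \<longrightarrow> quadn m A x \<le> d i * dotn m x x"
    by blast
  note orth = IH(1)[rule_format] and eig = IH(2)[rule_format]
  obtain x where x1: "dotn m x x = 1" and xu: "\<And>i. i < k \<Longrightarrow> dotn m x (u i) = 0"
    and xmax: "\<And>y. (\<And>i. i < k \<Longrightarrow> dotn m y (u i) = 0) \<Longrightarrow> quadn m A y \<le> quadn m A x * dotn m y y"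
    using quadn_attains_max[of k m u A] Suc.prems by (auto simp: Suc_le_eq)
  define e where "e = quadn m A x"
  \<comment> \<open>The residual of the eigenvalue equation at \<open>x\<close>. Symmetry makes it
    orthogonal to the eigenvectors found so far, so \<open>x + t * y\<close> remains admissible for
    every \<open>t\<close>.\<close>
  define y where "y = (\<lambda>a. (\<Sum>b<m. A a b * x b) - e * x a)"
  have yu: "dotn m y (u i) = 0" if "i < k" for i
  proof -
    have "dotn m y (u i) = (\<Sum>a<m. \<Sum>b<m. A a b * x b * u i a) - e * dotn m x (u i)"
      by (simp add: dotn_def y_def algebra_simps sum_subtractf sum_distrib_left sum_distrib_right)
    also have "(\<Sum>a<m. \<Sum>b<m. A a b * x b * u i a) = (\<Sum>b<m. x b * (\<Sum>a<m. A b a * u i a))"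
      unfolding sum_distrib_left by (subst sum.swap) (auto simp: sym intro!: sum.cong)
    also have "\<dots> = (\<Sum>b<m. x b * (d i * u i b))"
      using eig[OF that] by (intro sum.cong) auto
    also have "\<dots> = d i * dotn m x (u i)"
      by (simp add: dotn_def sum_distrib_left algebra_simps)
    finally show ?thesis using xu[OF that] by simp
  qed
  have xy: "(\<Sum>a<m. \<Sum>b<m. A a b * x b * y a) = e * dotn m x y + dotn m y y"
    by (simp add: dotn_def y_def algebra_simps sum_distrib_left sum_distrib_right sum_subtractf sum.distrib)
  have xy': "(\<Sum>a<m. \<Sum>b<m. A a b * y b * x a) = e * dotn m x y + dotn m y y"
    unfolding xy[symmetric] by (subst sum.swap) (auto simp: sym intro!: sum.cong)
  \<comment> \<open>Maximality along the line through \<open>x\<close> in direction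
    \<open>y\<close>: the inner product of \<open>x\<close> and \<open>y\<close> cancels, and a term
    linear in \<open>t\<close> with coefficient \<open>2 * dotn m y y\<close> is left.\<close>
  have "2 * t * dotn m y y + t\<^sup>2 * quadn m A y \<le> e * t\<^sup>2 * dotn m y y" for t
  proof -
    have "dotn m (\<lambda>a. x a + t * y a) (u i) = 0" if "i < k" for i
    proof -
      have "dotn m (\<lambda>a. x a + t * y a) (u i) = dotn m x (u i) + t * dotn m y (u i)"
        by (simp add: dotn_def algebra_simps sum.distrib sum_distrib_left)
      then show ?thesis using xu yu that by simp
    qed
    then have "quadn m A (\<lambda>a. x a + t * y a) \<le> e * dotn m (\<lambda>a. x a + t * y a) (\<lambda>a. x a + t * y a)"
      using xmax unfolding e_def by blast
    moreover have "quadn m A (\<lambda>a. x a + t * y a) =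
        e + t * (\<Sum>a<m. \<Sum>b<m. A a b * x b * y a) + t * (\<Sum>a<m. \<Sum>b<m. A a b * y b * x a) + t\<^sup>2 * quadn m A y"
      unfolding e_def quadn_def
      by (simp add: algebra_simps sum.distrib sum_distrib_left power2_eq_square)
    moreover have "dotn m (\<lambda>a. x a + t * y a) (\<lambda>a. x a + t * y a) = 1 + 2 * t * dotn m x y + t\<^sup>2 * dotn m y y"
      unfolding x1[symmetric] dotn_def
      by (simp add: algebra_simps sum.distrib sum_distrib_left power2_eq_square)
    ultimately show ?thesis
      unfolding xy xy' by (simp add: algebra_simps)
  qed
  note lin = this
  have "dotn m y y = 0"
  proof (rule ccontr)
    assume "dotn m y y \<noteq> 0"
    then have pos: "dotn m y y > 0" using dotn_self_nonneg[of m y] by simp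
    \<comment> \<open>\<open>c\<close> is a positive bound for the coefficient of the quadratic
      term, and \<open>t\<close> is small enough for the linear term to win.\<close>
    define c where "c = \<bar>e * dotn m y y - quadn m A y\<bar> + 1"
    define t where "t = dotn m y y / c"
    have c: "c > 0" by (simp add: c_def)
    have "t > 0" using pos c by (simp add: t_def)
    have "2 * t * dotn m y y \<le> t\<^sup>2 * (e * dotn m y y - quadn m A y)"
      using lin[of t] by (simp add: algebra_simps)
    also have "\<dots> \<le> t\<^sup>2 * c" by (intro mult_left_mono) (auto simp: c_def)
    finally have "2 * dotn m y y \<le> t * c"
      using \<open>t > 0\<close> by (simp add: power2_eq_square)
    then show False using c pos by (simp add: t_def)
  qed
  then have y0: "y a = 0" if "a < m" for a
    using dotn_self_pos[OF that, of y] by force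
  define u' where "u' = u(k := x)"
  define d' where "d' = d(k := e)"
  have ux: "dotn m (u i) x = 0" if "i < k" for i
    using xu[OF that] by (simp add: dotn_def mult.commute)
  have "\<forall>i<Suc k. \<forall>j<Suc k. dotn m (u' i) (u' j) = (if i = j then 1 else 0)"
    using orth xu ux x1 by (auto simp: u'_def less_Suc_eq)
  moreover have "\<forall>i<Suc k. \<forall>a<m. (\<Sum>b<m. A a b * u' i b) = d' i * u' i a"
    using eig y0 by (auto simp: u'_def d'_def y_def less_Suc_eq)
  moreover have "\<forall>i<Suc k. \<forall>z. (\<forall>l<i. dotn m z (u' l) = 0) \<longrightarrow> quadn m A z \<le> d' i * dotn m z z"
    using IH(3) xmax by (auto simp: u'_def d'_def e_def less_Suc_eq)
  ultimately show ?case by blast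
qed

lemma proots_prod_linear: "proots (\<Prod>a\<leftarrow>xs. [:- a, 1:]) = mset (xs :: real list)"
proof (induction xs)
  case (Cons a xs)
  have "(\<Prod>a\<leftarrow>xs. [:- a, 1:]) \<noteq> (0 :: real poly)" by (auto simp: prod_list_zero_iff)
  then have "proots ([:- a, 1:] * (\<Prod>a\<leftarrow>xs. [:- a, 1:])) = proots [:- a, 1:] + mset xs"
    using Cons by (subst proots_mult) auto
  then show ?case by (simp del: mult_pCons_left)
qed simp

text \<open>A full greedy basis diagonalizes \<open>A\<close> by an orthogonal matrix, which
  identifies the roots of the characteristic polynomial with their multiplicities. For
  \<open>i\<close> at most \<open>j\<close>, \<open>u j\<close> competes in the maximization that
  defines \<open>d i\<close>; hence \<open>d\<close> is decreasing and matches the reversed sorted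
  list of roots entry by entry.\<close>

lemma symmetric_eigenbasis:
  fixes A :: "real mat"
  assumes A: "A \<in> carrier_mat m m" and sym: "\<And>a b. a < m \<Longrightarrow> b < m \<Longrightarrow> A $$ (a, b) = A $$ (b, a)"
  shows "\<exists>u d. (\<forall>i<m. \<forall>j<m. dotn m (u i) (u j) = (if i = j then 1 else 0)) \<and>
     (\<forall>i<m. \<forall>a<m. (\<Sum>b<m. A $$ (a, b) * u i b) = d i * u i a) \<and>
     (\<forall>i<m. \<forall>x. (\<forall>l<i. dotn m x (u l) = 0) \<longrightarrow> quadn m (\<lambda>a b. A $$ (a, b)) x \<le> d i * dotn m x x) \<and>
     rev (sorted_list_of_multiset (proots (char_poly A))) = map d [0..<m]"
proof -
  obtain u d where
    orth0: "\<forall>i<m. \<forall>j<m. dotn m (u i) (u j) = (if i = j then 1 else 0)" and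
    eig0: "\<forall>i<m. \<forall>a<m. (\<Sum>b<m. A $$ (a, b) * u i b) = d i * u i a" and
    max: "\<forall>i<m. \<forall>x. (\<forall>l<i. dotn m x (u l) = 0) \<longrightarrow> quadn m (\<lambda>a b. A $$ (a, b)) x \<le> d i * dotn m x x"
    using greedy_eigenbasis[of m "\<lambda>a b. A $$ (a, b)" m] sym by blast
  note orth = orth0[rule_format] and eig = eig0[rule_format]
  define P where "P = mat m m (\<lambda>(a, i). u i a)"
  define Q where "Q = mat m m (\<lambda>(i, a). u i a)"
  define D where "D = mat m m (\<lambda>(i, j). if i = j then d i else 0)"
  have carr: "P \<in> carrier_mat m m" "Q \<in> carrier_mat m m" "D \<in> carrier_mat m m"
    by (auto simp: P_def Q_def D_def)
  have QP: "Q * P = 1\<^sub>m m"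
    using orth by (intro eq_matI) (auto simp: P_def Q_def scalar_prod_def dotn_def atLeast0LessThan)
  have PQ: "P * Q = 1\<^sub>m m"
    using mat_mult_left_right_inverse[OF carr(2,1) QP] .
  have AP: "A * P = P * D"
  proof (intro eq_matI)
    fix a i assume "a < dim_row (P * D)" "i < dim_col (P * D)"
    then have *: "a < m" "i < m" by (auto simp: P_def D_def)
    have "(A * P) $$ (a, i) = (\<Sum>b<m. A $$ (a, b) * u i b)"
      using * A by (auto simp: P_def scalar_prod_def atLeast0LessThan intro!: sum.cong)
    also have "\<dots> = (\<Sum>l<m. u l a * (if l = i then d l else 0))"
      using eig[OF *(2,1)] * by (simp add: if_distrib cong: if_cong)
    also have "\<dots> = (P * D) $$ (a, i)"
      using * by (auto simp: P_def D_def scalar_prod_def atLeast0LessThan intro!: sum.cong)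
    finally show "(A * P) $$ (a, i) = (P * D) $$ (a, i)" .
  qed (use A carr in auto)
  have "A = A * (P * Q)" using A PQ by simp
  also have "\<dots> = P * D * Q" using A carr AP by (metis assoc_mult_mat)
  finally have "similar_mat_wit A D P Q"
    using A carr PQ QP by (auto simp: similar_mat_wit_def Let_def)
  then have "char_poly A = char_poly D"
    unfolding similar_mat_def by (intro char_poly_similar) (auto simp: similar_mat_def)
  also have "\<dots> = (\<Prod>a\<leftarrow>diag_mat D. [:- a, 1:])"
    by (rule char_poly_upper_triangular[OF carr(3)]) (auto simp: D_def)
  also have "diag_mat D = map d [0..<m]"
    by (auto simp: diag_mat_def D_def)
  finally have roots: "proots (char_poly A) = mset (map d [0..<m])"
    by (simp only: proots_prod_linear)
  have quad: "quadn m (\<lambda>a b. A $$ (a, b)) (u j) = d j" if "j < m" for j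
  proof -
    have "quadn m (\<lambda>a b. A $$ (a, b)) (u j) = (\<Sum>a<m. d j * u j a * u j a)"
      unfolding quadn_def using eig[OF that] by (auto simp flip: sum_distrib_right intro!: sum.cong)
    also have "\<dots> = d j * dotn m (u j) (u j)" by (simp add: dotn_def sum_distrib_left mult.assoc)
    finally show ?thesis using orth[OF that that] by simp
  qed
  have anti: "d j \<le> d i" if "i \<le> j" "j < m" for i j
    using max[rule_format, of i "u j"] quad[of j] orth that by auto
  have "sorted (rev (map d [0..<m]))"
    using anti by (auto simp: sorted_iff_nth_mono rev_nth)
  then have "sort (map d [0..<m]) = rev (map d [0..<m])"
    by (intro properties_for_sort) auto
  then have "rev (sorted_list_of_multiset (proots (char_poly A))) = map d [0..<m]"
    unfolding roots sorted_list_of_multiset_mset by simp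
  then show ?thesis using orth0 eig0 max by blast
qed

section \<open>Left singular vectors and Weyl's inequality\<close>

text \<open>The squared length of the row vector x^T Y is the quadratic form of Y Y^T at x, so the
  \<open>u i\<close> are eigenvectors of Y Y^T. Working with the rows x^T Y avoids right singular
  vectors. \<open>Suc i\<close> appears because singular values are counted from 1 and the basis
  from 0.\<close>

lemma singular_vectors:
  assumes Y: "Y \<in> carrier_mat m n"
  shows "\<exists>u. (\<forall>i<m. \<forall>j<m. dotn m (u i) (u j) = (if i = j then 1 else 0)) \<and>
     (\<forall>i<m. singular_value Y (Suc i) \<ge> 0) \<and>
     (\<forall>i<m. \<forall>j\<le>i. singular_value Y (Suc i) \<le> singular_value Y (Suc j)) \<and>
     (\<forall>i<m. \<forall>j<m. dotn n (\<lambda>b. \<Sum>a<m. u i a * Y $$ (a, b)) (\<lambda>b. \<Sum>a<m. u j a * Y $$ (a, b)) =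
        (if i = j then (singular_value Y (Suc i))\<^sup>2 else 0)) \<and>
     (\<forall>i<m. \<forall>x. (\<forall>l<i. dotn m x (u l) = 0) \<longrightarrow>
        dotn n (\<lambda>b. \<Sum>a<m. x a * Y $$ (a, b)) (\<lambda>b. \<Sum>a<m. x a * Y $$ (a, b)) \<le>
        (singular_value Y (Suc i))\<^sup>2 * dotn m x x)"
proof -
  define A where "A = Y * transpose_mat Y"
  have A: "A \<in> carrier_mat m m" using Y by (auto simp: A_def)
  have A_nth: "A $$ (a, b) = (\<Sum>c<n. Y $$ (a, c) * Y $$ (b, c))" if "a < m" "b < m" for a b
    using that Y by (auto simp: A_def scalar_prod_def atLeast0LessThan intro!: sum.cong)
  have bil: "dotn n (\<lambda>b. \<Sum>a<m. x a * Y $$ (a, b)) (\<lambda>b. \<Sum>a<m. y a * Y $$ (a, b)) =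
      (\<Sum>a<m. (\<Sum>b<m. A $$ (a, b) * y b) * x a)" for x y
  proof -
    have "dotn n (\<lambda>b. \<Sum>a<m. x a * Y $$ (a, b)) (\<lambda>b. \<Sum>a<m. y a * Y $$ (a, b)) =
        (\<Sum>c<n. \<Sum>a<m. \<Sum>b<m. Y $$ (a, c) * Y $$ (b, c) * y b * x a)"
      by (simp add: dotn_def sum_product algebra_simps)
    also have "\<dots> = (\<Sum>a<m. \<Sum>b<m. \<Sum>c<n. Y $$ (a, c) * Y $$ (b, c) * y b * x a)"
      by (subst sum.swap, rule sum.cong[OF refl], rule sum.swap)
    also have "\<dots> = (\<Sum>a<m. (\<Sum>b<m. A $$ (a, b) * y b) * x a)"
      by (auto simp: A_nth sum_distrib_right sum_distrib_left intro!: sum.cong)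
    finally show ?thesis .
  qed
  have quad: "quadn m (\<lambda>a b. A $$ (a, b)) x =
      dotn n (\<lambda>b. \<Sum>a<m. x a * Y $$ (a, b)) (\<lambda>b. \<Sum>a<m. x a * Y $$ (a, b))" for x
    unfolding bil quadn_def by (simp add: sum_distrib_right)
  have "A $$ (a, b) = A $$ (b, a)" if "a < m" "b < m" for a b
    using that by (simp add: A_nth mult.commute)
  then obtain u d where
    orth: "\<forall>i<m. \<forall>j<m. dotn m (u i) (u j) = (if i = j then 1 else 0)" and
    eig: "\<forall>i<m. \<forall>a<m. (\<Sum>b<m. A $$ (a, b) * u i b) = d i * u i a" and
    max: "\<forall>i<m. \<forall>x. (\<forall>l<i. dotn m x (u l) = 0) \<longrightarrow> quadn m (\<lambda>a b. A $$ (a, b)) x \<le> d i * dotn m x x" and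
    roots: "rev (sorted_list_of_multiset (proots (char_poly A))) = map d [0..<m]"
    using symmetric_eigenbasis[OF A] by blast
  have uu: "dotn n (\<lambda>b. \<Sum>a<m. u i a * Y $$ (a, b)) (\<lambda>b. \<Sum>a<m. u j a * Y $$ (a, b)) =
      (if i = j then d i else 0)" if "i < m" "j < m" for i j
  proof -
    have "dotn n (\<lambda>b. \<Sum>a<m. u i a * Y $$ (a, b)) (\<lambda>b. \<Sum>a<m. u j a * Y $$ (a, b)) =
        d j * dotn m (u i) (u j)"
      using eig that unfolding bil by (auto simp: dotn_def sum_distrib_left intro!: sum.cong)
    then show ?thesis using orth that by simp
  qed
  have dnn: "d i \<ge> 0" if "i < m" for i
    using uu[OF that that] dotn_self_nonneg[of n "\<lambda>b. \<Sum>a<m. u i a * Y $$ (a, b)"] by simp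
  have sv: "singular_value Y (Suc i) = sqrt (d i)" if "i < m" for i
    using that roots by (simp add: singular_value_def A_def)
  have anti: "d i \<le> d j" if "j \<le> i" "i < m" for i j
    using max[rule_format, of j "u i"] uu[of i i] quad[of "u i"] orth that by auto
  show ?thesis
    using orth sv dnn anti uu max unfolding quad by (intro exI[of _ u]) auto
qed

lemma singular_value_nonneg:
  assumes "Y \<in> carrier_mat m n" "1 \<le> i" "i \<le> m"
  shows "singular_value Y i \<ge> 0"
  using singular_vectors[OF assms(1)] assms(2,3) by (metis Suc_le_D One_nat_def Suc_le_eq)

lemma frob_inner_carrier:
  assumes "A \<in> carrier_mat p q"
  shows "frob_inner A B = (\<Sum>(i, l)\<in>{..<p} \<times> {..<q}. A $$ (i, l) * B $$ (i, l))"
  using assms by (auto simp: frob_inner_def sum.cartesian_product)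

lemma frob_norm_L2_set:
  assumes "A \<in> carrier_mat p q"
  shows "frob_norm A = L2_set (\<lambda>il. A $$ il) ({..<p} \<times> {..<q})"
  using assms by (simp add: ip_norm_def frob_inner_carrier L2_set_def power2_eq_square case_prod_beta)

text \<open>Cauchy-Schwarz in every column: the Frobenius norm dominates the operator norm.\<close>

lemma L2_vec_mult_mat_le:
  assumes A: "A \<in> carrier_mat m n"
  shows "L2_set (\<lambda>b. \<Sum>a<m. x a * A $$ (a, b)) {..<n} \<le> L2_set x {..<m} * frob_norm A"
proof (rule power2_le_imp_le)
  have "(L2_set (\<lambda>b. \<Sum>a<m. x a * A $$ (a, b)) {..<n})\<^sup>2 = (\<Sum>b<n. (\<Sum>a<m. x a * A $$ (a, b))\<^sup>2)"
    by (simp add: L2_set_def sum_nonneg)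
  also have "\<dots> \<le> (\<Sum>b<n. (\<Sum>a<m. (x a)\<^sup>2) * (\<Sum>a<m. (A $$ (a, b))\<^sup>2))"
    by (intro sum_mono Cauchy_Schwarz_ineq_sum)
  also have "\<dots> = (\<Sum>a<m. (x a)\<^sup>2) * (\<Sum>il\<in>{..<m} \<times> {..<n}. (A $$ il)\<^sup>2)"
    by (subst sum.swap[of _ "{..<m}" "{..<n}"] sum_distrib_left[symmetric])+
       (simp add: sum.cartesian_product sum.swap[of _ "{..<n}"] case_prod_beta)
  also have "\<dots> = (L2_set x {..<m} * frob_norm A)\<^sup>2"
    using A by (simp add: frob_norm_L2_set power_mult_distrib L2_set_def sum_nonneg)
  finally show "(L2_set (\<lambda>b. \<Sum>a<m. x a * A $$ (a, b)) {..<n})\<^sup>2 \<le> (L2_set x {..<m} * frob_norm A)\<^sup>2" .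
next
  show "0 \<le> L2_set x {..<m} * frob_norm A" using A by (simp add: frob_norm_L2_set L2_set_nonneg)
qed

lemma dotn_self_L2: "dotn m x x = (L2_set x {..<m})\<^sup>2"
  by (simp add: dotn_def L2_set_def sum_nonneg power2_eq_square)

text \<open>Weyl's inequality by the Courant--Fischer argument: some nonzero \<open>x\<close> lies in the span of the
  first \<open>i\<close> left singular vectors of \<open>A\<close> and is orthogonal to the first \<open>i - 1\<close> of \<open>B\<close>.\<close>

lemma singular_value_diff_le:
  assumes A: "A \<in> carrier_mat m n" and B: "B \<in> carrier_mat m n" and i: "1 \<le> i" "i \<le> m"
  shows "singular_value A i - singular_value B i \<le> frob_norm (A - B)"
proof -
  define s where "s = (\<lambda>k. singular_value A (Suc k))"
  define t where "t = (\<lambda>k. singular_value B (Suc k))"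
  obtain p where p: "i = Suc p" "p < m" using i by (metis Suc_le_D One_nat_def Suc_le_eq)
  obtain u where
    uorth: "\<forall>i<m. \<forall>j<m. dotn m (u i) (u j) = (if i = j then 1 else 0)" and
    s0: "\<forall>i<m. s i \<ge> 0" and santi: "\<forall>i<m. \<forall>j\<le>i. s i \<le> s j" and
    uA: "\<forall>i<m. \<forall>j<m. dotn n (\<lambda>b. \<Sum>a<m. u i a * A $$ (a, b)) (\<lambda>b. \<Sum>a<m. u j a * A $$ (a, b)) =
        (if i = j then (s i)\<^sup>2 else 0)"
    using singular_vectors[OF A] unfolding s_def by blast
  obtain v where
    t0: "\<forall>i<m. t i \<ge> 0" and
    vB: "\<forall>i<m. \<forall>x. (\<forall>l<i. dotn m x (v l) = 0) \<longrightarrow>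
        dotn n (\<lambda>b. \<Sum>a<m. x a * B $$ (a, b)) (\<lambda>b. \<Sum>a<m. x a * B $$ (a, b)) \<le> (t i)\<^sup>2 * dotn m x x"
    using singular_vectors[OF B] unfolding t_def by blast
  \<comment> \<open>Coefficients of the test vector in the first \<open>Suc p\<close> left singular
    vectors of \<open>A\<close>: there is one unknown more than there are orthogonality
    conditions.\<close>
  obtain c where c: "\<exists>a<Suc p. c a \<noteq> 0" "\<And>l. l < p \<Longrightarrow> dotn (Suc p) c (\<lambda>k. dotn m (u k) (v l)) = 0"
    using exists_nonzero_orthogonal[of p "Suc p" "\<lambda>l k. dotn m (u k) (v l)"] by blast
  define x where "x = (\<lambda>a. \<Sum>k<Suc p. c k * u k a)"
  \<comment> \<open>Pythagoras for an orthogonal family, needed both for the \<open>u k\<close>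
    themselves (\<open>h\<close> constantly 1) and for their images under \<open>A\<close>
    (\<open>h\<close> the squared singular values).\<close>
  have expand: "dotn r (\<lambda>a. \<Sum>k<Suc p. c k * w k a) (\<lambda>a. \<Sum>k<Suc p. c k * w k a) = (\<Sum>k<Suc p. (c k)\<^sup>2 * h k)"
    if "\<And>k l. k < m \<Longrightarrow> l < m \<Longrightarrow> dotn r (w k) (w l) = (if k = l then h k else 0)" for r w and h :: "nat \<Rightarrow> real"
  proof -
    have "dotn r (\<lambda>a. \<Sum>k<Suc p. c k * w k a) (\<lambda>a. \<Sum>k<Suc p. c k * w k a) =
        (\<Sum>a<r. \<Sum>k<Suc p. \<Sum>l<Suc p. c k * c l * (w k a * w l a))"
      unfolding dotn_def sum_product by (intro sum.cong refl) (simp add: algebra_simps)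
    also have "\<dots> = (\<Sum>k<Suc p. \<Sum>a<r. \<Sum>l<Suc p. c k * c l * (w k a * w l a))"
      by (rule sum.swap)
    also have "\<dots> = (\<Sum>k<Suc p. \<Sum>l<Suc p. \<Sum>a<r. c k * c l * (w k a * w l a))"
      by (intro sum.cong refl sum.swap)
    also have "\<dots> = (\<Sum>k<Suc p. \<Sum>l<Suc p. c k * c l * dotn r (w k) (w l))"
      by (simp only: dotn_def sum_distrib_left)
    also have "\<dots> = (\<Sum>k<Suc p. \<Sum>l<Suc p. if l = k then c k * c k * h k else 0)"
      using that p(2) by (intro sum.cong refl) auto
    also have "\<dots> = (\<Sum>k<Suc p. (c k)\<^sup>2 * h k)"
      by (intro sum.cong refl) (simp add: power2_eq_square)
    finally show ?thesis .
  qed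
  have xx: "dotn m x x = (\<Sum>k<Suc p. (c k)\<^sup>2)"
    using expand[of m u "\<lambda>_. 1"] uorth unfolding x_def by simp
  have xA: "(\<lambda>b. \<Sum>a<m. x a * A $$ (a, b)) = (\<lambda>b. \<Sum>k<Suc p. c k * (\<Sum>a<m. u k a * A $$ (a, b)))"
    unfolding x_def sum_distrib_right sum_distrib_left by (subst sum.swap) (simp add: mult.assoc)
  have "dotn n (\<lambda>b. \<Sum>a<m. x a * A $$ (a, b)) (\<lambda>b. \<Sum>a<m. x a * A $$ (a, b)) = (\<Sum>k<Suc p. (c k)\<^sup>2 * (s k)\<^sup>2)"
    unfolding xA by (rule expand) (use uA in auto)
  also have "\<dots> \<ge> (\<Sum>k<Suc p. (c k)\<^sup>2 * (s p)\<^sup>2)"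
    using santi s0 p(2) by (intro sum_mono mult_left_mono power_mono) auto
  finally have lowA: "(s p)\<^sup>2 * dotn m x x \<le> dotn n (\<lambda>b. \<Sum>a<m. x a * A $$ (a, b)) (\<lambda>b. \<Sum>a<m. x a * A $$ (a, b))"
    unfolding xx by (simp add: sum_distrib_left distrib_left mult.commute)
  have "dotn m x (v l) = 0" if "l < p" for l
  proof -
    have "dotn m x (v l) = dotn (Suc p) c (\<lambda>k. dotn m (u k) (v l))"
      unfolding dotn_def x_def sum_distrib_left sum_distrib_right by (subst sum.swap) (simp add: mult.assoc)
    then show ?thesis using c(2) that by simp
  qed
  then have upB: "dotn n (\<lambda>b. \<Sum>a<m. x a * B $$ (a, b)) (\<lambda>b. \<Sum>a<m. x a * B $$ (a, b)) \<le> (t p)\<^sup>2 * dotn m x x"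
    using vB p(2) by blast
  define X where "X = L2_set x {..<m}"
  obtain k where k: "k < Suc p" "c k \<noteq> 0" using c(1) by blast
  have "X\<^sup>2 > 0"
    unfolding X_def dotn_self_L2[symmetric] xx
    by (rule sum_pos2[of _ k]) (use k in auto)
  then have X: "X > 0"
    using L2_set_nonneg[of x "{..<m}"] unfolding X_def[symmetric] by (simp add: less_le)
  have "s p * X \<le> L2_set (\<lambda>b. \<Sum>a<m. x a * A $$ (a, b)) {..<n}"
    using lowA unfolding dotn_self_L2 X_def
    by - (rule power2_le_imp_le[OF _ L2_set_nonneg], simp only: power_mult_distrib)
  also have "\<dots> = L2_set (\<lambda>b. (\<Sum>a<m. x a * B $$ (a, b)) + (\<Sum>a<m. x a * (A - B) $$ (a, b))) {..<n}"
    using A B by (intro L2_set_cong refl) (auto simp: right_diff_distrib sum_subtractf)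
  also have "\<dots> \<le> L2_set (\<lambda>b. \<Sum>a<m. x a * B $$ (a, b)) {..<n} + L2_set (\<lambda>b. \<Sum>a<m. x a * (A - B) $$ (a, b)) {..<n}"
    by (rule L2_set_triangle_ineq)
  also have "\<dots> \<le> t p * X + X * frob_norm (A - B)"
  proof (rule add_mono)
    show "L2_set (\<lambda>b. \<Sum>a<m. x a * B $$ (a, b)) {..<n} \<le> t p * X"
      using upB t0 p(2) unfolding dotn_self_L2 X_def
      by - (rule power2_le_imp_le[OF _ mult_nonneg_nonneg[OF _ L2_set_nonneg]], simp_all only: power_mult_distrib)
    show "L2_set (\<lambda>b. \<Sum>a<m. x a * (A - B) $$ (a, b)) {..<n} \<le> X * frob_norm (A - B)"
      unfolding X_def using A B by (intro L2_vec_mult_mat_le) auto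
  qed
  finally have "s p * X \<le> (t p + frob_norm (A - B)) * X" by (simp add: algebra_simps)
  then have "s p \<le> t p + frob_norm (A - B)" using X by simp
  then show ?thesis by (simp add: s_def t_def p(1))
qed

lemma frob_norm_minus_commute:
  assumes "A \<in> carrier_mat p q" "B \<in> carrier_mat p q"
  shows "frob_norm (A - B) = frob_norm (B - A)"
proof -
  have "L2_set (\<lambda>il. (A - B) $$ il) ({..<p} \<times> {..<q}) = L2_set (\<lambda>il. (B - A) $$ il) ({..<p} \<times> {..<q})"
    using assms unfolding L2_set_def by (auto simp: power2_commute intro!: arg_cong[of _ _ sqrt] sum.cong)
  then show ?thesis
    using frob_norm_L2_set[of "A - B" p q] frob_norm_L2_set[of "B - A" p q] assms
    by (metis minus_carrier_mat)
qed

lemma singular_value_lipschitz: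
  assumes "A \<in> carrier_mat m n" "B \<in> carrier_mat m n" "1 \<le> i" "i \<le> m"
  shows "\<bar>singular_value A i - singular_value B i\<bar> \<le> frob_norm (A - B)"
  using singular_value_diff_le[OF assms] singular_value_diff_le[OF assms(2,1,3,4)]
    frob_norm_minus_commute[OF assms(1,2)] by linarith

section \<open>Geometry and compactness of the space of variables\<close>

lemma norm_W_nonneg: "norm_W W x \<ge> 0" if "sym_pos_def W"
  using that by (cases "x = 0") (auto simp: ip_norm_def inner_W_def sym_pos_def_def order_less_imp_le)

lemma inner_W_simps:
  "inner_W W (x + y) z = inner_W W x z + inner_W W y z"
  "inner_W W z (x + y) = inner_W W z x + inner_W W z y"
  "inner_W W (x - y) z = inner_W W x z - inner_W W y z"
  "inner_W W z (x - y) = inner_W W z x - inner_W W z y"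
  "inner_W W (c *\<^sub>R x) z = c * inner_W W x z"
  "inner_W W z (c *\<^sub>R x) = c * inner_W W z x"
  by (simp_all add: inner_W_def inner_add_left inner_diff_left inner_add_right inner_diff_right
      matrix_vector_right_distrib matrix_vector_mult_diff_distrib matrix_vector_mult_scaleR)

lemma inner_W_commute:
  assumes "sym_pos_def W"
  shows "inner_W W x y = inner_W W y x"
proof -
  have "inner_W W x y = inner (Finite_Cartesian_Product.transpose W *v x) y"
    unfolding inner_W_def by (simp only: dot_lmul_matrix transpose_matrix_vector)
  then show ?thesis using assms by (simp add: sym_pos_def_def inner_W_def inner_commute del: transpose_matrix_vector)
qed

lemma norm_W_power2: "sym_pos_def W \<Longrightarrow> (norm_W W x)\<^sup>2 = inner_W W x x"
  by (cases "x = 0") (auto simp: ip_norm_def inner_W_def sym_pos_def_def order_less_imp_le)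

lemma inner_W_Cauchy_Schwarz:
  assumes "sym_pos_def W"
  shows "\<bar>inner_W W x y\<bar> \<le> norm_W W x * norm_W W y"
proof (rule power2_le_imp_le)
  note sq = norm_W_power2[OF assms]
  define a where "a = inner_W W y y"
  define b where "b = inner_W W x y"
  have a: "a \<ge> 0" using sq[of y] by (simp add: a_def flip: sq)
  \<comment> \<open>Testing with \<open>a *\<^sub>R x - b *\<^sub>R y\<close> avoids dividing by
    \<open>a\<close>; the remaining case \<open>a = 0\<close> forces \<open>y = 0\<close> by
    definiteness.\<close>
  have "inner_W W (a *\<^sub>R x - b *\<^sub>R y) (a *\<^sub>R x - b *\<^sub>R y) = a * (a * inner_W W x x - b\<^sup>2)"
    using inner_W_commute[OF assms, of y x]
    by (simp add: inner_W_simps a_def b_def power2_eq_square algebra_simps)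
  then have nn: "a * (a * inner_W W x x - b\<^sup>2) \<ge> 0"
    using sq[of "a *\<^sub>R x - b *\<^sub>R y"] by (metis zero_le_power2)
  have "b\<^sup>2 \<le> a * inner_W W x x"
  proof (cases "a = 0")
    case True
    then have "y = 0" using assms by (force simp: a_def sym_pos_def_def inner_W_def)
    then show ?thesis using True by (simp add: b_def inner_W_def)
  next
    case False
    then show ?thesis using nn a by (simp add: zero_le_mult_iff)
  qed
  then show "\<bar>inner_W W x y\<bar>\<^sup>2 \<le> (norm_W W x * norm_W W y)\<^sup>2"
    by (simp add: power_mult_distrib sq a_def b_def mult.commute)
next
  show "0 \<le> norm_W W x * norm_W W y" using norm_W_nonneg[OF assms] by simp
qed

lemma norm_W_triangle:
  assumes "sym_pos_def W"
  shows "norm_W W (x + y) \<le> norm_W W x + norm_W W y"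
proof (rule power2_le_imp_le)
  note sq = norm_W_power2[OF assms]
  have "(norm_W W (x + y))\<^sup>2 = (norm_W W x)\<^sup>2 + 2 * inner_W W x y + (norm_W W y)\<^sup>2"
    using inner_W_commute[OF assms, of x y] by (simp add: sq inner_W_simps)
  also have "\<dots> \<le> (norm_W W x + norm_W W y)\<^sup>2"
    using inner_W_Cauchy_Schwarz[OF assms, of x y] by (simp add: power2_sum)
  finally show "(norm_W W (x + y))\<^sup>2 \<le> (norm_W W x + norm_W W y)\<^sup>2" .
qed (use norm_W_nonneg[OF assms] in simp)

text \<open>The quadratic form of \<open>W\<close> has a positive minimum on the compact unit
  sphere. The bound links convergence in \<open>norm_W W\<close> with the standard topology, in
  which lower semicontinuity of \<open>f\<close> is stated.\<close>

lemma norm_W_lower: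
  assumes "sym_pos_def (W :: real^'N^'N)"
  shows "\<exists>c>0. \<forall>x. c * norm x \<le> norm_W W x"
proof -
  have cont: "continuous_on (sphere 0 1) (\<lambda>x. inner x (W *v x))"
    by (intro continuous_intros matrix_vector_mult_linear_continuous_on)
  have "sphere (0 :: real^'N) 1 \<noteq> {}"
    using SOME_Basis by (metis dist_0_norm empty_iff mem_sphere norm_Basis)
  then obtain x0 where x0: "x0 \<in> sphere 0 1" and min: "\<And>x. x \<in> sphere 0 1 \<Longrightarrow> inner x0 (W *v x0) \<le> inner x (W *v x)"
    using continuous_attains_inf[OF compact_sphere _ cont] by blast
  define c where "c = sqrt (inner x0 (W *v x0))"
  have "x0 \<noteq> 0" using x0 by auto
  then have "c > 0" using assms by (simp add: c_def sym_pos_def_def)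
  moreover have "c * norm x \<le> norm_W W x" for x
  proof (cases "x = 0")
    case True
    then show ?thesis using norm_W_nonneg[OF assms, of x] by simp
  next
    case False
    then have "inner x0 (W *v x0) \<le> inner ((1 / norm x) *\<^sub>R x) (W *v ((1 / norm x) *\<^sub>R x))"
      by (intro min) simp
    also have "\<dots> = inner x (W *v x) / (norm x)\<^sup>2"
      by (simp add: matrix_vector_mult_scaleR power2_eq_square)
    finally have "c\<^sup>2 \<le> (norm_W W x)\<^sup>2 / (norm x)\<^sup>2"
      using \<open>c > 0\<close> norm_W_power2[OF assms] by (simp add: c_def inner_W_def)
    then have "(c * norm x)\<^sup>2 \<le> (norm_W W x)\<^sup>2"
      using False by (simp add: field_simps power_mult_distrib)
    then show ?thesis using norm_W_nonneg[OF assms] by (rule power2_le_imp_le)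
  qed
  ultimately show ?thesis by blast
qed

lemma norm_W_tendsto_zero_iff:
  assumes "sym_pos_def (W :: real^'N^'N)"
  shows "(\<lambda>l. norm_W W (X l - x)) \<longlonglongrightarrow> 0 \<longleftrightarrow> X \<longlonglongrightarrow> x"
proof
  assume "X \<longlonglongrightarrow> x"
  then have "(\<lambda>l. sqrt (inner (X l - x) (W *v (X l - x)))) \<longlonglongrightarrow> sqrt (inner (x - x) (W *v (x - x)))"
    by (intro tendsto_intros bounded_linear.tendsto[OF matrix_vector_mul_bounded_linear])
  then show "(\<lambda>l. norm_W W (X l - x)) \<longlonglongrightarrow> 0" by (simp add: ip_norm_def inner_W_def)
next
  assume *: "(\<lambda>l. norm_W W (X l - x)) \<longlonglongrightarrow> 0"
  obtain c where c: "c > 0" "\<And>x. c * norm x \<le> norm_W W x" using norm_W_lower[OF assms] by blast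
  have "(\<lambda>l. norm (X l - x)) \<longlonglongrightarrow> 0"
  proof (rule tendsto_sandwich[OF _ _ tendsto_const])
    show "(\<lambda>l. norm_W W (X l - x) / c) \<longlonglongrightarrow> 0" using tendsto_divide[OF * tendsto_const, of c] c by simp
    show "\<forall>\<^sub>F l in sequentially. norm (X l - x) \<le> norm_W W (X l - x) / c"
      using c by (simp add: field_simps)
  qed auto
  then show "X \<longlonglongrightarrow> x" by (simp add: LIM_zero_iff tendsto_norm_zero_iff)
qed

section \<open>The Frobenius inner product\<close>

lemma frob_norm_nonneg: "frob_norm A \<ge> 0"
  by (auto simp: ip_norm_def frob_inner_def intro!: sum_nonneg)

lemma frob_norm_power2: "(frob_norm A)\<^sup>2 = frob_inner A A"
  by (auto simp: ip_norm_def frob_inner_def intro!: sum_nonneg)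

lemma frob_inner_commute:
  assumes "A \<in> carrier_mat p q" "B \<in> carrier_mat p q"
  shows "frob_inner A B = frob_inner B A"
  using assms by (simp add: frob_inner_carrier mult.commute)

lemma frob_inner_diff_left:
  assumes "A \<in> carrier_mat p q" "B \<in> carrier_mat p q"
  shows "frob_inner (A - B) C = frob_inner A C - frob_inner B C"
  using assms unfolding frob_inner_carrier[OF minus_carrier_mat[OF assms(2)]]
  by (auto simp: frob_inner_carrier left_diff_distrib simp flip: sum_subtractf intro!: sum.cong)

lemma frob_inner_diff_right:
  assumes "A \<in> carrier_mat p q" "B \<in> carrier_mat p q" "C \<in> carrier_mat p q"
  shows "frob_inner C (A - B) = frob_inner C A - frob_inner C B"
  using assms
  by (auto simp: frob_inner_carrier right_diff_distrib simp flip: sum_subtractf intro!: sum.cong)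

lemma frob_inner_smult_left:
  "frob_inner (c \<cdot>\<^sub>m A) B = c * frob_inner A B"
  by (auto simp: frob_inner_def sum_distrib_left mult.assoc intro!: sum.cong)

lemma frob_inner_smult_right:
  assumes "A \<in> carrier_mat p q" "B \<in> carrier_mat p q"
  shows "frob_inner B (c \<cdot>\<^sub>m A) = c * frob_inner B A"
  using assms by (auto simp: frob_inner_carrier sum_distrib_left intro!: sum.cong)

lemma frob_Cauchy_Schwarz:
  assumes "A \<in> carrier_mat p q" "B \<in> carrier_mat p q"
  shows "\<bar>frob_inner A B\<bar> \<le> frob_norm A * frob_norm B"
proof -
  have "\<bar>frob_inner A B\<bar> \<le> (\<Sum>il\<in>{..<p} \<times> {..<q}. \<bar>A $$ il\<bar> * \<bar>B $$ il\<bar>)"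
    using assms(1) unfolding frob_inner_carrier[OF assms(1)] case_prod_beta prod.collapse
    by (intro order_trans[OF sum_abs]) (simp add: abs_mult)
  also have "\<dots> \<le> frob_norm A * frob_norm B"
    using assms by (simp add: frob_norm_L2_set L2_set_mult_ineq)
  finally show ?thesis .
qed

lemma frob_norm_triangle:
  assumes "A \<in> carrier_mat p q" "B \<in> carrier_mat p q" "C \<in> carrier_mat p q"
  shows "frob_norm (A - C) \<le> frob_norm (A - B) + frob_norm (B - C)"
proof -
  have "frob_norm (A - C) = L2_set (\<lambda>il. (A - B) $$ il + (B - C) $$ il) ({..<p} \<times> {..<q})"
    unfolding frob_norm_L2_set[OF minus_carrier_mat[OF assms(3)]] using assms by (intro L2_set_cong) auto
  also have "\<dots> \<le> frob_norm (A - B) + frob_norm (B - C)"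
    unfolding frob_norm_L2_set[OF minus_carrier_mat[OF assms(2)]] frob_norm_L2_set[OF minus_carrier_mat[OF assms(3)]]
    by (rule L2_set_triangle_ineq)
  finally show ?thesis .
qed

lemma abs_entry_le_frob_norm:
  assumes "A \<in> carrier_mat p q" "i < p" "l < q"
  shows "\<bar>A $$ (i, l)\<bar> \<le> frob_norm A"
proof -
  have "\<bar>A $$ (i, l)\<bar> = L2_set (\<lambda>il. A $$ il) {(i, l)}" by simp
  also have "\<dots> \<le> frob_norm A"
    unfolding frob_norm_L2_set[OF assms(1)] L2_set_def
    using assms by (intro real_sqrt_le_mono sum_mono2) auto
  finally show ?thesis .
qed

lemma frob_norm_le_sum:
  assumes "A \<in> carrier_mat p q"
  shows "frob_norm A \<le> (\<Sum>(i, l)\<in>{..<p} \<times> {..<q}. \<bar>A $$ (i, l)\<bar>)"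
  unfolding frob_norm_L2_set[OF assms] using L2_set_le_sum_abs[of "\<lambda>il. A $$ il"] by (simp add: case_prod_beta)

lemma frob_norm_self_diff: "frob_norm (A - A) = 0"
  by (simp add: ip_norm_def frob_inner_def)

lemma frob_norm_power2_diff:
  assumes "A \<in> carrier_mat p q" "B \<in> carrier_mat p q" "C \<in> carrier_mat p q"
  shows "(frob_norm (A - C))\<^sup>2 = (frob_norm (B - C))\<^sup>2 + 2 * frob_inner (B - C) (A - B) + (frob_norm (A - B))\<^sup>2"
  unfolding frob_norm_power2 using assms
  by (simp add: frob_inner_diff_left[of _ p q] frob_inner_diff_right[of _ p q] frob_inner_commute[of B p q A]
      frob_inner_commute[of C p q A] frob_inner_commute[of C p q B] minus_carrier_mat)

lemma norm_W_power2_diff: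
  assumes "sym_pos_def W"
  shows "(norm_W W (x - z))\<^sup>2 = (norm_W W (y - z))\<^sup>2 + 2 * inner_W W (y - z) (x - y) + (norm_W W (x - y))\<^sup>2"
  unfolding norm_W_power2[OF assms] inner_W_simps
  using inner_W_commute[OF assms, of x y] inner_W_commute[OF assms, of z y] inner_W_commute[OF assms, of z x]
  by simp

lemma norm_W_minus_commute: "norm_W W (x - y) = norm_W W (y - x)"
  unfolding ip_norm_def inner_W_simps by simp

section \<open>The product norm on \<open>Z_space\<close>\<close>

text \<open>Index 0, which no matrix block occupies, is given to the image, so that the triangle
  inequality of \<open>L2_set\<close> becomes that of the product norm.\<close>

lemma Z_norm_L2_set:
  assumes "sym_pos_def W"
  shows "Z_norm J W Z = L2_set (\<lambda>j. if j = 0 then norm_W W (fst Z) else frob_norm (snd Z j)) {0..J}"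
proof -
  have "{0..J} = insert 0 {1..J}" by auto
  then show ?thesis by (simp add: Z_norm_def L2_set_def)
qed

lemma Z_norm_nonneg: "Z_norm J W Z \<ge> 0"
  by (simp add: Z_norm_def sum_nonneg)

lemma Z_norm_power2: "(Z_norm J W Z)\<^sup>2 = (norm_W W (fst Z))\<^sup>2 + (\<Sum>j=1..J. (frob_norm (snd Z j))\<^sup>2)"
  by (simp add: Z_norm_def sum_nonneg)

lemma norm_W_fst_le_Z_norm: "norm_W W (fst Z) \<le> Z_norm J W Z"
  by (rule power2_le_imp_le[OF _ Z_norm_nonneg]) (simp add: Z_norm_power2 sum_nonneg)

lemma frob_norm_snd_le_Z_norm:
  assumes "j \<in> {1..J}"
  shows "frob_norm (snd Z j) \<le> Z_norm J W Z"
proof (rule power2_le_imp_le[OF _ Z_norm_nonneg])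
  have "(frob_norm (snd Z j))\<^sup>2 \<le> (\<Sum>j=1..J. (frob_norm (snd Z j))\<^sup>2)"
    using assms by (intro member_le_sum) auto
  then show "(frob_norm (snd Z j))\<^sup>2 \<le> (Z_norm J W Z)\<^sup>2"
    by (simp add: Z_norm_power2 add_increasing)
qed

lemma Z_norm_le_sum:
  assumes "sym_pos_def W"
  shows "Z_norm J W Z \<le> norm_W W (fst Z) + (\<Sum>j=1..J. frob_norm (snd Z j))"
proof -
  have "{0..J} = insert 0 {1..J}" by auto
  then show ?thesis
    unfolding Z_norm_L2_set[OF assms]
    using L2_set_le_sum[of "{0..J}" "\<lambda>j. if j = 0 then norm_W W (fst Z) else frob_norm (snd Z j)"]
      norm_W_nonneg[OF assms] frob_norm_nonneg
    by simp
qed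

lemma Z_spaceD: "Z \<in> Z_space J m n \<Longrightarrow> j \<in> {1..J} \<Longrightarrow> snd Z j \<in> carrier_mat (m j) (n j)"
  by (auto simp: Z_space_def)

lemma Z_norm_triangle:
  assumes "sym_pos_def W" "A \<in> Z_space J m n" "B \<in> Z_space J m n" "C \<in> Z_space J m n"
  shows "Z_norm J W (A - C) \<le> Z_norm J W (A - B) + Z_norm J W (B - C)"
proof -
  have "Z_norm J W (A - C) \<le> L2_set (\<lambda>j. (if j = 0 then norm_W W (fst (A - B)) else frob_norm (snd (A - B) j)) +
      (if j = 0 then norm_W W (fst (B - C)) else frob_norm (snd (B - C) j))) {0..J}"
    unfolding Z_norm_L2_set[OF assms(1)]
  proof (rule L2_set_mono)
    fix j assume "j \<in> {0..J}"
    then have "frob_norm (snd A j - snd C j) \<le> frob_norm (snd A j - snd B j) + frob_norm (snd B j - snd C j)" if "j \<noteq> 0"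
      using assms(2-4) that by (intro frob_norm_triangle[of _ "m j" "n j"] Z_spaceD) auto
    moreover have "norm_W W (fst A - fst C) \<le> norm_W W (fst A - fst B) + norm_W W (fst B - fst C)"
      using norm_W_triangle[OF assms(1), of "fst A - fst B" "fst B - fst C"] by simp
    ultimately show "(if j = 0 then norm_W W (fst (A - C)) else frob_norm (snd (A - C) j)) \<le>
      (if j = 0 then norm_W W (fst (A - B)) else frob_norm (snd (A - B) j)) +
      (if j = 0 then norm_W W (fst (B - C)) else frob_norm (snd (B - C) j))"
      by simp
  qed (use norm_W_nonneg[OF assms(1)] frob_norm_nonneg in auto)
  also have "\<dots> \<le> Z_norm J W (A - B) + Z_norm J W (B - C)"
    unfolding Z_norm_L2_set[OF assms(1)] by (rule L2_set_triangle_ineq)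
  finally show ?thesis .
qed

lemma Z_norm_minus_commute:
  assumes "A \<in> Z_space J m n" "B \<in> Z_space J m n"
  shows "Z_norm J W (A - B) = Z_norm J W (B - A)"
proof -
  have "frob_norm (snd A j - snd B j) = frob_norm (snd B j - snd A j)" if "j \<in> {1..J}" for j
    using assms that by (intro frob_norm_minus_commute[of _ "m j" "n j"] Z_spaceD)
  then show ?thesis
    unfolding Z_norm_def by (simp add: norm_W_minus_commute[of W "fst A"])
qed

lemma Z_norm_self_diff: "Z_norm J W (Z - Z) = 0"
  by (simp add: Z_norm_def frob_norm_self_diff) (simp add: ip_norm_def inner_W_def)

lemma Z_space_slice_fst: "Z \<in> Z_space J m n \<Longrightarrow> (x, snd Z) \<in> Z_space J m n"
  by (auto simp: Z_space_def)

lemma Z_space_slice_snd: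
  "Z \<in> Z_space J m n \<Longrightarrow> j \<in> {1..J} \<Longrightarrow> M \<in> carrier_mat (m j) (n j) \<Longrightarrow> (fst Z, (snd Z)(j := M)) \<in> Z_space J m n"
  by (auto simp: Z_space_def PiE_iff extensional_def)

lemma Z_norm_slice_fst: "sym_pos_def W \<Longrightarrow> Z_norm J W ((x, snd Z) - Z) = norm_W W (x - fst Z)"
  by (simp add: Z_norm_def frob_norm_self_diff norm_W_nonneg)

lemma Z_norm_slice_snd:
  assumes "j \<in> {1..J}"
  shows "Z_norm J W ((fst Z, (snd Z)(j := M)) - Z) = frob_norm (M - snd Z j)"
proof -
  have "(\<Sum>i=1..J. (frob_norm (((snd Z)(j := M)) i - snd Z i))\<^sup>2) = (\<Sum>i=1..J. if i = j then (frob_norm (M - snd Z j))\<^sup>2 else 0)"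
    by (intro sum.cong) (auto simp: frob_norm_self_diff)
  also have "\<dots> = (frob_norm (M - snd Z j))\<^sup>2" using assms by simp
  finally have "(\<Sum>i=1..J. (frob_norm (((snd Z)(j := M)) i - snd Z i))\<^sup>2) = (frob_norm (M - snd Z j))\<^sup>2" .
  moreover have "norm_W W 0 = 0" by (simp add: ip_norm_def inner_W_def)
  ultimately show ?thesis by (simp add: Z_norm_def frob_norm_nonneg)
qed

text \<open>In a single block the squared distance to \<open>Z'\<close> is an exact quadratic, and
  the cross term shows its partial gradient at \<open>Z\<close>. The smoothed distance used with the
  KL property is differentiated in this way, here for the image and next for a matrix.\<close>

lemma Z_norm_slice_fst_expand:
  assumes "sym_pos_def W"
  shows "(Z_norm J W ((x, snd Z) - Z'))\<^sup>2 =
    (Z_norm J W (Z - Z'))\<^sup>2 + 2 * inner_W W (fst Z - fst Z') (x - fst Z) + (norm_W W (x - fst Z))\<^sup>2"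
  using norm_W_power2_diff[OF assms, of x "fst Z'" "fst Z"] by (simp add: Z_norm_power2)

lemma Z_norm_slice_snd_expand:
  assumes Z: "Z \<in> Z_space J m n" "Z' \<in> Z_space J m n" and j: "j \<in> {1..J}" and M: "M \<in> carrier_mat (m j) (n j)"
  shows "(Z_norm J W ((fst Z, (snd Z)(j := M)) - Z'))\<^sup>2 =
    (Z_norm J W (Z - Z'))\<^sup>2 + 2 * frob_inner (snd Z j - snd Z' j) (M - snd Z j) + (frob_norm (M - snd Z j))\<^sup>2"
proof -
  have "(\<Sum>i=1..J. (frob_norm (((snd Z)(j := M)) i - snd Z' i))\<^sup>2) =
      (\<Sum>i=1..J. (frob_norm (snd Z i - snd Z' i))\<^sup>2 +
        (if i = j then 2 * frob_inner (snd Z j - snd Z' j) (M - snd Z j) + (frob_norm (M - snd Z j))\<^sup>2 else 0))"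
    using frob_norm_power2_diff[OF M Z_spaceD[OF Z(1) j] Z_spaceD[OF Z(2) j]]
    by (intro sum.cong) auto
  also have "\<dots> = (\<Sum>i=1..J. (frob_norm (snd Z i - snd Z' i))\<^sup>2) +
      (2 * frob_inner (snd Z j - snd Z' j) (M - snd Z j) + (frob_norm (M - snd Z j))\<^sup>2)"
    using j by (simp add: sum.distrib)
  finally show ?thesis by (simp add: Z_norm_power2)
qed

section \<open>Sequential compactness of bounded sets in \<open>Z_space\<close>\<close>

lemma convergent_subsequence_finite_coords:
  assumes "finite I" "\<And>i. i \<in> I \<Longrightarrow> bounded (range (\<lambda>l. (c l i :: real)))"
  shows "\<exists>r :: nat \<Rightarrow> nat. strict_mono r \<and> (\<forall>i\<in>I. convergent (\<lambda>l. c (r l) i))"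
  using assms
proof (induction I rule: finite_induct)
  case empty
  show ?case by (auto intro!: exI[of _ id] simp: strict_mono_def)
next
  case (insert i I)
  then obtain r where r: "strict_mono r" "\<forall>i\<in>I. convergent (\<lambda>l. c (r l) i)" by auto
  have "bounded (range (\<lambda>l. c (r l) i))"
    by (rule bounded_subset[of "range (\<lambda>l. c l i)"]) (use insert.prems in auto)
  then obtain L r' where r': "strict_mono r'" "((\<lambda>l. c (r l) i) \<circ> r') \<longlonglongrightarrow> L"
    using bounded_imp_convergent_subsequence by blast
  have "convergent (\<lambda>l. c ((r \<circ> r') l) k)" if "k \<in> insert i I" for k
    using that r' r(2) convergent_subseq_convergent[of "\<lambda>l. c (r l) k" r']
    by (auto simp: o_def convergent_def)
  then show ?case using strict_mono_o[OF r(1) r'(1)] by blast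
qed

lemma Z_norm_tendsto_zeroI:
  assumes W: "sym_pos_def W" and X: "\<And>l. X l \<in> Z_space J m n" and Z: "Z \<in> Z_space J m n"
    and fst: "(\<lambda>l. fst (X l)) \<longlonglongrightarrow> fst Z"
    and snd: "\<And>j i q. j \<in> {1..J} \<Longrightarrow> i < m j \<Longrightarrow> q < n j \<Longrightarrow> (\<lambda>l. snd (X l) j $$ (i, q)) \<longlonglongrightarrow> snd Z j $$ (i, q)"
  shows "(\<lambda>l. Z_norm J W (X l - Z)) \<longlonglongrightarrow> 0"
proof (rule tendsto_sandwich[OF _ _ tendsto_const])
  have frob: "(\<lambda>l. frob_norm (snd (X l) j - snd Z j)) \<longlonglongrightarrow> 0" if j: "j \<in> {1..J}" for j
  proof (rule tendsto_sandwich[OF _ _ tendsto_const])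
    show "\<forall>\<^sub>F l in sequentially. frob_norm (snd (X l) j - snd Z j) \<le>
        (\<Sum>(i, q)\<in>{..<m j} \<times> {..<n j}. \<bar>snd (X l) j $$ (i, q) - snd Z j $$ (i, q)\<bar>)"
    proof (rule always_eventually, rule allI)
      fix l
      have "(\<Sum>(i, q)\<in>{..<m j} \<times> {..<n j}. \<bar>(snd (X l) j - snd Z j) $$ (i, q)\<bar>) =
         (\<Sum>(i, q)\<in>{..<m j} \<times> {..<n j}. \<bar>snd (X l) j $$ (i, q) - snd Z j $$ (i, q)\<bar>)"
        using Z_spaceD[OF X j] Z_spaceD[OF Z j] by (intro sum.cong) auto
      then show "frob_norm (snd (X l) j - snd Z j) \<le>
        (\<Sum>(i, q)\<in>{..<m j} \<times> {..<n j}. \<bar>snd (X l) j $$ (i, q) - snd Z j $$ (i, q)\<bar>)"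
        using frob_norm_le_sum[of "snd (X l) j - snd Z j" "m j" "n j"] Z_spaceD[OF Z j] by (simp add: minus_carrier_mat)
    qed
    have "(\<lambda>l. \<Sum>iq\<in>{..<m j} \<times> {..<n j}. \<bar>snd (X l) j $$ iq - snd Z j $$ iq\<bar>) \<longlonglongrightarrow> (\<Sum>iq\<in>{..<m j} \<times> {..<n j}. 0)"
      by (intro tendsto_sum tendsto_rabs_zero LIM_zero) (use snd[OF j] in auto)
    then show "(\<lambda>l. \<Sum>(i, q)\<in>{..<m j} \<times> {..<n j}. \<bar>snd (X l) j $$ (i, q) - snd Z j $$ (i, q)\<bar>) \<longlonglongrightarrow> 0"
      by (simp add: case_prod_beta)
  qed (simp add: frob_norm_nonneg)
  have "(\<lambda>l. norm_W W (fst (X l) - fst Z) + (\<Sum>j=1..J. frob_norm (snd (X l) j - snd Z j))) \<longlonglongrightarrow> 0 + (\<Sum>j=1..J. 0)"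
    using frob fst by (intro tendsto_add tendsto_sum) (auto simp: norm_W_tendsto_zero_iff[OF W])
  then show "(\<lambda>l. norm_W W (fst (X l) - fst Z) + (\<Sum>j=1..J. frob_norm (snd (X l) j - snd Z j))) \<longlonglongrightarrow> 0" by simp
  show "\<forall>\<^sub>F l in sequentially. Z_norm J W (X l - Z) \<le> norm_W W (fst (X l) - fst Z) + (\<Sum>j=1..J. frob_norm (snd (X l) j - snd Z j))"
    using Z_norm_le_sum[OF W, of J "X _ - Z"] by simp
qed (simp add: Z_norm_nonneg)

lemma Z_norm_tendsto_zeroD:
  assumes W: "sym_pos_def W" and lim: "(\<lambda>l. Z_norm J W (X l - Z)) \<longlonglongrightarrow> 0"
  shows "(\<lambda>l. fst (X l)) \<longlonglongrightarrow> fst Z"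
    and "j \<in> {1..J} \<Longrightarrow> (\<lambda>l. frob_norm (snd (X l) j - snd Z j)) \<longlonglongrightarrow> 0"
proof -
  have "(\<lambda>l. norm_W W (fst (X l) - fst Z)) \<longlonglongrightarrow> 0"
    by (rule tendsto_sandwich[OF _ _ tendsto_const lim])
       (use norm_W_fst_le_Z_norm[of W "X _ - Z"] norm_W_nonneg[OF W] in auto)
  then show "(\<lambda>l. fst (X l)) \<longlonglongrightarrow> fst Z" by (simp add: norm_W_tendsto_zero_iff[OF W])
  show "(\<lambda>l. frob_norm (snd (X l) j - snd Z j)) \<longlonglongrightarrow> 0" if "j \<in> {1..J}"
    by (rule tendsto_sandwich[OF _ _ tendsto_const lim])
       (use frob_norm_snd_le_Z_norm[OF that, of "X _ - Z"] frob_norm_nonneg in auto)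
qed

lemma Z_space_Bolzano_Weierstrass:
  fixes X :: "nat \<Rightarrow> 'N::finite var"
  assumes W: "sym_pos_def W" and X: "\<And>l. X l \<in> Z_space J m n" and bdd: "\<And>l. Z_norm J W (X l) \<le> K"
  shows "\<exists>Z\<in>Z_space J m n. \<exists>r. strict_mono r \<and> (\<lambda>l. Z_norm J W (X (r l) - Z)) \<longlonglongrightarrow> 0"
proof -
  obtain c where c: "c > 0" "\<And>x. c * norm x \<le> norm_W W x" using norm_W_lower[OF W] by blast
  have "c * norm (fst (X l)) \<le> K" for l
    using c(2) norm_W_fst_le_Z_norm[of W] bdd by (meson order_trans)
  then have "norm (fst (X l)) \<le> K / c" for l using c(1) by (simp add: field_simps)
  then have "bounded (range (\<lambda>l. fst (X l)))" by (auto simp: bounded_iff)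
  then obtain x r where r: "strict_mono r" "((\<lambda>l. fst (X l)) \<circ> r) \<longlonglongrightarrow> x"
    using bounded_imp_convergent_subsequence by blast
  \<comment> \<open>All real entries of all matrix blocks form one finite index set, so a single
    appeal to the coordinatewise lemma suffices.\<close>
  define I where "I = (SIGMA j:{1..J}. {..<m j} \<times> {..<n j})"
  define e where "e = (\<lambda>l (j, iq). snd (X (r l)) j $$ iq)"
  have "bounded (range (\<lambda>l. e l k))" if kI: "k \<in> I" for k
  proof -
    obtain j i q where "k = (j, i, q)" by (cases k)
    with kI have k: "k = (j, i, q)" "j \<in> {1..J}" "i < m j" "q < n j" by (auto simp: I_def)
    have "\<bar>e l k\<bar> \<le> K" for l
    proof -
      have "\<bar>e l k\<bar> \<le> frob_norm (snd (X (r l)) j)"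
        unfolding e_def k(1) prod.case by (rule abs_entry_le_frob_norm[OF Z_spaceD[OF X k(2)] k(3,4)])
      also have "\<dots> \<le> Z_norm J W (X (r l))" by (rule frob_norm_snd_le_Z_norm[OF k(2)])
      finally show ?thesis using bdd[of "r l"] by simp
    qed
    then show ?thesis by (auto simp: bounded_iff)
  qed
  moreover have "finite I" by (simp add: I_def)
  ultimately obtain r' where r': "strict_mono r'" "\<forall>k\<in>I. convergent (\<lambda>l. e (r' l) k)"
    using convergent_subsequence_finite_coords[of I e] by blast
  define Z where "Z = (x, \<lambda>j\<in>{1..J}. mat (m j) (n j) (\<lambda>iq. lim (\<lambda>l. e (r' l) (j, iq))))"
  have Z: "Z \<in> Z_space J m n" by (auto simp: Z_def Z_space_def)
  have "(\<lambda>l. Z_norm J W (X ((r \<circ> r') l) - Z)) \<longlonglongrightarrow> 0"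
  proof (rule Z_norm_tendsto_zeroI[OF W X Z])
    show "(\<lambda>l. fst (X ((r \<circ> r') l))) \<longlonglongrightarrow> fst Z"
      using LIMSEQ_subseq_LIMSEQ[OF r(2) r'(1)] by (simp add: Z_def o_def)
    fix j i q assume *: "j \<in> {1..J}" "i < m j" "q < n j"
    then have "(j, i, q) \<in> I" by (auto simp: I_def)
    then have "(\<lambda>l. e (r' l) (j, i, q)) \<longlonglongrightarrow> lim (\<lambda>l. e (r' l) (j, i, q))"
      using r'(2) convergent_LIMSEQ_iff by blast
    then show "(\<lambda>l. snd (X ((r \<circ> r') l)) j $$ (i, q)) \<longlonglongrightarrow> snd Z j $$ (i, q)"
      using * by (simp add: Z_def e_def)
  qed
  then show ?thesis using Z strict_mono_o[OF r(1) r'(1)] by blast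
qed

section \<open>Subgradients and the error bound from the KL property\<close>

text \<open>The liminf condition with the quotient cleared: points where \<open>h y\<close> is
  infinite satisfy the inequality trivially and need no separate treatment later.\<close>

lemma frechet_subdiffI:
  assumes u: "u \<in> V" and hx: "h x = ereal a"
    and low: "\<And>\<epsilon>. \<epsilon> > 0 \<Longrightarrow> \<exists>\<delta>>0. \<forall>y\<in>V. 0 < ip_norm ip (y - x) \<and> ip_norm ip (y - x) < \<delta> \<longrightarrow>
      ereal (a + ip u (y - x) - \<epsilon> * ip_norm ip (y - x)) \<le> h y"
  shows "u \<in> frechet_subdiff V ip h x"
proof -
  have "0 \<le> Liminf (ip_at V ip x) (\<lambda>y. (h y - h x - ereal (ip u (y - x))) / ereal (ip_norm ip (y - x)))"
    unfolding le_Liminf_iff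
  proof (intro allI impI)
    fix c :: ereal assume "c < 0"
    then obtain b :: real where b: "c < ereal b" "ereal b < 0"
      using ereal_dense2[of c 0] by blast
    define \<epsilon> where "\<epsilon> = - b"
    have "\<epsilon> > 0" using b by (simp add: \<epsilon>_def)
    then obtain \<delta> where \<delta>: "\<delta> > 0" "\<forall>y\<in>V. 0 < ip_norm ip (y - x) \<and> ip_norm ip (y - x) < \<delta> \<longrightarrow>
        ereal (a + ip u (y - x) - \<epsilon> * ip_norm ip (y - x)) \<le> h y"
      using low by blast
    have "c < (h y - h x - ereal (ip u (y - x))) / ereal (ip_norm ip (y - x))"
      if y: "y \<in> V" "0 < ip_norm ip (y - x)" "ip_norm ip (y - x) < \<delta>" for y
    proof -
      define N where "N = ip_norm ip (y - x)"
      have N: "N > 0" using y by (simp add: N_def)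
      have le: "ereal (a + ip u (y - x) - \<epsilon> * N) \<le> h y" using \<delta> y unfolding N_def by blast
      show ?thesis
      proof (cases "h y")
        case (real r)
        then have "b * N \<le> r - a - ip u (y - x)" using le by (simp add: \<epsilon>_def)
        then have "b \<le> (r - a - ip u (y - x)) / N" using N by (simp add: field_simps)
        then have "c < ereal ((r - a - ip u (y - x)) / N)" using b(1) by (meson ereal_less_eq(3) less_le_trans)
        then show ?thesis using real hx N by (simp add: N_def)
      next
        case PInf
        then show ?thesis using hx N b by (auto simp: N_def[symmetric])
      next
        case MInf
        then show ?thesis using le by simp
      qed
    qed
    then show "\<forall>\<^sub>F y in ip_at V ip x. c < (h y - h x - ereal (ip u (y - x))) / ereal (ip_norm ip (y - x))"
      unfolding ip_at_def eventually_inf_principal eventually_filtercomap eventually_at_right_field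
      using \<delta>(1) by (intro exI[of _ "\<lambda>s. 0 < s \<and> s < \<delta>"]) auto
  qed
  then show ?thesis using u hx by (simp add: frechet_subdiff_def)
qed

text \<open>Constant sequences serve as witnesses. The type only has a subtraction, so that
  self-differences have norm 0 is a hypothesis.\<close>

lemma frechet_subset_limiting:
  assumes "u \<in> frechet_subdiff V ip h x" "x \<in> V" "ip_norm ip (x - x) = 0" "ip_norm ip (u - u) = 0"
  shows "u \<in> limiting_subdiff V ip h x"
proof -
  have "u \<in> V" using assms(1) by (auto simp: frechet_subdiff_def split: if_splits)
  then show ?thesis
    using assms unfolding limiting_subdiff_def mem_Collect_eq
    by (intro conjI exI[of _ "\<lambda>_. x"] exI[of _ "\<lambda>_. u"]) auto
qed

text \<open>\<open>l\<close> is the gradient of \<open>q\<close> at \<open>x\<close>.\<close>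

lemma frechet_subdiff_composite_min:
  assumes u: "u \<in> V" and hx: "h x = ereal a"
    and mono: "mono \<Theta>" and deriv: "((\<lambda>t. \<Theta> (ereal t)) has_real_derivative p) (at a)" and p: "p > 0"
    and up: "\<And>y. y \<in> V \<Longrightarrow> ip u (y - x) = - (l (y - x) / p)"
    and l: "\<And>y. y \<in> V \<Longrightarrow> \<bar>l (y - x)\<bar> \<le> B * ip_norm ip (y - x)" and B: "B \<ge> 0"
    and q: "\<And>y. y \<in> V \<Longrightarrow> q y \<le> q x + l (y - x) + K * (ip_norm ip (y - x))\<^sup>2" and K: "K \<ge> 0"
    and \<rho>: "\<rho> > 0" and min: "\<And>y. y \<in> V \<Longrightarrow> ip_norm ip (y - x) < \<rho> \<Longrightarrow> \<Theta> (h x) + q x \<le> \<Theta> (h y) + (q y :: real)"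
  shows "u \<in> frechet_subdiff V ip h x"
proof (rule frechet_subdiffI[where a = a])
  fix \<epsilon> :: real assume \<epsilon>: "\<epsilon> > 0"
  \<comment> \<open>\<open>D\<close> bounds the change of the supporting value \<open>t\<close> per
    unit of distance. \<open>\<kappa>\<close> is chosen so that linearizing \<open>\<Theta>\<close>
    uses up at most half of the slack \<open>p * \<epsilon>\<close>.\<close>
  define D where "D = B / p + \<epsilon>"
  have Bp: "D > 0" using B p \<epsilon> by (simp add: D_def add_nonneg_pos)
  define \<kappa> where "\<kappa> = p * \<epsilon> / 2 / D"
  have \<kappa>: "\<kappa> > 0" using Bp p \<epsilon> by (simp add: \<kappa>_def)
  have "((\<lambda>t. (\<Theta> (ereal t) - \<Theta> (ereal a)) / (t - a)) \<longlongrightarrow> p) (at a)"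
    using deriv by (simp add: has_field_derivative_iff)
  then have "\<forall>\<^sub>F t in at a. dist ((\<Theta> (ereal t) - \<Theta> (ereal a)) / (t - a)) p < \<kappa>"
    using \<kappa> by (rule tendstoD)
  then obtain \<delta>\<^sub>0 where \<delta>\<^sub>0: "\<delta>\<^sub>0 > 0" and
    d0: "\<And>t. t \<noteq> a \<Longrightarrow> \<bar>t - a\<bar> < \<delta>\<^sub>0 \<Longrightarrow> \<bar>(\<Theta> (ereal t) - \<Theta> (ereal a)) / (t - a) - p\<bar> < \<kappa>"
    unfolding eventually_at dist_real_def by blast
  have lin: "\<Theta> (ereal t) \<le> \<Theta> (ereal a) + p * (t - a) + \<kappa> * \<bar>t - a\<bar>" if "\<bar>t - a\<bar> < \<delta>\<^sub>0" for t
  proof (cases "t = a")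
    case False
    define s where "s = (\<Theta> (ereal t) - \<Theta> (ereal a)) / (t - a)"
    have s: "\<Theta> (ereal t) - \<Theta> (ereal a) = s * (t - a)" using False by (simp add: s_def)
    have "(s - p) * (t - a) \<le> \<bar>s - p\<bar> * \<bar>t - a\<bar>" by (metis abs_ge_self abs_mult)
    also have "\<dots> \<le> \<kappa> * \<bar>t - a\<bar>" using d0[OF False that] unfolding s_def by (intro mult_right_mono) auto
    finally show ?thesis using s by (simp add: algebra_simps)
  qed simp
  \<comment> \<open>In this order: \<open>y\<close> stays where \<open>x\<close> is minimal,
    \<open>t\<close> stays where the linearization of \<open>\<Theta>\<close> holds, and the
    quadratic term of \<open>q\<close> stays below the other half of the slack. \<open>K + 1\<close>
    guards against \<open>K = 0\<close>.\<close>
  define \<delta> where "\<delta> = min \<rho> (min (\<delta>\<^sub>0 / D) (p * \<epsilon> / (2 * (K + 1))))"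
  have "\<delta> > 0" using \<rho> \<delta>\<^sub>0 Bp p \<epsilon> K by (simp add: \<delta>_def)
  moreover have "ereal (a + ip u (y - x) - \<epsilon> * ip_norm ip (y - x)) \<le> h y"
    if y: "y \<in> V" "0 < ip_norm ip (y - x)" "ip_norm ip (y - x) < \<delta>" for y
  proof (rule ccontr)
    define e where "e = ip_norm ip (y - x)"
    define t where "t = a + ip u (y - x) - \<epsilon> * e"
    assume "\<not> ?thesis"
    then have "h y < ereal t" by (simp add: t_def e_def)
    \<comment> \<open>Monotonicity replaces \<open>h y\<close>, which may be far from
      \<open>a\<close> or minus infinity, by the real number \<open>t\<close> close to
      \<open>a\<close>; so differentiability of \<open>\<Theta>\<close> at the single point
      \<open>a\<close> is enough.\<close>
    then have "\<Theta> (h y) \<le> \<Theta> (ereal t)" using mono by (simp add: mono_def less_imp_le)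
    have e: "e > 0" "e < \<rho>" "e < \<delta>\<^sub>0 / D" "e < p * \<epsilon> / (2 * (K + 1))"
      using y by (auto simp: e_def \<delta>_def)
    have "\<bar>t - a\<bar> \<le> \<bar>l (y - x)\<bar> / p + \<epsilon> * e"
      using up[OF y(1)] p \<epsilon> e(1) abs_triangle_ineq4[of "ip u (y - x)" "\<epsilon> * e"] by (simp add: t_def)
    also have "\<dots> \<le> B * e / p + \<epsilon> * e"
      using l[OF y(1)] p by (intro add_right_mono divide_right_mono) (auto simp: e_def)
    finally have ta: "\<bar>t - a\<bar> \<le> D * e" by (simp add: D_def algebra_simps)
    also have "\<dots> < \<delta>\<^sub>0" using e(3) Bp by (simp add: field_simps)
    finally have "\<Theta> (ereal t) \<le> \<Theta> (ereal a) + p * (t - a) + \<kappa> * \<bar>t - a\<bar>" by (rule lin)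
    also have "\<kappa> * \<bar>t - a\<bar> \<le> \<kappa> * (D * e)" using ta \<kappa> by (intro mult_left_mono) auto
    also have "\<kappa> * (D * e) = p * \<epsilon> / 2 * e" using Bp by (simp add: \<kappa>_def)
    also have "p * (t - a) = - l (y - x) - p * \<epsilon> * e" using up[OF y(1)] p by (simp add: t_def algebra_simps)
    finally have "\<Theta> (h y) \<le> \<Theta> (h x) - l (y - x) - p * \<epsilon> / 2 * e"
      using \<open>\<Theta> (h y) \<le> \<Theta> (ereal t)\<close> hx by (simp add: mult.commute mult.left_commute)
    moreover have "\<Theta> (h x) + q x \<le> \<Theta> (h y) + q y" using min y(1) e(2) unfolding e_def by blast
    moreover have "q y \<le> q x + l (y - x) + K * e\<^sup>2" using q[OF y(1)] unfolding e_def .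
    ultimately have "p * \<epsilon> / 2 * e \<le> K * e\<^sup>2" by linarith
    then have "p * \<epsilon> / 2 \<le> K * e" using e(1) by (simp add: power2_eq_square)
    also have "\<dots> \<le> (K + 1) * e" using e(1) by (simp add: algebra_simps)
    also have "\<dots> < p * \<epsilon> / 2" using e(4) K by (simp add: field_simps)
    finally show False by simp
  qed
  ultimately show "\<exists>\<delta>>0. \<forall>y\<in>V. 0 < ip_norm ip (y - x) \<and> ip_norm ip (y - x) < \<delta> \<longrightarrow>
      ereal (a + ip u (y - x) - \<epsilon> * ip_norm ip (y - x)) \<le> h y" by blast
qed (use u hx in auto)

section \<open>Penalized minimization and the KL error bound\<close>

text \<open>Lower semicontinuity relative to the carrier and to \<open>Z_norm\<close>. It is
  sequential because compactness is available in sequential form.\<close>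

definition Z_lsc :: "nat \<Rightarrow> (nat \<Rightarrow> nat) \<Rightarrow> (nat \<Rightarrow> nat) \<Rightarrow> real^'N^'N \<Rightarrow> ('N::finite var \<Rightarrow> ereal) \<Rightarrow> bool" where
  "Z_lsc J m n W h \<longleftrightarrow> (\<forall>X z t. (\<forall>l. X l \<in> Z_space J m n) \<and> z \<in> Z_space J m n \<and>
     (\<lambda>l. Z_norm J W (X l - z)) \<longlonglongrightarrow> 0 \<and> t < h z \<longrightarrow> (\<forall>\<^sub>F l in sequentially. t < h (X l)))"

lemma Z_norm_le_dist_add:
  assumes W: "sym_pos_def W" and A: "A \<in> Z_space J m n" and B: "B \<in> Z_space J m n"
  shows "Z_norm J W A \<le> Z_norm J W (A - B) + Z_norm J W B"
proof -
  have Z0: "Z_zero J m n \<in> Z_space J m n" by (auto simp: Z_zero_def Z_space_def)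
  have "Z_norm J W (X - Z_zero J m n) = Z_norm J W X" if "X \<in> Z_space J m n" for X
  proof -
    have "snd X j - 0\<^sub>m (m j) (n j) = snd X j" if "j \<in> {1..J}" for j
      using Z_spaceD[OF \<open>X \<in> _\<close> that] by (intro eq_matI) auto
    then show ?thesis by (simp add: Z_norm_def Z_zero_def)
  qed
  then show ?thesis using Z_norm_triangle[OF W A B Z0] A B by simp
qed

text \<open>The direct method: a minimizing sequence in the closed ball has a convergent
  subsequence, whose limit stays in the ball and is a minimizer by lower semicontinuity.\<close>

lemma Z_ball_attains_min:
  fixes E :: "'N::finite var \<Rightarrow> real"
  assumes W: "sym_pos_def W" and z: "z \<in> Z_space J m n" and \<rho>: "\<rho> \<ge> 0"
    and bdd: "\<And>y. y \<in> Z_space J m n \<Longrightarrow> E y \<ge> 0"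
    and lsc: "\<And>X y \<epsilon>. (\<And>l. X l \<in> Z_space J m n) \<Longrightarrow> y \<in> Z_space J m n \<Longrightarrow>
      (\<lambda>l. Z_norm J W (X l - y)) \<longlonglongrightarrow> 0 \<Longrightarrow> \<epsilon> > 0 \<Longrightarrow> \<forall>\<^sub>F l in sequentially. E y - \<epsilon> \<le> E (X l)"
  shows "\<exists>y\<in>Z_space J m n. Z_norm J W (y - z) \<le> \<rho> \<and>
    (\<forall>x\<in>Z_space J m n. Z_norm J W (x - z) \<le> \<rho> \<longrightarrow> E y \<le> E x)"
proof -
  define S where "S = {y \<in> Z_space J m n. Z_norm J W (y - z) \<le> \<rho>}"
  define I where "I = Inf (E ` S)"
  have zS: "z \<in> S" using z \<rho> by (simp add: S_def Z_norm_self_diff)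
  have below: "bdd_below (E ` S)" using bdd by (auto simp: S_def bdd_below_def)
  have I: "I \<le> E x" if "x \<in> S" for x unfolding I_def using below that by (intro cInf_lower) auto
  have "\<exists>x\<in>S. E x < I + 1 / real (Suc l)" for l
    using cInf_lessD[of "E ` S" "I + 1 / real (Suc l)"] zS by (auto simp: I_def)
  then obtain X where X: "\<And>l. X l \<in> S" "\<And>l. E (X l) < I + 1 / real (Suc l)" by metis
  have XV: "X l \<in> Z_space J m n" and X\<rho>: "Z_norm J W (X l - z) \<le> \<rho>" for l using X(1)[of l] by (auto simp: S_def)
  have X_bdd: "Z_norm J W (X l) \<le> \<rho> + Z_norm J W z" for l
    using Z_norm_le_dist_add[OF W XV[of l] z] X\<rho>[of l] by simp
  obtain y r where y: "y \<in> Z_space J m n" and r: "strict_mono r"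
    and lim: "(\<lambda>l. Z_norm J W (X (r l) - y)) \<longlonglongrightarrow> 0"
    using Z_space_Bolzano_Weierstrass[of W X, OF W XV X_bdd] by blast
  have "Z_norm J W (y - z) \<le> 0 + \<rho>"
  proof (rule LIMSEQ_le_const[OF tendsto_add[OF lim tendsto_const]])
    have "Z_norm J W (y - z) \<le> Z_norm J W (X (r l) - y) + \<rho>" for l
      using Z_norm_triangle[OF W y XV[of "r l"] z] Z_norm_minus_commute[OF y XV[of "r l"]] X\<rho>[of "r l"] by simp
    then show "\<exists>N. \<forall>l\<ge>N. Z_norm J W (y - z) \<le> Z_norm J W (X (r l) - y) + \<rho>" by blast
  qed
  moreover have "E y \<le> I"
  proof (rule field_le_epsilon)
    fix \<epsilon> :: real assume "\<epsilon> > 0"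
    then have 1: "\<forall>\<^sub>F l in sequentially. E y - \<epsilon> / 2 \<le> E (X (r l))"
      using lsc[of "\<lambda>l. X (r l)" y "\<epsilon> / 2"] XV y lim by auto
    have "(\<lambda>l. 1 / real (Suc l)) \<longlonglongrightarrow> 0" by (rule LIMSEQ_Suc[OF lim_1_over_n])
    then have "\<forall>\<^sub>F l in sequentially. 1 / real (Suc (r l)) < \<epsilon> / 2"
      using LIMSEQ_subseq_LIMSEQ[OF _ r, of "\<lambda>l. 1 / real (Suc l)" 0] \<open>\<epsilon> > 0\<close>
      by (intro order_tendstoD(2)[of _ 0]) (auto simp: o_def)
    with 1 have "\<forall>\<^sub>F l in sequentially. E y \<le> I + \<epsilon>"
    proof eventually_elim
      case (elim l)
      then show ?case using X(2)[of "r l"] by linarith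
    qed
    then show "E y \<le> I + \<epsilon>" by simp
  qed
  ultimately show ?thesis using y I by (intro bexI[of _ y]) (auto simp: S_def intro: order_trans)
qed

text \<open>Concavity of the square root. With an exact quadratic for the squared distance it yields
  the quadratic upper model of the smoothed distance.\<close>

lemma sqrt_le_tangent:
  assumes "a > 0" "b \<ge> 0"
  shows "sqrt b \<le> sqrt a + (b - a) / (2 * sqrt a)"
proof -
  have "(sqrt b - sqrt a)\<^sup>2 \<ge> 0" by simp
  then have "2 * sqrt a * sqrt b \<le> a + b" using assms by (simp add: power2_diff algebra_simps)
  then have "2 * sqrt a * sqrt b \<le> 2 * sqrt a * (sqrt a + (b - a) / (2 * sqrt a))"
    using assms by (simp add: distrib_left mult.assoc)
  then show ?thesis using assms by simp
qed

lemma norm_W_scaleR: "norm_W W (c *\<^sub>R x) = \<bar>c\<bar> * norm_W W x"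
  by (simp add: ip_norm_def inner_W_simps real_sqrt_mult flip: mult.assoc)

lemma frob_norm_smult:
  assumes "A \<in> carrier_mat p q"
  shows "frob_norm (c \<cdot>\<^sub>m A) = \<bar>c\<bar> * frob_norm A"
  using assms
  by (simp add: ip_norm_def frob_inner_smult_left frob_inner_smult_right[of A p q] flip: mult.assoc)
     (simp add: real_sqrt_mult)

text \<open>Smoothing the distance to \<open>z\<close> by \<open>\<delta>\<close> makes it differentiable at \<open>z\<close> itself, with gradient of
  norm less than 1, so that no subdifferential sum rule is required.\<close>

lemma penalized_min_subgradient:
  fixes h :: "'N::finite var \<Rightarrow> ereal"
  assumes W: "sym_pos_def W" and b: "b \<in> Z_space J m n" and z: "z \<in> Z_space J m n"
    and hb: "h b = ereal a" and \<delta>: "\<delta> > 0"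
    and mono: "mono \<Theta>" and deriv: "((\<lambda>t. \<Theta> (ereal t)) has_real_derivative p) (at a)" and p: "p > 0"
    and \<rho>: "Z_norm J W (b - z) < \<rho>"
    and min: "\<And>y. y \<in> Z_space J m n \<Longrightarrow> Z_norm J W (y - z) \<le> \<rho> \<Longrightarrow>
       \<Theta> (h b) + sqrt ((Z_norm J W (b - z))\<^sup>2 + \<delta>\<^sup>2) \<le> \<Theta> (h y) + sqrt ((Z_norm J W (y - z))\<^sup>2 + \<delta>\<^sup>2)"
  shows "\<exists>A\<in>Z_subdiff J m n W h b. p * Z_norm J W A < 1"
proof -
  define d where "d = Z_norm J W (b - z)"
  define Q where "Q = sqrt (d\<^sup>2 + \<delta>\<^sup>2)"
  \<comment> \<open>\<open>A\<close> is minus the gradient at \<open>b\<close> of the smoothed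
    distance, divided by \<open>p\<close>. Hence \<open>p\<close> times its norm is
    \<open>d / Q\<close>, which is less than 1 because \<open>\<delta>\<close> is positive.\<close>
  define c where "c = - (1 / (p * Q))"
  define A :: "'N var" where "A = (c *\<^sub>R (fst b - fst z), \<lambda>j\<in>{1..J}. c \<cdot>\<^sub>m (snd b j - snd z j))"
  have d: "d \<ge> 0" by (simp add: d_def Z_norm_nonneg)
  have dQ: "d < Q" unfolding Q_def using \<delta> d by (intro real_less_rsqrt) simp
  have Q: "Q > 0" using dQ d by simp
  have Q2: "d\<^sup>2 + \<delta>\<^sup>2 > 0" using \<delta> by (simp add: add_nonneg_pos)
  have \<rho>': "\<rho> - d > 0" using \<rho> by (simp add: d_def)
  have AZ: "A \<in> Z_space J m n"
    unfolding A_def Z_space_def using Z_spaceD[OF z] by (auto simp: minus_carrier_mat)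
  have quad: "sqrt ((Z_norm J W (y - z))\<^sup>2 + \<delta>\<^sup>2) \<le> Q + i / Q + 1 / (2 * Q) * N\<^sup>2"
    if "(Z_norm J W (y - z))\<^sup>2 = (Z_norm J W (b - z))\<^sup>2 + 2 * i + N\<^sup>2" for y i N
  proof -
    have "sqrt ((Z_norm J W (y - z))\<^sup>2 + \<delta>\<^sup>2) \<le> Q + (2 * i + N\<^sup>2) / (2 * Q)"
    proof -
      have eq: "(Z_norm J W (y - z))\<^sup>2 + \<delta>\<^sup>2 - (d\<^sup>2 + \<delta>\<^sup>2) = 2 * i + N\<^sup>2"
        using that by (simp add: d_def)
      show ?thesis
        using sqrt_le_tangent[OF Q2, of "(Z_norm J W (y - z))\<^sup>2 + \<delta>\<^sup>2"]
        unfolding eq Q_def[symmetric] by simp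
    qed
    then show ?thesis by (simp add: add_divide_distrib)
  qed
  \<comment> \<open>The ball of radius \<open>\<rho> - d\<close> around \<open>b\<close> lies inside
    the ball on which \<open>b\<close> is minimal, so the constraint is inactive near
    \<open>b\<close>.\<close>
  have min': "\<Theta> (h b) + Q \<le> \<Theta> (h y) + sqrt ((Z_norm J W (y - z))\<^sup>2 + \<delta>\<^sup>2)"
    if "y \<in> Z_space J m n" "Z_norm J W (y - b) < \<rho> - d" for y
    using min[OF that(1)] that(2) Z_norm_triangle[OF W that(1) b z] by (simp add: Q_def d_def)
  have "fst A \<in> frechet_subdiff UNIV (inner_W W) (\<lambda>x. h (x, snd b)) (fst b)"
  proof (rule frechet_subdiff_composite_min[where a = a and \<Theta> = \<Theta> and p = p
        and l = "\<lambda>v. inner_W W (fst b - fst z) v / Q" and B = "norm_W W (fst b - fst z) / Q"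
        and q = "\<lambda>x. sqrt ((Z_norm J W ((x, snd b) - z))\<^sup>2 + \<delta>\<^sup>2)" and K = "1 / (2 * Q)" and \<rho> = "\<rho> - d"])
    show "inner_W W (fst A) (y - fst b) = - (inner_W W (fst b - fst z) (y - fst b) / Q / p)" for y
      unfolding A_def c_def fst_conv inner_W_simps(5) by (simp add: mult.commute)
    show "\<bar>inner_W W (fst b - fst z) (y - fst b) / Q\<bar> \<le>
        norm_W W (fst b - fst z) / Q * ip_norm (inner_W W) (y - fst b)" for y
      using inner_W_Cauchy_Schwarz[OF W, of "fst b - fst z" "y - fst b"] Q
      by (simp add: abs_divide divide_right_mono)
    show "sqrt ((Z_norm J W ((y, snd b) - z))\<^sup>2 + \<delta>\<^sup>2) \<le>
        sqrt ((Z_norm J W ((fst b, snd b) - z))\<^sup>2 + \<delta>\<^sup>2) + inner_W W (fst b - fst z) (y - fst b) / Q +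
        1 / (2 * Q) * (ip_norm (inner_W W) (y - fst b))\<^sup>2" for y
      using quad[OF Z_norm_slice_fst_expand[OF W]] by (simp add: Q_def d_def)
    show "\<Theta> (h (fst b, snd b)) + sqrt ((Z_norm J W ((fst b, snd b) - z))\<^sup>2 + \<delta>\<^sup>2) \<le>
        \<Theta> (h (y, snd b)) + sqrt ((Z_norm J W ((y, snd b) - z))\<^sup>2 + \<delta>\<^sup>2)"
      if "ip_norm (inner_W W) (y - fst b) < \<rho> - d" for y
      using min'[OF Z_space_slice_fst[OF b]] that by (simp add: Z_norm_slice_fst[OF W] Q_def d_def)
  qed (use hb mono deriv p Q \<rho>' norm_W_nonneg[OF W] in auto)
  then have 1: "fst A \<in> limiting_subdiff UNIV (inner_W W) (\<lambda>x. h (x, snd b)) (fst b)"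
    by (rule frechet_subset_limiting) (auto simp: ip_norm_def inner_W_def)
  have 2: "snd A j \<in> limiting_subdiff (carrier_mat (m j) (n j)) frob_inner (\<lambda>M. h (fst b, (snd b)(j := M))) (snd b j)"
    if j: "j \<in> {1..J}" for j
  proof (rule frechet_subset_limiting)
    note bj = Z_spaceD[OF b j] and zj = Z_spaceD[OF z j]
    have Aj: "snd A j = c \<cdot>\<^sub>m (snd b j - snd z j)" using j by (simp add: A_def)
    show "snd A j \<in> frechet_subdiff (carrier_mat (m j) (n j)) frob_inner (\<lambda>M. h (fst b, (snd b)(j := M))) (snd b j)"
    proof (rule frechet_subdiff_composite_min[where a = a and \<Theta> = \<Theta> and p = p
          and l = "\<lambda>v. frob_inner (snd b j - snd z j) v / Q" and B = "frob_norm (snd b j - snd z j) / Q"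
          and q = "\<lambda>M. sqrt ((Z_norm J W ((fst b, (snd b)(j := M)) - z))\<^sup>2 + \<delta>\<^sup>2)" and K = "1 / (2 * Q)" and \<rho> = "\<rho> - d"])
      show "frob_inner (snd A j) (y - snd b j) = - (frob_inner (snd b j - snd z j) (y - snd b j) / Q / p)" for y
        by (simp add: Aj c_def frob_inner_smult_left)
      show "\<bar>frob_inner (snd b j - snd z j) (y - snd b j) / Q\<bar> \<le>
          frob_norm (snd b j - snd z j) / Q * frob_norm (y - snd b j)" for y
        using frob_Cauchy_Schwarz[OF minus_carrier_mat[OF zj] minus_carrier_mat[OF bj]] Q
        by (simp add: abs_divide divide_right_mono)
      show "sqrt ((Z_norm J W ((fst b, (snd b)(j := y)) - z))\<^sup>2 + \<delta>\<^sup>2) \<le>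
          sqrt ((Z_norm J W ((fst b, (snd b)(j := snd b j)) - z))\<^sup>2 + \<delta>\<^sup>2) +
          frob_inner (snd b j - snd z j) (y - snd b j) / Q + 1 / (2 * Q) * (frob_norm (y - snd b j))\<^sup>2"
        if "y \<in> carrier_mat (m j) (n j)" for y
        using quad[OF Z_norm_slice_snd_expand[OF b z j that]] by (simp add: Q_def d_def)
      show "\<Theta> (h (fst b, (snd b)(j := snd b j))) + sqrt ((Z_norm J W ((fst b, (snd b)(j := snd b j)) - z))\<^sup>2 + \<delta>\<^sup>2) \<le>
          \<Theta> (h (fst b, (snd b)(j := y))) + sqrt ((Z_norm J W ((fst b, (snd b)(j := y)) - z))\<^sup>2 + \<delta>\<^sup>2)"
        if "y \<in> carrier_mat (m j) (n j)" "frob_norm (y - snd b j) < \<rho> - d" for y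
        using min'[OF Z_space_slice_snd[OF b j that(1)]] that(2) by (simp add: Z_norm_slice_snd[OF j] Q_def d_def)
    qed (use hb mono deriv p Q \<rho>' frob_norm_nonneg zj in \<open>auto simp: Aj minus_carrier_mat\<close>)
  qed (use Z_spaceD[OF b j] in \<open>simp_all only: frob_norm_self_diff\<close>)
  have "A \<in> Z_subdiff J m n W h b" using AZ 1 2 by (simp add: Z_subdiff_def)
  moreover have "(Z_norm J W A)\<^sup>2 = (\<bar>c\<bar> * d)\<^sup>2"
  proof -
    have "(\<Sum>j=1..J. (frob_norm (snd A j))\<^sup>2) = (\<Sum>j=1..J. c\<^sup>2 * (frob_norm (snd b j - snd z j))\<^sup>2)"
      using frob_norm_smult[OF minus_carrier_mat[OF Z_spaceD[OF z]]]
      by (intro sum.cong) (auto simp: A_def power_mult_distrib)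
    then show ?thesis
      unfolding Z_norm_power2 d_def power_mult_distrib
      by (simp add: A_def norm_W_scaleR power_mult_distrib sum_distrib_left distrib_left)
  qed
  then have "Z_norm J W A = \<bar>c\<bar> * d"
    by (rule power2_eq_imp_eq) (use d Z_norm_nonneg in simp_all)
  then have "p * Z_norm J W A = d / Q" using p Q by (simp add: c_def abs_mult)
  then have "p * Z_norm J W A < 1" using dQ Q by simp
  ultimately show ?thesis by blast
qed

lemma Z_lscD:
  assumes "Z_lsc J m n W h" "\<And>l. X l \<in> Z_space J m n" "z \<in> Z_space J m n"
    "(\<lambda>l. Z_norm J W (X l - z)) \<longlonglongrightarrow> 0" "t < h z"
  shows "\<forall>\<^sub>F l in sequentially. t < h (X l)"
  using assms unfolding Z_lsc_def by blast

lemma tendsto_Z_dist: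
  assumes W: "sym_pos_def W" and X: "\<And>l. X l \<in> Z_space J m n" and y: "y \<in> Z_space J m n" and z: "z \<in> Z_space J m n"
    and lim: "(\<lambda>l. Z_norm J W (X l - y)) \<longlonglongrightarrow> 0"
  shows "(\<lambda>l. Z_norm J W (X l - z)) \<longlonglongrightarrow> Z_norm J W (y - z)"
proof (rule LIM_zero_cancel, rule tendsto_rabs_zero_cancel, rule tendsto_sandwich[OF _ _ tendsto_const lim])
  have "\<bar>Z_norm J W (X l - z) - Z_norm J W (y - z)\<bar> \<le> Z_norm J W (X l - y)" for l
    using Z_norm_triangle[OF W X[of l] y z] Z_norm_triangle[OF W y X[of l] z] Z_norm_minus_commute[OF y X[of l], of W] by simp
  then show "\<forall>\<^sub>F l in sequentially. \<bar>Z_norm J W (X l - z) - Z_norm J W (y - z)\<bar> \<le> Z_norm J W (X l - y)"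
    by simp
qed simp

text \<open>The KL property used here does not require \<open>\<phi>\<close> to be concave, so \<open>\<phi>\<close> cannot be telescoped along
  the iterates by means of a relative error condition; this error bound takes its place.\<close>

lemma KL_error_bound:
  fixes h :: "'N::finite var \<Rightarrow> ereal"
  assumes W: "sym_pos_def W" and lsc: "Z_lsc J m n W h"
    and KL: "KL_property_at (Z_space J m n) (Z_norm J W) (Z_subdiff J m n W h) h zs"
    and zs: "zs \<in> Z_space J m n" and hzs: "h zs = ereal F"
  shows "\<exists>r>0. \<exists>\<eta>>0. \<exists>\<phi>. continuous_on {0..\<eta>} \<phi> \<and> \<phi> 0 = 0 \<and> strict_mono_on {0..\<eta>} \<phi> \<and>
    (\<forall>z\<in>Z_space J m n. \<forall>t s \<delta>. Z_norm J W (z - zs) < r \<and> h z = ereal t \<and> F \<le> s \<and> s < t \<and> t < F + \<eta> \<and> \<delta> > 0 \<longrightarrow>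
      (\<exists>y\<in>Z_space J m n. h y \<le> ereal s \<and> Z_norm J W (y - z) \<le> \<phi> (t - F) - \<phi> (s - F) + \<delta>))"
proof -
  obtain \<eta>\<^sub>0 :: ereal and r\<^sub>0 :: real and \<phi> \<psi> where \<eta>\<^sub>0: "\<eta>\<^sub>0 > 0" and r\<^sub>0: "r\<^sub>0 > 0"
    and cont0: "continuous_on {s. 0 \<le> s \<and> ereal s < \<eta>\<^sub>0} \<phi>" and \<phi>0: "\<phi> 0 = 0"
    and deriv: "\<forall>s. 0 < s \<and> ereal s < \<eta>\<^sub>0 \<longrightarrow> (\<phi> has_real_derivative \<psi> s) (at s) \<and> \<psi> s > 0"
    and slope: "\<forall>x\<in>Z_space J m n. Z_norm J W (x - zs) < r\<^sub>0 \<and> h zs < h x \<and> h x < h zs + \<eta>\<^sub>0 \<longrightarrow>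
       ereal (\<psi> (real_of_ereal (h x - h zs))) * dist_origin (Z_norm J W) (Z_subdiff J m n W h x) \<ge> 1"
    using KL unfolding KL_property_at_def by blast
  \<comment> \<open>\<open>\<eta>\<^sub>0\<close> may be infinite. A real number below it gives a
    compact interval inside the domain of \<open>\<phi>\<close>.\<close>
  obtain \<eta>\<^sub>1 :: real where \<eta>\<^sub>1: "0 < ereal \<eta>\<^sub>1" "ereal \<eta>\<^sub>1 < \<eta>\<^sub>0" using ereal_dense2[OF \<eta>\<^sub>0] by blast
  then have "\<eta>\<^sub>1 > 0" by simp
  have below: "ereal s < \<eta>\<^sub>0" if "s \<le> \<eta>\<^sub>1" for s using that \<eta>\<^sub>1(2) by (meson ereal_less_eq(3) le_less_trans)
  have cont1: "continuous_on {0..\<eta>\<^sub>1} \<phi>" by (rule continuous_on_subset[OF cont0]) (use below in auto)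
  obtain d where d: "d > 0" "\<And>s. s \<in> {0..\<eta>\<^sub>1} \<Longrightarrow> \<bar>s\<bar> < d \<Longrightarrow> \<bar>\<phi> s\<bar> < r\<^sub>0 / 4"
    using cont1 \<open>\<eta>\<^sub>1 > 0\<close> r\<^sub>0 \<phi>0 unfolding continuous_on_iff dist_real_def
    by (metis atLeastAtMost_iff diff_zero divide_pos_pos less_eq_real_def order_refl zero_less_numeral)
  \<comment> \<open>\<open>\<eta>\<close> is so small that \<open>\<phi>\<close> stays below
    \<open>r\<^sub>0 / 4\<close> on the interval; this will keep the penalized minimizer off the
    boundary of its ball.\<close>
  define \<eta> where "\<eta> = min \<eta>\<^sub>1 (d / 2)"
  have \<eta>: "\<eta> > 0" "\<eta> \<le> \<eta>\<^sub>1" using \<open>\<eta>\<^sub>1 > 0\<close> d(1) by (auto simp: \<eta>_def)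
  have "\<eta> < d" using d(1) by (auto simp: \<eta>_def)
  then have \<phi>\<eta>: "\<phi> \<eta> < r\<^sub>0 / 4" using d(2)[of \<eta>] \<eta> by simp
  have cont: "continuous_on {0..\<eta>} \<phi>" by (rule continuous_on_subset[OF cont1]) (use \<eta> in auto)
  have smono: "strict_mono_on {0..\<eta>} \<phi>"
  proof (rule strict_mono_onI)
    fix x y assume xy: "x \<in> {0..\<eta>}" "y \<in> {0..\<eta>}" "x < y"
    show "\<phi> x < \<phi> y"
    proof (rule DERIV_pos_imp_increasing_open[OF xy(3)])
      show "\<exists>v. (\<phi> has_real_derivative v) (at u) \<and> v > 0" if "x < u" "u < y" for u
        using deriv[rule_format, of u] below[of u] that xy \<eta> by (intro exI[of _ "\<psi> u"]) auto
      show "continuous_on {x..y} \<phi>" by (rule continuous_on_subset[OF cont]) (use xy in auto)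
    qed
  qed
  have mono: "\<phi> x \<le> \<phi> y" if "0 \<le> x" "x \<le> y" "y \<le> \<eta>" for x y
    using strict_mono_on_leD[OF smono, of x y] that by auto
  have bound: "\<exists>y\<in>Z_space J m n. h y \<le> ereal s \<and> Z_norm J W (y - z) \<le> \<phi> (t - F) - \<phi> (s - F) + \<delta>"
    if z: "z \<in> Z_space J m n" and zr: "Z_norm J W (z - zs) < r\<^sub>0 / 2" and hz: "h z = ereal t"
      and s: "F \<le> s" and st: "s < t" and t: "t < F + \<eta>" and \<delta>: "0 < \<delta>" "\<delta> < r\<^sub>0 / 8" for z t s \<delta>
  proof -
    \<comment> \<open>\<open>T\<close> clamps the excess over \<open>F\<close> to the interval from
      \<open>s - F\<close> to \<open>\<eta>\<close>. Cutting below at \<open>s - F\<close> leaves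
      nothing to gain once the level \<open>s\<close> is reached; cutting above at
      \<open>\<eta>\<close> keeps \<open>\<phi>\<close> within its domain. The infinities are
      separate cases because \<open>real_of_ereal\<close> sends both to 0.\<close>
    define T where "T = (\<lambda>e. if e = \<infinity> then \<eta> else if e = - \<infinity> then s - F else max (s - F) (min \<eta> (real_of_ereal e - F)))"
    define \<Theta> where "\<Theta> = (\<lambda>e. \<phi> (T e))"
    have T_range: "s - F \<le> T e" "T e \<le> \<eta>" for e using st t by (auto simp: T_def)
    have T_nonneg: "0 \<le> T e" for e using T_range(1)[of e] s by simp
    have T_mono: "T e \<le> T e'" if "e \<le> e'" for e e'
      using that st t by (cases e; cases e') (auto simp: T_def)
    have T_real: "T (ereal v) = max (s - F) (min \<eta> (v - F))" for v by (simp add: T_def)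
    have \<Theta>_mono: "mono \<Theta>"
      unfolding \<Theta>_def mono_def using T_mono T_range(2) T_nonneg by (auto intro!: mono)
    have \<Theta>_ge: "\<phi> (s - F) \<le> \<Theta> e" for e unfolding \<Theta>_def using T_range[of e] s by (intro mono) auto
    have \<phi>s: "\<phi> (s - F) \<ge> 0" using mono[of 0 "s - F"] s st t \<phi>0 by simp
    define E where "E = (\<lambda>y. \<Theta> (h y) + sqrt ((Z_norm J W (y - z))\<^sup>2 + \<delta>\<^sup>2))"
    have lsc\<Theta>: "\<forall>\<^sub>F l in sequentially. \<Theta> (h y) - \<epsilon> \<le> \<Theta> (h (X l))"
      if X: "\<And>l. X l \<in> Z_space J m n" and y: "y \<in> Z_space J m n"
        and lim: "(\<lambda>l. Z_norm J W (X l - y)) \<longlonglongrightarrow> 0" and \<epsilon>: "\<epsilon> > 0" for X y and \<epsilon> :: real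
    proof (cases "T (h y) = s - F")
      case True
      then have "\<Theta> (h y) - \<epsilon> \<le> \<Theta> (h (X l))" for l
        using \<Theta>_ge[of "h (X l)"] \<epsilon> by (simp add: \<Theta>_def)
      then show ?thesis by simp
    next
      case False
      then have gt: "s - F < T (h y)" using T_range(1)[of "h y"] by simp
      have "T (h y) \<in> {0..\<eta>}" using T_range[of "h y"] s by simp
      then obtain d where d: "d > 0" "\<And>v. v \<in> {0..\<eta>} \<Longrightarrow> \<bar>v - T (h y)\<bar> < d \<Longrightarrow> \<bar>\<phi> v - \<phi> (T (h y))\<bar> < \<epsilon>"
        using cont \<epsilon> unfolding continuous_on_iff dist_real_def by blast
      \<comment> \<open>A level slightly below \<open>T (h y)\<close>, still within the clamped
        range: lower semicontinuity of \<open>h\<close> carries it to the sequence, and continuity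
        of \<open>\<phi>\<close> makes the loss less than \<open>\<epsilon>\<close>.\<close>
      define v where "v = max (s - F) (T (h y) - d / 2)"
      have v: "v \<in> {0..\<eta>}" "v < T (h y)" "s - F \<le> v" "\<bar>v - T (h y)\<bar> < d"
        using gt d(1) T_range[of "h y"] s by (auto simp: v_def)
      have "ereal (v + F) < h y"
        using v(2,3) gt by (cases "h y") (auto simp: T_def split: if_splits)
      then have "\<forall>\<^sub>F l in sequentially. ereal (v + F) < h (X l)"
        by (rule Z_lscD[OF lsc X y lim])
      then show ?thesis
      proof eventually_elim
        case (elim l)
        have "v = T (ereal (v + F))" using v(1,3) by (simp add: T_real)
        also have "\<dots> \<le> T (h (X l))" using elim by (intro T_mono) simp
        finally have "\<phi> v \<le> \<Theta> (h (X l))" unfolding \<Theta>_def using v(1) T_range(2) by (intro mono) auto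
        then show ?case using d(2)[OF v(1,4)] by (simp add: \<Theta>_def)
      qed
    qed
    have "\<exists>b\<in>Z_space J m n. Z_norm J W (b - z) \<le> r\<^sub>0 / 2 \<and>
        (\<forall>x\<in>Z_space J m n. Z_norm J W (x - z) \<le> r\<^sub>0 / 2 \<longrightarrow> E b \<le> E x)"
    proof (rule Z_ball_attains_min[OF W z])
      show "E y \<ge> 0" for y using \<Theta>_ge[of "h y"] \<phi>s by (simp add: E_def)
      fix X y and \<epsilon> :: real
      assume X: "\<And>l. X l \<in> Z_space J m n" and y: "y \<in> Z_space J m n"
        and lim: "(\<lambda>l. Z_norm J W (X l - y)) \<longlonglongrightarrow> 0" and \<epsilon>: "\<epsilon> > 0"
      have "(\<lambda>l. sqrt ((Z_norm J W (X l - z))\<^sup>2 + \<delta>\<^sup>2)) \<longlonglongrightarrow> sqrt ((Z_norm J W (y - z))\<^sup>2 + \<delta>\<^sup>2)"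
        by (intro tendsto_intros tendsto_Z_dist[OF W X y z lim])
      then have "\<forall>\<^sub>F l in sequentially. sqrt ((Z_norm J W (y - z))\<^sup>2 + \<delta>\<^sup>2) - \<epsilon> / 2 < sqrt ((Z_norm J W (X l - z))\<^sup>2 + \<delta>\<^sup>2)"
        using \<epsilon> by (intro order_tendstoD(1)) auto
      moreover have "\<forall>\<^sub>F l in sequentially. \<Theta> (h y) - \<epsilon> / 2 \<le> \<Theta> (h (X l))"
        using lsc\<Theta>[OF X y lim, of "\<epsilon> / 2"] \<epsilon> by simp
      ultimately show "\<forall>\<^sub>F l in sequentially. E y - \<epsilon> \<le> E (X l)"
        unfolding E_def by eventually_elim linarith
    qed (use r\<^sub>0 in simp)
    then obtain b where b: "b \<in> Z_space J m n"
      and bmin: "\<And>x. x \<in> Z_space J m n \<Longrightarrow> Z_norm J W (x - z) \<le> r\<^sub>0 / 2 \<Longrightarrow> E b \<le> E x" by blast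
    have Tz: "T (h z) = t - F" unfolding hz T_real using st t by simp
    have "E b \<le> E z" by (rule bmin[OF z]) (use r\<^sub>0 in \<open>simp add: Z_norm_self_diff\<close>)
    \<comment> \<open>At the centre the smoothed distance is \<open>\<delta>\<close>, which is the
      additive error in the claim.\<close>
    also have "E z = \<phi> (t - F) + \<delta>" using \<delta>(1) by (simp add: E_def \<Theta>_def Tz Z_norm_self_diff)
    finally have Eb: "\<Theta> (h b) + sqrt ((Z_norm J W (b - z))\<^sup>2 + \<delta>\<^sup>2) \<le> \<phi> (t - F) + \<delta>" by (simp add: E_def)
    have "Z_norm J W (b - z) \<le> sqrt ((Z_norm J W (b - z))\<^sup>2 + \<delta>\<^sup>2)" by (intro real_le_rsqrt) simp
    then have dist: "Z_norm J W (b - z) \<le> \<phi> (t - F) - \<phi> (s - F) + \<delta>" using Eb \<Theta>_ge[of "h b"] by linarith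
    have "\<phi> (t - F) \<le> \<phi> \<eta>" using s st t by (intro mono) auto
    \<comment> \<open>The budget is \<open>r\<^sub>0 / 4\<close> from \<open>\<phi>\<close> and
      \<open>r\<^sub>0 / 8\<close> from \<open>\<delta>\<close>, so the minimizer is
      interior.\<close>
    then have dist': "Z_norm J W (b - z) < r\<^sub>0 / 2" using dist \<phi>\<eta> \<phi>s \<delta>(2) r\<^sub>0 by simp
    \<comment> \<open>If \<open>h b\<close> were above \<open>s\<close>, then
      \<open>\<Theta>\<close> would have the positive slope \<open>\<psi> (a - F)\<close> at
      \<open>a = h b\<close>, and minimality of \<open>b\<close> would give a subgradient whose norm
      times this slope is less than 1, against the KL inequality.\<close>
    have "h b \<le> ereal s"
    proof (rule ccontr)
      assume "\<not> h b \<le> ereal s"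
      then have hb_gt: "ereal s < h b" by simp
      \<comment> \<open>The penalty is never below \<open>\<delta>\<close>, so the two terms
        \<open>\<delta>\<close> cancel and \<open>h b\<close> is at most \<open>t\<close>: the upper
        cut is inactive at \<open>b\<close>.\<close>
      have "\<delta> \<le> sqrt ((Z_norm J W (b - z))\<^sup>2 + \<delta>\<^sup>2)" by (intro real_le_rsqrt) simp
      then have "\<phi> (T (h b)) \<le> \<phi> (t - F)" using Eb unfolding \<Theta>_def by linarith
      then have Tb: "T (h b) \<le> t - F"
        using strict_mono_onD[OF smono, of "t - F" "T (h b)"] T_range(2)[of "h b"] s st t
        by (cases "T (h b) \<le> t - F") auto
      obtain a where a: "h b = ereal a" using hb_gt Tb t by (cases "h b") (auto simp: T_def)
      have sa: "s < a" using hb_gt a by simp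
      have at: "a \<le> t" using Tb t unfolding a T_real by auto
      define p where "p = \<psi> (a - F)"
      have p: "p > 0" and dp: "(\<phi> has_real_derivative p) (at (a - F))"
        using deriv[rule_format, of "a - F"] below[of "a - F"] sa at s t \<eta> by (auto simp: p_def)
      have "((\<lambda>v. v - F) has_real_derivative 1) (at a)" by (auto intro!: derivative_eq_intros)
      from DERIV_chain2[where f = \<phi>, OF dp this]
      have "((\<lambda>v. \<phi> (v - F)) has_real_derivative p) (at a)" by simp
      then have "((\<lambda>t. \<Theta> (ereal t)) has_real_derivative p) (at a)"
        by (rule has_field_derivative_transform_within_open[of _ _ _ "{s<..<F + \<eta>}"])
           (use sa at t in \<open>auto simp: \<Theta>_def T_real\<close>)
      then obtain A where A: "A \<in> Z_subdiff J m n W h b" "p * Z_norm J W A < 1"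
        using penalized_min_subgradient[where h = h and \<Theta> = \<Theta> and p = p, OF W b z a \<delta>(1) \<Theta>_mono _ p dist'] bmin
        unfolding E_def by blast
      have "Z_norm J W (b - zs) < r\<^sub>0" using Z_norm_triangle[OF W b z zs] dist' zr by simp
      moreover have "h zs < h b" using hzs a sa s by simp
      moreover have "h b < h zs + \<eta>\<^sub>0"
      proof -
        have "ereal (a - F) < \<eta>\<^sub>0" using below[of "a - F"] at t \<eta> by simp
        then show ?thesis unfolding a hzs by (cases \<eta>\<^sub>0) auto
      qed
      ultimately have "1 \<le> ereal p * dist_origin (Z_norm J W) (Z_subdiff J m n W h b)"
        using slope[rule_format, OF b] unfolding a hzs p_def by simp
      also have "\<dots> \<le> ereal p * ereal (Z_norm J W A)"
        unfolding dist_origin_def using p A(1) by (intro ereal_mult_left_mono INF_lower) auto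
      finally show False using A(2) by simp
    qed
    then show ?thesis using b dist by blast
  qed
  have "\<exists>y\<in>Z_space J m n. h y \<le> ereal s \<and> Z_norm J W (y - z) \<le> \<phi> (t - F) - \<phi> (s - F) + \<delta>"
    if "z \<in> Z_space J m n" "Z_norm J W (z - zs) < r\<^sub>0 / 2 \<and> h z = ereal t \<and> F \<le> s \<and> s < t \<and> t < F + \<eta> \<and> \<delta> > 0" for z t s \<delta>
    \<comment> \<open>A smaller error is a stronger claim, so \<open>\<delta>\<close> may be reduced
      to meet the bound \<open>r\<^sub>0 / 8\<close>.\<close>
    using bound[of z t s "min \<delta> (r\<^sub>0 / 16)"] that r\<^sub>0 by force
  then show ?thesis
    using r\<^sub>0 \<eta> cont \<phi>0 smono
    by (intro exI[of _ "r\<^sub>0 / 2"] conjI exI[of _ \<eta>] exI[of _ \<phi>]) auto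
qed


section \<open>Criticality of the limit point\<close>

text \<open>A deficit of second order in the distance is eventually below \<open>\<epsilon>\<close>
  times the distance, so zero is a Frechet subgradient in each block; moving one block changes
  \<open>Z_norm\<close> by exactly the norm of that block.\<close>

lemma critical_point_of_quadratic_minorant:
  fixes h :: "'N::finite var \<Rightarrow> ereal"
  assumes W: "sym_pos_def W" and zs: "zs \<in> Z_space J m n" and hzs: "h zs = ereal F" and C: "C \<ge> 0"
    and min: "\<And>z. z \<in> Z_space J m n \<Longrightarrow> ereal (F - C * (Z_norm J W (z - zs))\<^sup>2) \<le> h z"
  shows "critical_point J m n W h zs"
proof -
  have small: "\<exists>\<delta>>0. \<forall>N. 0 < N \<and> N < \<delta> \<longrightarrow> F - \<epsilon> * N \<le> F - C * N\<^sup>2" if "\<epsilon> > 0" for \<epsilon>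
  proof (intro exI[of _ "\<epsilon> / (C + 1)"] conjI allI impI)
    show "\<epsilon> / (C + 1) > 0" using that C by simp
    fix N assume N: "0 < N \<and> N < \<epsilon> / (C + 1)"
    then have "(C + 1) * N \<le> \<epsilon>" using C by (simp add: field_simps)
    then have "C * N \<le> \<epsilon>" using N by (simp add: algebra_simps)
    then have "C * N * N \<le> \<epsilon> * N" using N by (intro mult_right_mono) auto
    then show "F - \<epsilon> * N \<le> F - C * N\<^sup>2" by (simp add: power2_eq_square mult.assoc)
  qed
  have "0 \<in> frechet_subdiff UNIV (inner_W W) (\<lambda>x. h (x, snd zs)) (fst zs)"
  proof (rule frechet_subdiffI[where a = F])
    fix \<epsilon> :: real assume "\<epsilon> > 0"
    then obtain \<delta> where \<delta>: "\<delta> > 0" "\<forall>N. 0 < N \<and> N < \<delta> \<longrightarrow> F - \<epsilon> * N \<le> F - C * N\<^sup>2" using small by blast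
    have "ereal (F + inner_W W 0 (y - fst zs) - \<epsilon> * norm_W W (y - fst zs)) \<le> h (y, snd zs)"
      if "0 < norm_W W (y - fst zs)" "norm_W W (y - fst zs) < \<delta>" for y
      using min[OF Z_space_slice_fst[OF zs], of y] \<delta>(2)[rule_format, of "norm_W W (y - fst zs)"] that
      unfolding Z_norm_slice_fst[OF W] by (auto simp: inner_W_def intro: order_trans[rotated])
    then show "\<exists>\<delta>>0. \<forall>y\<in>UNIV. 0 < norm_W W (y - fst zs) \<and> norm_W W (y - fst zs) < \<delta> \<longrightarrow>
        ereal (F + inner_W W 0 (y - fst zs) - \<epsilon> * norm_W W (y - fst zs)) \<le> h (y, snd zs)"
      using \<delta>(1) by blast
  qed (use hzs in auto)
  then have 1: "0 \<in> limiting_subdiff UNIV (inner_W W) (\<lambda>x. h (x, snd zs)) (fst zs)"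
    by (rule frechet_subset_limiting) (auto simp: ip_norm_def inner_W_def)
  have 2: "0\<^sub>m (m j) (n j) \<in> limiting_subdiff (carrier_mat (m j) (n j)) frob_inner (\<lambda>M. h (fst zs, (snd zs)(j := M))) (snd zs j)"
    if j: "j \<in> {1..J}" for j
  proof (rule frechet_subset_limiting)
    show "0\<^sub>m (m j) (n j) \<in> frechet_subdiff (carrier_mat (m j) (n j)) frob_inner (\<lambda>M. h (fst zs, (snd zs)(j := M))) (snd zs j)"
    proof (rule frechet_subdiffI[where a = F])
      fix \<epsilon> :: real assume "\<epsilon> > 0"
      then obtain \<delta> where \<delta>: "\<delta> > 0" "\<forall>N. 0 < N \<and> N < \<delta> \<longrightarrow> F - \<epsilon> * N \<le> F - C * N\<^sup>2" using small by blast
      have "ereal (F + frob_inner (0\<^sub>m (m j) (n j)) (M - snd zs j) - \<epsilon> * frob_norm (M - snd zs j)) \<le> h (fst zs, (snd zs)(j := M))"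
        if "M \<in> carrier_mat (m j) (n j)" "0 < frob_norm (M - snd zs j)" "frob_norm (M - snd zs j) < \<delta>" for M
        using min[OF Z_space_slice_snd[OF zs j that(1)]] \<delta>(2)[rule_format, of "frob_norm (M - snd zs j)"] that(2,3)
        unfolding Z_norm_slice_snd[OF j] by (auto simp: frob_inner_def intro: order_trans[rotated])
      then show "\<exists>\<delta>>0. \<forall>M\<in>carrier_mat (m j) (n j). 0 < frob_norm (M - snd zs j) \<and> frob_norm (M - snd zs j) < \<delta> \<longrightarrow>
          ereal (F + frob_inner (0\<^sub>m (m j) (n j)) (M - snd zs j) - \<epsilon> * frob_norm (M - snd zs j)) \<le> h (fst zs, (snd zs)(j := M))"
        using \<delta>(1) by blast
    qed (use hzs in auto)
  qed (use Z_spaceD[OF zs j] in \<open>simp_all only: frob_norm_self_diff\<close>)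
  have "Z_zero J m n \<in> Z_space J m n" by (auto simp: Z_zero_def Z_space_def)
  then have "Z_zero J m n \<in> Z_subdiff J m n W h zs"
    using 1 2 by (simp add: Z_subdiff_def Z_zero_def)
  then show ?thesis using zs by (simp add: critical_point_def)
qed

section \<open>Convergence of inexact proximal sequences\<close>

theorem inexact_proximal_convergence:
  fixes h :: "'N::finite var \<Rightarrow> ereal" and Z :: "nat \<Rightarrow> 'N var"
  assumes W: "sym_pos_def W" and lsc: "Z_lsc J m n W h" and proper: "\<And>z. h z \<noteq> -\<infinity>"
    and coercive: "Z_coercive J m n W h"
    and KL: "KL_function (Z_space J m n) (Z_norm J W) (Z_subdiff J m n W h) h"
    and ZV: "\<And>k. Z k \<in> Z_space J m n" and c: "c > 0" and C: "C \<ge> 0"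
    and finite: "\<And>k. h (Z (Suc k)) \<noteq> \<infinity>"
    and step: "\<And>k z. z \<in> Z_space J m n \<Longrightarrow>
      h (Z (Suc k)) + ereal (c * (Z_norm J W (Z (Suc k) - Z k))\<^sup>2) \<le> h z + ereal (C * (Z_norm J W (z - Z k))\<^sup>2)"
  shows "summable (\<lambda>k. Z_norm J W (Z (Suc k) - Z k)) \<and>
    (\<exists>zs. critical_point J m n W h zs \<and> (\<lambda>k. Z_norm J W (Z k - zs)) \<longlonglongrightarrow> 0)"
proof -
  \<comment> \<open>The index is shifted by one because \<open>h (Z 0)\<close> may be
    infinite.\<close>
  define F where "F = (\<lambda>k. real_of_ereal (h (Z (Suc k))))"
  define D where "D = (\<lambda>k. Z_norm J W (Z (Suc k) - Z k))"
  have F: "h (Z (Suc k)) = ereal (F k)" for k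
    unfolding F_def using finite[of k] proper[of "Z (Suc k)"] by (cases "h (Z (Suc k))") auto
  have D: "D k \<ge> 0" for k by (simp add: D_def Z_norm_nonneg)
  have step': "F k + c * (D k)\<^sup>2 \<le> v + C * (Z_norm J W (z - Z k))\<^sup>2"
    if "z \<in> Z_space J m n" "h z \<le> ereal v" for k z v
  proof -
    have "ereal (F k) + ereal (c * (D k)\<^sup>2) \<le> h z + ereal (C * (Z_norm J W (z - Z k))\<^sup>2)"
      using step[OF that(1), of k] by (simp add: F D_def)
    also have "\<dots> \<le> ereal v + ereal (C * (Z_norm J W (z - Z k))\<^sup>2)" using that(2) by (intro add_right_mono)
    finally show ?thesis by simp
  qed
  have descent: "F (Suc k) + c * (D (Suc k))\<^sup>2 \<le> F k" for k
    using step'[OF ZV[of "Suc k"], of "F k" "Suc k"] by (simp add: F Z_norm_self_diff)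
  have dec: "decseq F"
  proof (rule decseq_SucI)
    fix k
    have "c * (D (Suc k))\<^sup>2 \<ge> 0" using c by simp
    then show "F (Suc k) \<le> F k" using descent[of k] by linarith
  qed
  obtain K where K: "\<And>z. z \<in> Z_space J m n \<Longrightarrow> K \<le> Z_norm J W z \<Longrightarrow> ereal (F 0) < h z"
  proof -
    have "\<forall>\<^sub>F z in inf (filtercomap (Z_norm J W) at_top) (principal (Z_space J m n)). ereal (F 0) < h z"
      using coercive unfolding Z_coercive_def by (rule order_tendstoD(1)) simp
    then show thesis
      using that unfolding eventually_inf_principal eventually_filtercomap eventually_at_top_linorder by blast
  qed
  have bdd: "Z_norm J W (Z (Suc k)) \<le> K" for k
  proof (rule ccontr)
    assume "\<not> ?thesis"
    then have "F 0 < F k" using K[OF ZV[of "Suc k"]] F[of k] by simp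
    then show False using decseqD[OF dec, of 0 k] by simp
  qed
  obtain zs r where zs: "zs \<in> Z_space J m n" and r: "strict_mono r"
    and lim: "(\<lambda>l. Z_norm J W (Z (Suc (r l)) - zs)) \<longlonglongrightarrow> 0"
    using Z_space_Bolzano_Weierstrass[of W "\<lambda>l. Z (Suc l)", OF W ZV bdd] by blast
  have hzs_le: "h zs \<le> ereal (F k)" for k
  proof (rule ccontr)
    assume "\<not> ?thesis"
    then have "\<forall>\<^sub>F l in sequentially. ereal (F k) < h (Z (Suc (r l)))"
      by (intro Z_lscD[OF lsc ZV zs lim]) simp
    then obtain N where "\<And>l. l \<ge> N \<Longrightarrow> F k < F (r l)" unfolding F eventually_sequentially by auto
    then have "F k < F (r (max N k))" by simp
    moreover have "k \<le> r (max N k)" using seq_suble[OF r, of "max N k"] by simp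
    ultimately show False using decseqD[OF dec, of k "r (max N k)"] by simp
  qed
  define Fs where "Fs = real_of_ereal (h zs)"
  have hzs: "h zs = ereal Fs"
    unfolding Fs_def using hzs_le[of 0] proper[of zs] by (cases "h zs") auto
  have Fs_le: "Fs \<le> F k" for k using hzs_le[of k] hzs by simp
  obtain L where L: "F \<longlonglongrightarrow> L" using decseq_convergent[OF dec, of Fs] Fs_le by blast
  have zlim: "(\<lambda>l. Z_norm J W (z - Z (Suc (r l)))) \<longlonglongrightarrow> Z_norm J W (z - zs)" if z: "z \<in> Z_space J m n" for z
    using tendsto_Z_dist[of W "\<lambda>l. Z (Suc (r l))", OF W ZV zs z lim]
    by (simp add: Z_norm_minus_commute[OF z zs] Z_norm_minus_commute[OF z ZV])
  \<comment> \<open>The step inequality with a fixed competitor, without its nonnegative left term,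
    in the limit along the subsequence.\<close>
  have Lz: "L \<le> v + C * (Z_norm J W (z - zs))\<^sup>2" if z: "z \<in> Z_space J m n" and v: "h z \<le> ereal v" for z v
  proof (rule LIMSEQ_le)
    show "(\<lambda>l. F (Suc (r l))) \<longlonglongrightarrow> L"
      using LIMSEQ_subseq_LIMSEQ[OF LIMSEQ_Suc[OF L] r] by (simp add: o_def)
    show "(\<lambda>l. v + C * (Z_norm J W (z - Z (Suc (r l))))\<^sup>2) \<longlonglongrightarrow> v + C * (Z_norm J W (z - zs))\<^sup>2"
      by (intro tendsto_intros zlim[OF z])
    have "F (Suc (r l)) \<le> v + C * (Z_norm J W (z - Z (Suc (r l))))\<^sup>2" for l
    proof -
      have "c * (D (Suc (r l)))\<^sup>2 \<ge> 0" using c by simp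
      then show ?thesis using step'[OF z v, of "Suc (r l)"] by linarith
    qed
    then show "\<exists>N. \<forall>l\<ge>N. F (Suc (r l)) \<le> v + C * (Z_norm J W (z - Z (Suc (r l))))\<^sup>2" by blast
  qed
  \<comment> \<open>Lower semicontinuity yields only \<open>Fs \<le> L\<close>. The competitor
    \<open>zs\<close> itself supplies the other direction, so no continuity of \<open>h\<close> is
    required.\<close>
  have "L = Fs"
  proof (rule antisym)
    show "L \<le> Fs" using Lz[OF zs, of Fs] hzs by (simp add: Z_norm_self_diff)
    show "Fs \<le> L" using L Fs_le by (intro LIMSEQ_le_const) auto
  qed
  have crit: "critical_point J m n W h zs"
  proof (rule critical_point_of_quadratic_minorant[where h = h and F = Fs, OF W zs hzs C])
    fix z :: "'N var" assume z: "z \<in> Z_space J m n"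
    show "ereal (Fs - C * (Z_norm J W (z - zs))\<^sup>2) \<le> h z"
      using Lz[OF z, of "real_of_ereal (h z)"] proper[of z] \<open>L = Fs\<close> by (cases "h z") auto
  qed
  then have "zs \<in> dom_subdiff (Z_space J m n) (Z_subdiff J m n W h)"
    by (auto simp: critical_point_def dom_subdiff_def)
  then have "KL_property_at (Z_space J m n) (Z_norm J W) (Z_subdiff J m n W h) h zs"
    using KL by (simp add: KL_function_def)
  from KL_error_bound[where h = h and F = Fs, OF W lsc this zs hzs] obtain \<rho> \<eta> \<phi> where \<rho>: "\<rho> > 0" and \<eta>: "\<eta> > 0"
    and cont: "continuous_on {0..\<eta>} \<phi>" and \<phi>0: "\<phi> 0 = 0" and smono: "strict_mono_on {0..\<eta>} \<phi>"
    and eb0: "\<forall>z\<in>Z_space J m n. \<forall>t s \<delta>. Z_norm J W (z - zs) < \<rho> \<and> h z = ereal t \<and> Fs \<le> s \<and> s < t \<and> t < Fs + \<eta> \<and> \<delta> > 0 \<longrightarrow>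
      (\<exists>y\<in>Z_space J m n. h y \<le> ereal s \<and> Z_norm J W (y - z) \<le> \<phi> (t - Fs) - \<phi> (s - Fs) + \<delta>)"
    by blast
  \<comment> \<open>The square root comes from \<open>c * D\<^sup>2 \<le> C * dist\<^sup>2\<close>.
    The 2 arises because the additive error in the error bound is taken equal to the gap of
    \<open>\<phi>\<close>.\<close>
  define B where "B = 2 * sqrt (C / c)"
  have B: "B \<ge> 0" using C c by (simp add: B_def)
  define P where "P = (\<lambda>k. B * \<phi> (F k - Fs))"
  have gap: "D (Suc k) \<le> P k - P (Suc k)"
    if near: "Z_norm J W (Z (Suc k) - zs) < \<rho>" "F k < Fs + \<eta>" for k
  proof (cases "F (Suc k) = F k")
    case True
    then have "c * (D (Suc k))\<^sup>2 \<le> 0" using descent[of k] by simp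
    then have "D (Suc k) = 0" using c by (simp add: mult_le_0_iff)
    then show ?thesis using True by (simp add: P_def)
  next
    case False
    then have lt: "F (Suc k) < F k" using decseqD[OF dec, of k "Suc k"] by simp
    define \<delta> where "\<delta> = \<phi> (F k - Fs) - \<phi> (F (Suc k) - Fs)"
    have \<delta>: "\<delta> > 0"
      using strict_mono_onD[OF smono, of "F (Suc k) - Fs" "F k - Fs"] lt Fs_le[of k] Fs_le[of "Suc k"] near(2)
      by (simp add: \<delta>_def)
    \<comment> \<open>\<open>y\<close> reaches the level of the next iterate, so the function values
      cancel in the step inequality and only the distance from \<open>Z (Suc k)\<close> to
      \<open>y\<close> bounds the step.\<close>
    obtain y where y: "y \<in> Z_space J m n" "h y \<le> ereal (F (Suc k))" "Z_norm J W (y - Z (Suc k)) \<le> 2 * \<delta>"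
      using eb0[rule_format, OF ZV[of "Suc k"], of "F k" "F (Suc k)" \<delta>] near lt Fs_le \<delta> F[of k]
      by (auto simp: \<delta>_def)
    have "c * (D (Suc k))\<^sup>2 \<le> C * (Z_norm J W (y - Z (Suc k)))\<^sup>2"
      using step'[OF y(1,2), of "Suc k"] by simp
    also have "\<dots> \<le> C * (2 * \<delta>)\<^sup>2" using y(3) C by (intro mult_left_mono power_mono Z_norm_nonneg) auto
    finally have "(D (Suc k))\<^sup>2 \<le> C / c * (2 * \<delta>)\<^sup>2" using c by (simp add: field_simps)
    also have "\<dots> = (B * \<delta>)\<^sup>2" using C c by (simp add: B_def power_mult_distrib)
    finally have "D (Suc k) \<le> B * \<delta>" using B \<delta> by (intro power2_le_imp_le[of "D (Suc k)"]) auto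
    then show ?thesis by (simp add: P_def \<delta>_def right_diff_distrib)
  qed
  have P_nonneg: "P k \<ge> 0" if "F k < Fs + \<eta>" for k
    using strict_mono_on_leD[OF smono, of 0 "F k - Fs"] that Fs_le[of k] B \<eta> \<phi>0 by (simp add: P_def)
  have "P \<longlonglongrightarrow> B * \<phi> 0"
  proof -
    have "(\<lambda>k. F k - Fs) \<longlonglongrightarrow> 0" using L \<open>L = Fs\<close> by (simp add: LIM_zero)
    moreover have "\<forall>\<^sub>F k in sequentially. F k - Fs \<in> {0..\<eta>}"
      using order_tendstoD(2)[OF calculation \<eta>] by eventually_elim (use Fs_le in \<open>auto intro: less_imp_le\<close>)
    ultimately have "(\<lambda>k. \<phi> (F k - Fs)) \<longlonglongrightarrow> \<phi> 0"
      using continuous_on_tendsto_compose[OF cont, of "\<lambda>k. F k - Fs" 0 sequentially] \<eta> by simp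
    then show ?thesis unfolding P_def by (intro tendsto_intros)
  qed
  then have "(\<lambda>l. P (r l)) \<longlonglongrightarrow> 0" using LIMSEQ_subseq_LIMSEQ[OF _ r] \<phi>0 by (force simp: o_def)
  then have "\<forall>\<^sub>F l in sequentially. P (r l) < \<rho> / 2" using \<rho> by (intro order_tendstoD(2)) auto
  moreover have "\<forall>\<^sub>F l in sequentially. Z_norm J W (Z (Suc (r l)) - zs) < \<rho> / 2"
    using lim \<rho> by (intro order_tendstoD(2)) auto
  moreover have "\<forall>\<^sub>F l in sequentially. F (r l) < Fs + \<eta>"
    using LIMSEQ_subseq_LIMSEQ[OF L r] \<open>L = Fs\<close> \<eta> by (intro order_tendstoD(2)[of _ Fs]) (auto simp: o_def)
  ultimately have "\<forall>\<^sub>F l in sequentially. P (r l) < \<rho> / 2 \<and> Z_norm J W (Z (Suc (r l)) - zs) < \<rho> / 2 \<and> F (r l) < Fs + \<eta>"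
    by eventually_elim blast
  then obtain l where l: "P (r l) < \<rho> / 2" "Z_norm J W (Z (Suc (r l)) - zs) < \<rho> / 2" "F (r l) < Fs + \<eta>"
    unfolding eventually_sequentially by blast
  \<comment> \<open>From here on the starting distance and the total length still allowed by
    \<open>P\<close> are each below \<open>\<rho> / 2\<close>.\<close>
  define k\<^sub>0 where "k\<^sub>0 = r l"
  note k0 = l[folded k\<^sub>0_def]
  have Fk: "F (k\<^sub>0 + i) < Fs + \<eta>" for i using decseqD[OF dec, of k\<^sub>0 "k\<^sub>0 + i"] k0(3) by simp
  have travel: "Z_norm J W (Z (N + i) - zs) \<le> Z_norm J W (Z N - zs) + (\<Sum>j<i. D (N + j))" for N i
  proof (induction i)
    case (Suc i)
    then show ?case
      using Z_norm_triangle[OF W ZV[of "N + Suc i"] ZV[of "N + i"] zs] by (simp add: D_def)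
  qed simp
  \<comment> \<open>The length bound so far keeps the next iterate in the ball of radius
    \<open>\<rho>\<close>, where \<open>gap\<close> applies and extends the bound; \<open>P\<close>
    telescopes.\<close>
  have trapped: "(\<Sum>j<i. D (Suc k\<^sub>0 + j)) \<le> P k\<^sub>0 - P (k\<^sub>0 + i)" for i
  proof (induction i)
    case (Suc i)
    have "Z_norm J W (Z (Suc (k\<^sub>0 + i)) - zs) \<le> Z_norm J W (Z (Suc k\<^sub>0) - zs) + (\<Sum>j<i. D (Suc k\<^sub>0 + j))"
      using travel[of "Suc k\<^sub>0" i] by simp
    then have "Z_norm J W (Z (Suc (k\<^sub>0 + i)) - zs) < \<rho>"
      using Suc.IH k0(1,2) P_nonneg[OF Fk, of i] by linarith
    then have "D (Suc (k\<^sub>0 + i)) \<le> P (k\<^sub>0 + i) - P (Suc (k\<^sub>0 + i))" using Fk by (rule gap)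
    then show ?case using Suc.IH by simp
  qed simp
  have "summable (\<lambda>j. D (j + Suc k\<^sub>0))"
  proof (rule summableI_nonneg_bounded)
    show "(\<Sum>j<i. D (j + Suc k\<^sub>0)) \<le> P k\<^sub>0" for i
      using trapped[of i] P_nonneg[OF Fk, of i] by (simp add: add.commute)
  qed (simp add: D)
  then have sum: "summable D" by (simp only: summable_iff_shift)
  \<comment> \<open>The limit is already at hand: one iterate of the subsequence near
    \<open>zs\<close>, late enough for the remaining length to be small, controls all later
    ones.\<close>
  have "(\<lambda>k. Z_norm J W (Z k - zs)) \<longlonglongrightarrow> 0"
  proof (rule LIMSEQ_I)
    fix e :: real assume e: "e > 0"
    obtain N where N: "\<And>a b. a \<ge> N \<Longrightarrow> norm (sum D {a..<b}) < e / 2"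
      using sum e unfolding summable_Cauchy by (meson half_gt_zero)
    have "\<forall>\<^sub>F l in sequentially. Z_norm J W (Z (Suc (r l)) - zs) < e / 2"
      using lim e by (intro order_tendstoD(2)) auto
    then obtain N' where N': "\<And>l. l \<ge> N' \<Longrightarrow> Z_norm J W (Z (Suc (r l)) - zs) < e / 2"
      unfolding eventually_sequentially by blast
    define M where "M = Suc (r (max N N'))"
    have "M \<ge> N" using seq_suble[OF r, of "max N N'"] by (simp add: M_def)
    have "Z_norm J W (Z k - zs) < e" if "k \<ge> M" for k
    proof -
      have "(\<Sum>j<k - M. D (M + j)) = sum D {M..<k}"
        using sum.shift_bounds_nat_ivl[of D 0 M "k - M"] that by (simp add: atLeast0LessThan add.commute)
      then have "(\<Sum>j<k - M. D (M + j)) < e / 2" using N[OF \<open>M \<ge> N\<close>, of k] by simp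
      moreover have "Z_norm J W (Z M - zs) < e / 2" using N'[of "max N N'"] by (simp add: M_def)
      ultimately show ?thesis using travel[of M "k - M"] that by simp
    qed
    then show "\<exists>N. \<forall>k\<ge>N. norm (Z_norm J W (Z k - zs) - 0) < e"
      unfolding diff_0_right real_norm_def abs_of_nonneg[OF Z_norm_nonneg] by blast
  qed
  then show ?thesis using sum crit unfolding D_def by blast
qed

section \<open>The PARM algorithm\<close>

text \<open>By concavity the increment from \<open>s\<close> to \<open>t\<close> is at most
  \<open>t - s\<close> times any difference quotient taken at a point between them. Such points,
  tending to \<open>s\<close> from the side of \<open>t\<close>, stay in the half-line, so the
  one-sided derivative at 0 is covered.\<close>

lemma concave_on_le_tangent:
  assumes conc: "concave_on {0..} g" and der: "(g has_real_derivative d) (at s within {0..})"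
    and s: "(s::real) \<ge> 0" and t: "t \<ge> 0"
  shows "g t \<le> g s + d * (t - s)"
proof (cases "t = s")
  case False
  define \<epsilon> where "\<epsilon> = (\<lambda>k. 1 / real (Suc k))"
  define y where "y = (\<lambda>k. s + \<epsilon> k * (t - s))"
  have \<epsilon>: "0 < \<epsilon> k" "\<epsilon> k \<le> 1" for k by (auto simp: \<epsilon>_def)
  have \<epsilon>lim: "\<epsilon> \<longlonglongrightarrow> 0" unfolding \<epsilon>_def by (rule LIMSEQ_Suc[OF lim_1_over_n])
  have y_conv: "y k = (1 - \<epsilon> k) * s + \<epsilon> k * t" for k by (simp add: y_def algebra_simps)
  have y0: "y k \<ge> 0" for k unfolding y_conv using \<epsilon>[of k] s t by simp
  have "y \<longlonglongrightarrow> s + 0 * (t - s)" unfolding y_def by (intro tendsto_intros \<epsilon>lim)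
  then have "filterlim y (at s within {0..}) sequentially"
    using False y0 \<epsilon> by (simp add: filterlim_at y_def less_imp_neq[symmetric])
  moreover have "((\<lambda>v. (g v - g s) / (v - s)) \<longlongrightarrow> d) (at s within {0..})"
    using der by (simp add: has_field_derivative_iff)
  ultimately have "(\<lambda>k. (g (y k) - g s) / (y k - s)) \<longlonglongrightarrow> d" by (rule filterlim_compose[rotated])
  then have "(\<lambda>k. (g (y k) - g s) / (y k - s) * (t - s)) \<longlonglongrightarrow> d * (t - s)" by (intro tendsto_intros)
  moreover have "g t - g s \<le> (g (y k) - g s) / (y k - s) * (t - s)" for k
  proof -
    have "(1 - \<epsilon> k) * g s + \<epsilon> k * g t \<le> g (y k)"
      using concave_onD[OF conc, of "\<epsilon> k" s t] \<epsilon>[of k] s t by (simp add: y_conv)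
    then have "\<epsilon> k * (g t - g s) \<le> g (y k) - g s" by (simp add: algebra_simps)
    then have "g t - g s \<le> (g (y k) - g s) / \<epsilon> k" using \<epsilon>[of k] by (simp add: field_simps)
    also have "\<dots> = (g (y k) - g s) / (y k - s) * (t - s)" using False by (simp add: y_def)
    finally show ?thesis .
  qed
  ultimately have "g t - g s \<le> d * (t - s)" by (intro LIMSEQ_le_const) auto
  then show ?thesis by simp
qed simp

text \<open>The converse estimate up to a quadratic error: it bounds the linearization at a
  competitor, while concavity bounds \<open>g\<close> at the new iterate. The mean value theorem
  gives \<open>L\<close> in place of the sharp \<open>L / 2\<close>, which merely enlarges the final
  constant \<open>C\<close>.\<close>

lemma tangent_le_lipschitz:
  fixes g g' :: "real \<Rightarrow> real"
  assumes der: "\<And>t. t \<ge> 0 \<Longrightarrow> (g has_real_derivative g' t) (at t within {0..})"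
    and lip: "L-lipschitz_on {0..} g'" and s: "s \<ge> 0" and t: "t \<ge> 0"
  shows "g' s * (t - s) \<le> g t - g s + L * (t - s)\<^sup>2"
proof -
  have mvt: "\<exists>u. a < u \<and> u < b \<and> g b - g a = g' u * (b - a)" if "0 \<le> a" "a < b" for a b
  proof -
    have "(g has_derivative (*) (g' u)) (at u within {a..b})" if "a \<le> u" "u \<le> b" for u
    proof -
      have "(g has_real_derivative g' u) (at u within {a..b})"
        by (rule has_field_derivative_subset[OF der]) (use that \<open>0 \<le> a\<close> in auto)
      then show ?thesis by (simp add: has_field_derivative_def)
    qed
    then show ?thesis using mvt_simple[OF \<open>a < b\<close>, of g "\<lambda>u. (*) (g' u)"] by auto
  qed
  have "\<exists>u\<ge>0. \<bar>u - s\<bar> \<le> \<bar>t - s\<bar> \<and> g t - g s = g' u * (t - s)"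
  proof (cases s t rule: linorder_cases)
    case less
    then obtain u where "s < u" "u < t" "g t - g s = g' u * (t - s)" using mvt s by blast
    then show ?thesis using s by (intro exI[of _ u]) auto
  next
    case greater
    then obtain u where "t < u" "u < s" "g s - g t = g' u * (s - t)" using mvt t by blast
    then show ?thesis using t by (intro exI[of _ u]) (auto simp: algebra_simps)
  qed (use s in auto)
  then obtain u where u: "u \<ge> 0" "\<bar>u - s\<bar> \<le> \<bar>t - s\<bar>" "g t - g s = g' u * (t - s)" by blast
  have "\<bar>g' s - g' u\<bar> \<le> L * \<bar>s - u\<bar>" using lipschitz_onD[OF lip, of s u] s u(1) by (simp add: dist_real_def)
  also have "\<dots> \<le> L * \<bar>t - s\<bar>" using u(2) lipschitz_on_nonneg[OF lip] by (intro mult_left_mono) auto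
  finally have "\<bar>g' s - g' u\<bar> * \<bar>t - s\<bar> \<le> L * \<bar>t - s\<bar> * \<bar>t - s\<bar>" by (intro mult_right_mono) auto
  then have "(g' s - g' u) * (t - s) \<le> L * (t - s)\<^sup>2"
    by (simp add: power2_eq_square mult.assoc flip: abs_mult)
  then show ?thesis using u(3) by (simp add: algebra_simps)
qed

section \<open>Bounds for the patch operators\<close>

lemma linear_to_mat_diff:
  assumes "linear_to_mat p q R"
  shows "R (x - y) = R x - R y"
proof -
  have add: "R (x + y) = R x + R y" and smult: "R (c *\<^sub>R x) = c \<cdot>\<^sub>m R x" and carr: "R x \<in> carrier_mat p q" for c x y
    using assms by (auto simp: linear_to_mat_def)
  have "R (x - y) = R x + (-1) \<cdot>\<^sub>m R y" using add[of x "- y"] smult[of "- 1" y] by simp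
  also have "\<dots> = R x - R y" using carr[of x] carr[of y] by (intro eq_matI) auto
  finally show ?thesis .
qed

lemma linear_to_mat_bounded:
  fixes R :: "real^'N \<Rightarrow> real mat"
  assumes R: "linear_to_mat p q R"
  shows "\<exists>K\<ge>0. \<forall>x. frob_norm (R x) \<le> K * norm x"
proof -
  have add: "R (x + y) = R x + R y" and smult: "R (c *\<^sub>R x) = c \<cdot>\<^sub>m R x" and carr: "R x \<in> carrier_mat p q" for c x y
    using R by (auto simp: linear_to_mat_def)
  have "\<exists>K\<ge>0. \<forall>x. \<bar>R x $$ il\<bar> \<le> norm x * K" if "il \<in> {..<p} \<times> {..<q}" for il
  proof -
    have "linear (\<lambda>x. R x $$ il)"
      by (rule linearI) (use that in \<open>auto simp: add smult carrier_matD[OF carr]\<close>)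
    then have "bounded_linear (\<lambda>x. R x $$ il)" by (simp add: linear_conv_bounded_linear)
    from bounded_linear.nonneg_bounded[OF this] show ?thesis by auto
  qed
  then obtain K where K: "\<And>il. il \<in> {..<p} \<times> {..<q} \<Longrightarrow> K il \<ge> 0 \<and> (\<forall>x. \<bar>R x $$ il\<bar> \<le> norm x * K il)" by metis
  have "frob_norm (R x) \<le> (\<Sum>il\<in>{..<p} \<times> {..<q}. K il) * norm x" for x
  proof -
    have "frob_norm (R x) \<le> (\<Sum>il\<in>{..<p} \<times> {..<q}. \<bar>R x $$ il\<bar>)"
      using frob_norm_le_sum[OF carr[of x]] by (simp add: case_prod_beta)
    also have "\<dots> \<le> (\<Sum>il\<in>{..<p} \<times> {..<q}. norm x * K il)" using K by (intro sum_mono) blast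
    finally show ?thesis by (simp add: sum_distrib_left mult.commute)
  qed
  then show ?thesis using K by (intro exI[of _ "\<Sum>il\<in>{..<p} \<times> {..<q}. K il"]) (auto intro: sum_nonneg)
qed

lemma linear_to_mat_bounded_W:
  fixes R :: "real^'N \<Rightarrow> real mat"
  assumes R: "linear_to_mat p q R" and W: "sym_pos_def W"
  shows "\<exists>K\<ge>0. \<forall>x y. frob_norm (R x - R y) \<le> K * norm_W W (x - y)"
proof -
  obtain K where K: "K \<ge> 0" "\<And>x. frob_norm (R x) \<le> K * norm x" using linear_to_mat_bounded[OF R] by blast
  obtain c where c: "c > 0" "\<And>x. c * norm x \<le> norm_W W x" using norm_W_lower[OF W] by blast
  have "frob_norm (R x - R y) \<le> K / c * norm_W W (x - y)" for x y
  proof -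
    have "frob_norm (R x - R y) \<le> K * norm (x - y)" using K(2)[of "x - y"] by (simp add: linear_to_mat_diff[OF R])
    also have "\<dots> \<le> K * (norm_W W (x - y) / c)" using c K(1) by (intro mult_left_mono) (auto simp: field_simps)
    finally show ?thesis by simp
  qed
  then show ?thesis using K(1) c(1) by (intro exI[of _ "K / c"]) auto
qed

section \<open>The two subproblems combined into one inexact proximal step\<close>

text \<open>The subproblem contains the linearization of \<open>g\<close> at the singular values of
  \<open>Y\<close>. At \<open>Y'\<close> it lies above \<open>g\<close>; at a competitor
  \<open>M\<close> it exceeds \<open>g\<close> by at most \<open>L\<close> times a squared
  difference of singular values, which Weyl's inequality bounds by the squared distance of the
  matrices. Summation over \<open>p\<close> singular values gives \<open>real p * L\<close>. The
  numbers \<open>a'\<close> and \<open>a\<close> stand for the coupling terms at \<open>Y'\<close>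
  and \<open>M\<close>.\<close>

lemma matrix_step_estimate:
  fixes g g' :: "real \<Rightarrow> real"
  assumes conc: "concave_on {0..} g"
    and der: "\<And>t. t \<ge> 0 \<Longrightarrow> (g has_real_derivative g' t) (at t within {0..})"
    and lip: "L-lipschitz_on {0..} g'"
    and Y: "Y \<in> carrier_mat p q" and Y': "Y' \<in> carrier_mat p q" and M: "M \<in> carrier_mat p q"
    and lam: "lam > 0" and \<alpha>: "\<alpha>_lo \<le> \<alpha>" "\<alpha> \<le> \<alpha>_hi"
    and argmin: "a' + lam * (\<Sum>i=1..p. g' (singular_value Y i) * singular_value Y' i) + \<alpha> / 2 * (frob_norm (Y' - Y))\<^sup>2 \<le>
       a + lam * (\<Sum>i=1..p. g' (singular_value Y i) * singular_value M i) + \<alpha> / 2 * (frob_norm (M - Y))\<^sup>2"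
  shows "a' + lam * (\<Sum>i=1..p. g (singular_value Y' i)) + \<alpha>_lo / 2 * (frob_norm (Y' - Y))\<^sup>2 \<le>
     a + lam * (\<Sum>i=1..p. g (singular_value M i)) + (\<alpha>_hi / 2 + lam * (real p * L)) * (frob_norm (M - Y))\<^sup>2"
proof -
  have nn: "singular_value A i \<ge> 0" if "A \<in> carrier_mat p q" "i \<in> {1..p}" for A i
    using singular_value_nonneg[OF that(1)] that(2) by simp
  have "(\<Sum>i=1..p. g (singular_value Y' i)) \<le>
      (\<Sum>i=1..p. g (singular_value Y i) + g' (singular_value Y i) * (singular_value Y' i - singular_value Y i))"
    using conc der nn Y Y' by (intro sum_mono concave_on_le_tangent) auto
  then have 1: "(\<Sum>i=1..p. g (singular_value Y' i)) \<le> (\<Sum>i=1..p. g (singular_value Y i)) +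
      ((\<Sum>i=1..p. g' (singular_value Y i) * singular_value Y' i) - (\<Sum>i=1..p. g' (singular_value Y i) * singular_value Y i))"
    by (simp add: right_diff_distrib sum.distrib sum_subtractf)
  have "(\<Sum>i=1..p. g' (singular_value Y i) * (singular_value M i - singular_value Y i)) \<le>
      (\<Sum>i=1..p. g (singular_value M i) - g (singular_value Y i) + L * (frob_norm (M - Y))\<^sup>2)"
  proof (rule sum_mono)
    fix i assume i: "i \<in> {1..p}"
    have "(singular_value M i - singular_value Y i)\<^sup>2 \<le> (frob_norm (M - Y))\<^sup>2"
      using singular_value_lipschitz[OF M Y] i by (intro abs_le_square_iff[THEN iffD1]) (auto intro: order_trans[OF _ abs_ge_self])
    then have "L * (singular_value M i - singular_value Y i)\<^sup>2 \<le> L * (frob_norm (M - Y))\<^sup>2"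
      using lipschitz_on_nonneg[OF lip] by (intro mult_left_mono)
    then show "g' (singular_value Y i) * (singular_value M i - singular_value Y i) \<le>
        g (singular_value M i) - g (singular_value Y i) + L * (frob_norm (M - Y))\<^sup>2"
      using tangent_le_lipschitz[OF der lip nn[OF Y i] nn[OF M i]] by linarith
  qed
  then have 2: "(\<Sum>i=1..p. g' (singular_value Y i) * singular_value M i) - (\<Sum>i=1..p. g' (singular_value Y i) * singular_value Y i) \<le>
      (\<Sum>i=1..p. g (singular_value M i)) - (\<Sum>i=1..p. g (singular_value Y i)) + real p * L * (frob_norm (M - Y))\<^sup>2"
    by (simp add: right_diff_distrib sum.distrib sum_subtractf)
  have "lam * (\<Sum>i=1..p. g (singular_value Y' i)) \<le> lam * ((\<Sum>i=1..p. g (singular_value M i)) + real p * L * (frob_norm (M - Y))\<^sup>2 +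
      (\<Sum>i=1..p. g' (singular_value Y i) * singular_value Y' i) - (\<Sum>i=1..p. g' (singular_value Y i) * singular_value M i))"
    using 1 2 lam by (intro mult_left_mono) auto
  then have "lam * (\<Sum>i=1..p. g (singular_value Y' i)) \<le> lam * (\<Sum>i=1..p. g (singular_value M i)) + lam * (real p * L) * (frob_norm (M - Y))\<^sup>2 +
      lam * (\<Sum>i=1..p. g' (singular_value Y i) * singular_value Y' i) - lam * (\<Sum>i=1..p. g' (singular_value Y i) * singular_value M i)"
    by (simp add: algebra_simps)
  moreover have "\<alpha>_lo / 2 * (frob_norm (Y' - Y))\<^sup>2 \<le> \<alpha> / 2 * (frob_norm (Y' - Y))\<^sup>2"
    using \<alpha>(1) by (intro mult_right_mono) auto
  moreover have "\<alpha> / 2 * (frob_norm (M - Y))\<^sup>2 \<le> \<alpha>_hi / 2 * (frob_norm (M - Y))\<^sup>2"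
    using \<alpha>(2) by (intro mult_right_mono) auto
  ultimately show ?thesis using argmin unfolding distrib_right by linarith
qed

lemma frob_norm_parallelogram:
  assumes "A \<in> carrier_mat p q" "B \<in> carrier_mat p q" "P \<in> carrier_mat p q" "Q \<in> carrier_mat p q"
  shows "(frob_norm (A - P))\<^sup>2 - (frob_norm (A - Q))\<^sup>2 + (frob_norm (B - Q))\<^sup>2 - (frob_norm (B - P))\<^sup>2 =
    2 * frob_inner (A - B) (Q - P)"
  unfolding frob_norm_power2 using assms
  by (simp add: frob_inner_diff_left[of _ p q] frob_inner_diff_right[of _ p q] frob_inner_commute[of P p q A]
      frob_inner_commute[of P p q B] frob_inner_commute[of Q p q A] frob_inner_commute[of Q p q B] minus_carrier_mat)

text \<open>The mixed second difference of a quadratic is bilinear, so exchanging \<open>P\<close> and \<open>Q\<close> costs only a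
  product of two step lengths.\<close>

lemma coupling_exchange:
  assumes Y: "Y \<in> carrier_mat p q" and Y': "Y' \<in> carrier_mat p q" and M: "M \<in> carrier_mat p q"
    and P: "P \<in> carrier_mat p q" and Q: "Q \<in> carrier_mat p q"
    and \<mu>: "\<mu> > 0" and \<alpha>: "\<alpha> > 0" and K: "K \<ge> 0" and PQ: "frob_norm (Q - P) \<le> K * e"
  shows "\<mu> / 2 * (frob_norm (M - P))\<^sup>2 + \<mu> / 2 * (frob_norm (Y' - Q))\<^sup>2 \<le>
    \<mu> / 2 * (frob_norm (M - Q))\<^sup>2 + \<mu> / 2 * (frob_norm (Y' - P))\<^sup>2 +
    \<alpha> / 4 * (frob_norm (Y' - Y))\<^sup>2 + \<mu> * K / 2 * (frob_norm (M - Y))\<^sup>2 + ((\<mu> * K)\<^sup>2 / \<alpha> + \<mu> * K / 2) * e\<^sup>2"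
proof -
  define a where "a = frob_norm (Y' - Y)"
  define d where "d = frob_norm (M - Y)"
  have ad: "a \<ge> 0" "d \<ge> 0" by (auto simp: a_def d_def frob_norm_nonneg)
  have "frob_norm (M - Y') \<le> d + a"
    using frob_norm_triangle[OF M Y Y'] frob_norm_minus_commute[OF Y Y'] by (simp add: a_def d_def)
  then have "frob_norm (M - Y') * frob_norm (Q - P) \<le> (d + a) * (K * e)"
    using PQ ad by (intro mult_mono) (auto simp: frob_norm_nonneg)
  then have "frob_inner (M - Y') (Q - P) \<le> (d + a) * (K * e)"
    using frob_Cauchy_Schwarz[OF minus_carrier_mat[OF Y', of M] minus_carrier_mat[OF P, of Q]] by linarith
  then have "\<mu> * frob_inner (M - Y') (Q - P) \<le> \<mu> * ((d + a) * (K * e))"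
    using \<mu> by (intro mult_left_mono) auto
  also have "\<dots> = \<mu> * K * (d * e) + a * (\<mu> * K * e)" by (simp add: algebra_simps)
  also have "\<dots> \<le> \<mu> * K * ((d\<^sup>2 + e\<^sup>2) / 2) + (\<alpha> / 4 * a\<^sup>2 + (\<mu> * K)\<^sup>2 / \<alpha> * e\<^sup>2)"
  proof (rule add_mono)
    show "\<mu> * K * (d * e) \<le> \<mu> * K * ((d\<^sup>2 + e\<^sup>2) / 2)"
      using \<mu> K sum_squares_bound[of d e] by (intro mult_left_mono) auto
    \<comment> \<open>Young's inequality, weighted so that only half of the proximal gain
      \<open>\<alpha> / 2 * a\<^sup>2\<close> is spent; the other half is left for the
      descent.\<close>
    have "0 \<le> (\<alpha> / 2 * a - \<mu> * K * e)\<^sup>2 / \<alpha>" using \<alpha> by simp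
    also have "\<dots> = \<alpha> / 4 * a\<^sup>2 + (\<mu> * K)\<^sup>2 / \<alpha> * e\<^sup>2 - a * (\<mu> * K * e)"
      using \<alpha> by (simp add: power2_eq_square field_simps)
    finally show "a * (\<mu> * K * e) \<le> \<alpha> / 4 * a\<^sup>2 + (\<mu> * K)\<^sup>2 / \<alpha> * e\<^sup>2" by simp
  qed
  finally have "\<mu> / 2 * (2 * frob_inner (M - Y') (Q - P)) \<le>
      \<alpha> / 4 * a\<^sup>2 + \<mu> * K / 2 * d\<^sup>2 + ((\<mu> * K)\<^sup>2 / \<alpha> + \<mu> * K / 2) * e\<^sup>2"
    by (simp add: algebra_simps add_divide_distrib)
  then show ?thesis
    unfolding frob_norm_parallelogram[OF M Y' P Q, symmetric] a_def d_def by (simp add: algebra_simps)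
qed


text \<open>Minimality of the image compares the new iterate with the new matrices paired with
  \<open>fst z\<close>. Minimality of the matrices, after the coupling has been exchanged from
  \<open>fst (Z k)\<close> to \<open>fst z\<close>, compares that pair with \<open>z\<close>. Adding
  both gives the claim.\<close>

lemma PARM_sequence_step:
  fixes R :: "nat \<Rightarrow> real^'N \<Rightarrow> real mat" and W :: "real^'N^'N" and f :: "real^'N \<Rightarrow> ereal" and Z :: "nat \<Rightarrow> 'N var"
  assumes J: "J \<ge> 1" and \<tau>: "\<tau> > 0"
    and \<mu>: "\<And>j. j \<in> {1..J} \<Longrightarrow> \<mu> j > 0" and lam: "\<And>j. j \<in> {1..J} \<Longrightarrow> lam j > 0"
    and R: "\<And>j. j \<in> {1..J} \<Longrightarrow> linear_to_mat (m j) (n j) (R j)"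
    and W_eq: "W = W_matrix J \<mu> R" and W: "sym_pos_def W"
    and f: "proper f" and conc: "concave_on {0..} g"
    and der: "\<And>t. t \<ge> 0 \<Longrightarrow> (g has_real_derivative g' t) (at t within {0..})"
    and lip: "L-lipschitz_on {0..} g'"
    and parm: "PARM_sequence J m n \<tau> \<mu> lam R f g g' \<alpha> \<beta> Z"
    and \<alpha>_lo: "0 < \<alpha>_lo" and \<alpha>: "\<And>j k. j \<in> {1..J} \<Longrightarrow> \<alpha>_lo \<le> \<alpha> j k \<and> \<alpha> j k \<le> \<alpha>_hi"
    and \<beta>_lo: "0 < \<beta>_lo" and \<beta>: "\<And>k. \<beta>_lo \<le> \<beta> k \<and> \<beta> k \<le> \<beta>_hi"
  defines "\<Phi> \<equiv> Phi J m \<tau> \<mu> lam R f g"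
  shows "\<exists>c>0. \<exists>C\<ge>0. \<forall>k. \<forall>z\<in>Z_space J m n.
    \<Phi> (Z (Suc k)) + ereal (c * (Z_norm J W (Z (Suc k) - Z k))\<^sup>2) \<le> \<Phi> z + ereal (C * (Z_norm J W (z - Z k))\<^sup>2)"
proof -
  define q where "q = (\<lambda>j x M. \<mu> j / 2 * (frob_norm (M - R j x))\<^sup>2)"
  define S where "S = (\<lambda>j M. lam j * (\<Sum>i=1..m j. g (singular_value M i)))"
  have \<Phi>_eq: "\<Phi> z = ereal \<tau> * f (fst z) + ereal (\<Sum>j=1..J. q j (fst z) (snd z j) + S j (snd z j))" for z
    by (simp add: \<Phi>_def Phi_def q_def S_def)
  have "\<forall>j\<in>{1..J}. \<exists>K\<ge>0. \<forall>x y. frob_norm (R j x - R j y) \<le> K * norm_W W (x - y)"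
    using linear_to_mat_bounded_W[OF R W] by blast
  then obtain K where K: "\<forall>j\<in>{1..J}. K j \<ge> 0 \<and> (\<forall>x y. frob_norm (R j x - R j y) \<le> K j * norm_W W (x - y))"
    by (rule bchoice[THEN exE])
  define C1 where "C1 = (\<lambda>j. \<alpha>_hi / 2 + lam j * (real (m j) * L))"
  define C2 where "C2 = (\<lambda>j. \<mu> j * K j / 2)"
  define C3 where "C3 = (\<lambda>j. (\<mu> j * K j)\<^sup>2 / \<alpha>_lo + \<mu> j * K j / 2)"
  have \<alpha>_hi: "\<alpha>_hi > 0" using \<alpha>_lo \<alpha>[of 1 0] J by simp
  have \<beta>_hi: "\<beta>_hi > 0" using \<beta>_lo \<beta>[of 0] by simp
  have C_nonneg: "C1 j \<ge> 0" "C2 j \<ge> 0" "C3 j \<ge> 0" if "j \<in> {1..J}" for j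
    using that \<alpha>_hi \<alpha>_lo \<mu>[OF that] lam[OF that] K lipschitz_on_nonneg[OF lip]
    by (auto simp: C1_def C2_def C3_def)
  \<comment> \<open>\<open>\<alpha>_lo / 4\<close> is what the exchange leaves of
    \<open>\<alpha>_lo / 2\<close>; the image block keeps \<open>\<beta>_lo / 2\<close> in
    full.\<close>
  define c where "c = min (\<alpha>_lo / 4) (\<beta>_lo / 2)"
  \<comment> \<open>\<open>C1\<close> comes from the linearization of \<open>g\<close> and the
    proximal term, \<open>C2\<close> and \<open>C3\<close> from the exchange. The sum over all
    blocks is needed because every block contributes \<open>C3 j\<close> times the same image
    distance.\<close>
  define C where "C = \<beta>_hi / 2 + (\<Sum>j=1..J. C1 j + C2 j + C3 j)"
  have c: "c > 0" using \<alpha>_lo \<beta>_lo by (simp add: c_def)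
  have C: "C \<ge> 0" unfolding C_def using \<beta>_hi C_nonneg by (intro add_nonneg_nonneg sum_nonneg) auto
  have "\<Phi> (Z (Suc k)) + ereal (c * (Z_norm J W (Z (Suc k) - Z k))\<^sup>2) \<le> \<Phi> z + ereal (C * (Z_norm J W (z - Z k))\<^sup>2)"
    if z: "z \<in> Z_space J m n" for k z
  proof (cases "f (fst z)")
    case PInf
    then show ?thesis using \<tau> by (simp add: \<Phi>_eq)
  next
    case MInf
    then show ?thesis using f by (simp add: proper_def)
  next
    case (real f\<^sub>z)
    define x where "x = fst (Z k)"
    define x' where "x' = fst (Z (Suc k))"
    define Y where "Y = snd (Z k)"
    define Y' where "Y' = snd (Z (Suc k))"
    define a where "a = (\<lambda>j. (frob_norm (Y' j - Y j))\<^sup>2)"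
    define d where "d = (\<lambda>j. (frob_norm (snd z j - Y j))\<^sup>2)"
    define b where "b = (norm_W W (x' - x))\<^sup>2"
    define e where "e = (norm_W W (fst z - x))\<^sup>2"
    have ZV: "Z l \<in> Z_space J m n" for l using parm by (simp add: PARM_sequence_def)
    have dist_sq: "(Z_norm J W (Z (Suc k) - Z k))\<^sup>2 = b + (\<Sum>j=1..J. a j)" "(Z_norm J W (z - Z k))\<^sup>2 = e + (\<Sum>j=1..J. d j)"
      by (simp_all add: Z_norm_power2 a_def b_def d_def e_def x_def x'_def Y_def Y'_def)
    have argmin_x: "\<Phi> (x', Y') + ereal (\<beta> k / 2 * b) \<le> \<Phi> (fst z, Y') + ereal (\<beta> k / 2 * e)"
      using parm unfolding PARM_sequence_def is_arg_min_def \<Phi>_def[symmetric] W_eq[symmetric]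
      by (auto simp: b_def e_def x'_def x_def Y'_def not_less)
    have "f x' \<noteq> \<infinity>"
    proof
      assume "f x' = \<infinity>"
      then show False using argmin_x real \<tau> by (simp add: \<Phi>_eq)
    qed
    moreover have "f x' \<noteq> -\<infinity>" using f by (simp add: proper_def)
    ultimately obtain f' where f': "f x' = ereal f'" by (cases "f x'") auto
    have x_step: "\<tau> * f' + (\<Sum>j=1..J. q j x' (Y' j) + S j (Y' j)) + \<beta> k / 2 * b \<le>
        \<tau> * f\<^sub>z + (\<Sum>j=1..J. q j (fst z) (Y' j) + S j (Y' j)) + \<beta> k / 2 * e"
      using argmin_x by (simp add: \<Phi>_eq f' real)
    have Y_step: "q j (fst z) (Y' j) + S j (Y' j) + \<alpha>_lo / 4 * a j \<le>
        q j (fst z) (snd z j) + S j (snd z j) + ((C1 j + C2 j) * d j + C3 j * e)" if j: "j \<in> {1..J}" for j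
    proof -
      have Yj: "Y j \<in> carrier_mat (m j) (n j)" and Y'j: "Y' j \<in> carrier_mat (m j) (n j)" and zj: "snd z j \<in> carrier_mat (m j) (n j)"
        using Z_spaceD[OF ZV j] Z_spaceD[OF z j] by (auto simp: Y_def Y'_def)
      have Rj: "R j v \<in> carrier_mat (m j) (n j)" for v using R[OF j] by (simp add: linear_to_mat_def)
      have "q j x (Y' j) + lam j * (\<Sum>i=1..m j. g' (singular_value (Y j) i) * singular_value (Y' j) i) + \<alpha> j k / 2 * a j \<le>
          q j x (snd z j) + lam j * (\<Sum>i=1..m j. g' (singular_value (Y j) i) * singular_value (snd z j) i) + \<alpha> j k / 2 * d j"
        using parm j zj unfolding PARM_sequence_def is_arg_min_def
        by (auto simp: q_def a_def d_def x_def Y'_def Y_def not_less)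
      then have 1: "q j x (Y' j) + S j (Y' j) + \<alpha>_lo / 2 * a j \<le> q j x (snd z j) + S j (snd z j) + C1 j * d j"
        unfolding S_def C1_def a_def d_def
        by (intro matrix_step_estimate[OF conc der lip Yj Y'j zj lam[OF j]]) (use \<alpha>[OF j] in auto)
      have "frob_norm (R j (fst z) - R j x) \<le> K j * norm_W W (fst z - x)" using K j by blast
      then have 2: "q j x (snd z j) + q j (fst z) (Y' j) \<le>
          q j (fst z) (snd z j) + q j x (Y' j) + \<alpha>_lo / 4 * a j + C2 j * d j + C3 j * e"
        unfolding q_def C2_def C3_def a_def d_def e_def
        using K j by (intro coupling_exchange[OF Yj Y'j zj Rj Rj \<mu>[OF j] \<alpha>_lo]) auto
      show ?thesis using 1 2 unfolding distrib_right by linarith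
    qed
    have "(\<Sum>j=1..J. q j (fst z) (Y' j) + S j (Y' j)) + \<alpha>_lo / 4 * (\<Sum>j=1..J. a j) =
        (\<Sum>j=1..J. q j (fst z) (Y' j) + S j (Y' j) + \<alpha>_lo / 4 * a j)"
      by (simp add: sum.distrib sum_distrib_left)
    also have "\<dots> \<le> (\<Sum>j=1..J. q j (fst z) (snd z j) + S j (snd z j) + ((C1 j + C2 j) * d j + C3 j * e))"
      by (intro sum_mono Y_step)
    also have "\<dots> = (\<Sum>j=1..J. q j (fst z) (snd z j) + S j (snd z j)) + (\<Sum>j=1..J. (C1 j + C2 j) * d j) + (\<Sum>j=1..J. C3 j) * e"
      by (simp add: sum.distrib sum_distrib_right)
    finally have sum_step: "(\<Sum>j=1..J. q j (fst z) (Y' j) + S j (Y' j)) + \<alpha>_lo / 4 * (\<Sum>j=1..J. a j) \<le>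
        (\<Sum>j=1..J. q j (fst z) (snd z j) + S j (snd z j)) + (\<Sum>j=1..J. (C1 j + C2 j) * d j) + (\<Sum>j=1..J. C3 j) * e" .
    have nn: "a j \<ge> 0" "d j \<ge> 0" "b \<ge> 0" "e \<ge> 0" for j by (auto simp: a_def b_def d_def e_def)
    have "c * (b + (\<Sum>j=1..J. a j)) \<le> \<beta> k / 2 * b + \<alpha>_lo / 4 * (\<Sum>j=1..J. a j)"
      unfolding distrib_left using \<beta>[of k] nn
      by (intro add_mono mult_right_mono sum_nonneg) (auto simp: c_def min_le_iff_disj)
    moreover have "\<beta> k / 2 * e + (\<Sum>j=1..J. (C1 j + C2 j) * d j) + (\<Sum>j=1..J. C3 j) * e \<le> C * (e + (\<Sum>j=1..J. d j))"
    proof -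
      have "\<beta> k / 2 * e \<le> \<beta>_hi / 2 * e" using \<beta>[of k] nn by (intro mult_right_mono) auto
      moreover have "(\<Sum>j=1..J. C3 j) * e \<le> (\<Sum>j=1..J. C1 j + C2 j + C3 j) * e"
        using C_nonneg nn by (intro mult_right_mono sum_mono) (auto simp: add_nonneg_nonneg)
      ultimately have "\<beta> k / 2 * e + (\<Sum>j=1..J. C3 j) * e \<le> C * e"
        unfolding C_def distrib_right by linarith
      moreover have "(\<Sum>j=1..J. (C1 j + C2 j) * d j) \<le> (\<Sum>j=1..J. C * d j)"
      proof (intro sum_mono mult_right_mono nn)
        fix j assume j: "j \<in> {1..J}"
        have "C1 j + C2 j + C3 j \<le> (\<Sum>j=1..J. C1 j + C2 j + C3 j)"
          using j C_nonneg by (intro member_le_sum) (auto simp: add_nonneg_nonneg)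
        then show "C1 j + C2 j \<le> C" using C_nonneg(3)[OF j] \<beta>_hi by (simp add: C_def)
      qed
      ultimately show ?thesis by (simp add: distrib_left sum_distrib_left)
    qed
    ultimately have "\<tau> * f' + (\<Sum>j=1..J. q j x' (Y' j) + S j (Y' j)) + c * (b + (\<Sum>j=1..J. a j)) \<le>
        \<tau> * f\<^sub>z + (\<Sum>j=1..J. q j (fst z) (snd z j) + S j (snd z j)) + C * (e + (\<Sum>j=1..J. d j))"
      using x_step sum_step by linarith
    then show ?thesis
      unfolding \<Phi>_eq dist_sq using f' real by (simp add: x'_def Y'_def)
  qed
  then show ?thesis using c C by blast
qed

section \<open>Lower semicontinuity of the objective and the conclusion\<close>

text \<open>Apart from \<open>f\<close>, every term is continuous: the coupling by boundedness of
  \<open>R j\<close>, the spectral term by Weyl's inequality.\<close>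

lemma Z_lsc_Phi:
  fixes R :: "nat \<Rightarrow> real^'N \<Rightarrow> real mat" and W :: "real^'N^'N" and f :: "real^'N \<Rightarrow> ereal"
  assumes \<tau>: "\<tau> > 0" and R: "\<And>j. j \<in> {1..J} \<Longrightarrow> linear_to_mat (m j) (n j) (R j)" and W: "sym_pos_def W"
    and f: "proper f" and lsc: "lower_semicontinuous f"
    and der: "\<And>t. t \<ge> 0 \<Longrightarrow> (g has_real_derivative g' t) (at t within {0..})"
  shows "Z_lsc J m n W (Phi J m \<tau> \<mu> lam R f g)"
  unfolding Z_lsc_def
proof (intro allI impI, elim conjE)
  fix X :: "nat \<Rightarrow> 'N var" and z :: "'N var" and t :: ereal
  assume X: "\<forall>l. X l \<in> Z_space J m n" and z: "z \<in> Z_space J m n"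
    and lim: "(\<lambda>l. Z_norm J W (X l - z)) \<longlonglongrightarrow> 0" and t: "t < Phi J m \<tau> \<mu> lam R f g z"
  define G where "G = (\<lambda>z. \<Sum>j=1..J. \<mu> j / 2 * (frob_norm (snd z j - R j (fst z)))\<^sup>2 +
      lam j * (\<Sum>i=1..m j. g (singular_value (snd z j) i)))"
  have Phi_eq: "Phi J m \<tau> \<mu> lam R f g y = ereal \<tau> * f (fst y) + ereal (G y)" for y
    by (simp add: Phi_def G_def)
  have x_lim: "(\<lambda>l. fst (X l)) \<longlonglongrightarrow> fst z" by (rule Z_norm_tendsto_zeroD(1)[OF W lim])
  have g_cont: "continuous_on {0..} g"
    using der by (auto simp: continuous_on_eq_continuous_within intro: DERIV_continuous)
  have G_lim: "(\<lambda>l. G (X l)) \<longlonglongrightarrow> G z"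
    unfolding G_def
  proof (intro tendsto_intros)
    fix j assume j: "j \<in> {1..J}"
    have Xj: "snd (X l) j \<in> carrier_mat (m j) (n j)" and zj: "snd z j \<in> carrier_mat (m j) (n j)"
      and Rj: "R j v \<in> carrier_mat (m j) (n j)" for l v
      using Z_spaceD[OF X[rule_format] j] Z_spaceD[OF z j] R[OF j] by (simp_all add: linear_to_mat_def)
    have Y_lim: "(\<lambda>l. frob_norm (snd (X l) j - snd z j)) \<longlonglongrightarrow> 0" by (rule Z_norm_tendsto_zeroD(2)[OF W lim j])
    obtain K where K: "\<And>x y. frob_norm (R j x - R j y) \<le> K * norm_W W (x - y)"
      using linear_to_mat_bounded_W[OF R[OF j] W] by blast
    show "(\<lambda>l. frob_norm (snd (X l) j - R j (fst (X l)))) \<longlonglongrightarrow> frob_norm (snd z j - R j (fst z))"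
    proof (rule LIM_zero_cancel, rule tendsto_rabs_zero_cancel, rule tendsto_sandwich[OF _ _ tendsto_const])
      have "(\<lambda>l. frob_norm (snd (X l) j - snd z j) + K * norm_W W (fst (X l) - fst z)) \<longlonglongrightarrow> 0 + K * 0"
        using x_lim by (intro tendsto_intros Y_lim) (simp add: norm_W_tendsto_zero_iff[OF W])
      then show "(\<lambda>l. frob_norm (snd (X l) j - snd z j) + K * norm_W W (fst (X l) - fst z)) \<longlonglongrightarrow> 0" by simp
      have "\<bar>frob_norm (snd (X l) j - R j (fst (X l))) - frob_norm (snd z j - R j (fst z))\<bar> \<le>
          frob_norm (snd (X l) j - snd z j) + K * norm_W W (fst (X l) - fst z)" for l
        using frob_norm_triangle[OF Xj[of l] zj Rj[of "fst (X l)"]] frob_norm_triangle[OF zj Rj[of "fst z"] Rj[of "fst (X l)"]]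
          frob_norm_triangle[OF zj Xj[of l] Rj[of "fst z"]] frob_norm_triangle[OF Xj[of l] Rj[of "fst (X l)"] Rj[of "fst z"]]
          frob_norm_minus_commute[OF zj Xj[of l]] frob_norm_minus_commute[OF Rj[of "fst z"] Rj[of "fst (X l)"]]
          K[of "fst (X l)" "fst z"]
        by linarith
      then show "\<forall>\<^sub>F l in sequentially. \<bar>frob_norm (snd (X l) j - R j (fst (X l))) - frob_norm (snd z j - R j (fst z))\<bar> \<le>
          frob_norm (snd (X l) j - snd z j) + K * norm_W W (fst (X l) - fst z)" by simp
    qed simp
    fix i assume i: "i \<in> {1..m j}"
    have "(\<lambda>l. singular_value (snd (X l) j) i) \<longlonglongrightarrow> singular_value (snd z j) i"
    proof (rule LIM_zero_cancel, rule tendsto_rabs_zero_cancel, rule tendsto_sandwich[OF _ _ tendsto_const Y_lim])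
      show "\<forall>\<^sub>F l in sequentially. \<bar>singular_value (snd (X l) j) i - singular_value (snd z j) i\<bar> \<le> frob_norm (snd (X l) j - snd z j)"
        using singular_value_lipschitz[OF Xj zj] i by simp
    qed simp
    then show "(\<lambda>l. g (singular_value (snd (X l) j) i)) \<longlonglongrightarrow> g (singular_value (snd z j) i)"
      using i singular_value_nonneg[OF Xj] singular_value_nonneg[OF zj]
      by (intro continuous_on_tendsto_compose[OF g_cont]) auto
  qed
  show "\<forall>\<^sub>F l in sequentially. t < Phi J m \<tau> \<mu> lam R f g (X l)"
  proof (cases "t = -\<infinity>")
    case True
    have "Phi J m \<tau> \<mu> lam R f g y \<noteq> -\<infinity>" for y
      using f \<tau> by (cases "f (fst y)") (auto simp: Phi_eq proper_def)
    then show ?thesis using True by simp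
  next
    case False
    then obtain v where v: "t = ereal v" using t by (cases t) auto
    have "ereal ((v - G z) / \<tau>) < f (fst z)"
      using t \<tau> unfolding v Phi_eq by (cases "f (fst z)") (auto simp: field_simps)
    \<comment> \<open>\<open>w\<close> splits the strict inequality into one for \<open>f\<close>
      alone and one for the continuous part \<open>G\<close> alone, both of which persist along the
      sequence.\<close>
    then obtain w where w: "ereal ((v - G z) / \<tau>) < ereal w" "ereal w < f (fst z)" using ereal_dense2 by blast
    have "\<forall>\<^sub>F x in at (fst z). ereal w < f x"
      using lsc w(2) unfolding lower_semicontinuous_def by (metis less_le_trans less_LiminfD)
    then have "\<forall>\<^sub>F x in nhds (fst z). ereal w < f x" using w(2) by (auto simp: eventually_at_filter elim: eventually_mono)
    then have "\<forall>\<^sub>F l in sequentially. ereal w < f (fst (X l))" using x_lim by (rule eventually_compose_filterlim)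
    moreover have "\<forall>\<^sub>F l in sequentially. v - \<tau> * w < G (X l)"
      using w(1) \<tau> by (intro order_tendstoD(1)[OF G_lim]) (simp add: field_simps)
    ultimately show ?thesis
    proof eventually_elim
      case (elim l)
      show ?case
      proof (cases "f (fst (X l))")
        case (real r)
        then have "\<tau> * w < \<tau> * r" using elim(1) \<tau> by simp
        then show ?thesis using real elim(2) by (simp add: v Phi_eq)
      qed (use elim \<tau> in \<open>auto simp: v Phi_eq\<close>)
    qed
  qed
qed

theorem theorem4p3:
  fixes J :: nat and m n :: "nat \<Rightarrow> nat"
    and \<tau> :: real and \<mu> lam :: "nat \<Rightarrow> real"
    and R :: "nat \<Rightarrow> real^'N \<Rightarrow> real mat"
    and W :: "real^'N^'N"
    and f :: "real^'N \<Rightarrow> ereal"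
    and g g' :: "real \<Rightarrow> real" and L\<^sub>g :: real
    and \<Phi> :: "'N var \<Rightarrow> ereal"
    and \<alpha> :: "nat \<Rightarrow> nat \<Rightarrow> real" and \<beta> :: "nat \<Rightarrow> real"
    and \<alpha>_lo \<alpha>_hi \<beta>_lo \<beta>_hi :: real
    and Z :: "nat \<Rightarrow> 'N var"
  assumes "J \<ge> 1"
    and "\<And>j. j \<in> {1..J} \<Longrightarrow> 1 \<le> m j \<and> m j \<le> n j"
    and "\<tau> > 0"
    and "\<And>j. j \<in> {1..J} \<Longrightarrow> \<mu> j > 0"
    and "\<And>j. j \<in> {1..J} \<Longrightarrow> lam j > 0"
    and "\<And>j. j \<in> {1..J} \<Longrightarrow> linear_to_mat (m j) (n j) (R j)"
    and "W = W_matrix J \<mu> R" and "sym_pos_def W"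
    and "\<Phi> = Phi J m \<tau> \<mu> lam R f g"
    and "proper f" and "lower_semicontinuous f" and "(INF x. f x) > -\<infinity>"
    and "mono_on {0..} g" and "concave_on {0..} g" and "\<not> convex_on {0..} g"
    and "\<And>t. t \<ge> 0 \<Longrightarrow> (g has_real_derivative g' t) (at t within {0..})"
    and "continuous_on {0..} g'" and "L\<^sub>g-lipschitz_on {0..} g'"
    and "Z_coercive J m n W \<Phi>"
    and "PARM_sequence J m n \<tau> \<mu> lam R f g g' \<alpha> \<beta> Z"
    and "0 < \<alpha>_lo" and "\<And>j k. j \<in> {1..J} \<Longrightarrow> \<alpha>_lo \<le> \<alpha> j k \<and> \<alpha> j k \<le> \<alpha>_hi"
    and "0 < \<beta>_lo" and "\<And>k. \<beta>_lo \<le> \<beta> k \<and> \<beta> k \<le> \<beta>_hi"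
    and "KL_function (Z_space J m n) (Z_norm J W) (Z_subdiff J m n W \<Phi>) \<Phi>"
  shows "summable (\<lambda>k. Z_norm J W (Z (Suc k) - Z k)) \<and>
    (\<exists>Zs. critical_point J m n W \<Phi> Zs \<and> (\<lambda>k. Z_norm J W (Z k - Zs)) \<longlonglongrightarrow> 0)"
proof -
  note \<Phi> = \<open>\<Phi> = Phi J m \<tau> \<mu> lam R f g\<close> and parm = \<open>PARM_sequence J m n \<tau> \<mu> lam R f g g' \<alpha> \<beta> Z\<close>
  obtain c C where c: "c > 0" and C: "C \<ge> 0" and step: "\<forall>k. \<forall>z\<in>Z_space J m n.
      \<Phi> (Z (Suc k)) + ereal (c * (Z_norm J W (Z (Suc k) - Z k))\<^sup>2) \<le> \<Phi> z + ereal (C * (Z_norm J W (z - Z k))\<^sup>2)"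
    unfolding \<Phi>
    using PARM_sequence_step[OF assms(1,3-8,10,14,16,18,20-24)] by blast
  have ZV: "Z k \<in> Z_space J m n" for k using parm by (simp add: PARM_sequence_def)
  have proper: "\<Phi> z \<noteq> -\<infinity>" for z
    using \<open>proper f\<close> \<open>\<tau> > 0\<close> unfolding \<Phi> by (cases "f (fst z)") (auto simp: Phi_def proper_def)
  obtain x\<^sub>0 where x0: "f x\<^sub>0 \<noteq> \<infinity>" using \<open>proper f\<close> by (auto simp: proper_def)
  \<comment> \<open>The initial value may be infinite. A competitor with finite value in the step
    inequality makes the value of every later iterate finite.\<close>
  have "\<Phi> (x\<^sub>0, snd (Z 0)) \<noteq> \<infinity>"
    using x0 \<open>proper f\<close> \<open>\<tau> > 0\<close> unfolding \<Phi> by (cases "f x\<^sub>0") (auto simp: Phi_def proper_def)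
  then have finite: "\<Phi> (Z (Suc k)) \<noteq> \<infinity>" for k
    using step[rule_format, OF Z_space_slice_fst[OF ZV[of 0], of x\<^sub>0], of k] by auto
  have "Z_lsc J m n W \<Phi>"
    unfolding \<Phi> by (rule Z_lsc_Phi[OF assms(3,6,8,10,11,16)])
  from inexact_proximal_convergence[where h = \<Phi> and Z = Z, OF assms(8) this proper assms(19,25) ZV c C finite
      step[rule_format]]
  show ?thesis .
qed

end
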